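(* Let $(M,F)$ be a connected $n$-dimensional homogeneous Finsler space with isotropic S-curvature, i.e. ${\bf S}=(n+1)c(x)F$ for some scalar function $c$ on $M$. Suppose that $F$ has non-positive flag curvature if $n=2$, and negative flag curvature if $n>2$. Then $F$ is Riemannian or locally Minkowskian.
   Context: A Finsler metric on a smooth manifold $M$ is a function $F:TM\to[0,\infty)$, smooth on $TM_0=TM\setminus\{0\}$, positively homogeneous of degree one in $y$, whose fundamental tensor $g_{ij}(x,y)=\frac12\frac{\partial^2F^2}{\partial y^i\partial y^j}$ is positive definite. In standard local coordinates $(x^i,y^i)$ the spray coefficients are $G^i=\frac14 g^{il}\big(\frac{\partial^2F^2}{\partial x^k\partial y^l}y^k-\frac{\partial F^2}{\partial x^l}\big)$. The Riemann curvature is $R_y(u)=R^i_{\ k}(y)u^k\partial_i$ with $R^i_{\ k}=2\frac{\partial G^i}{\partial x^k}-y^j\frac{\partial^2G^i}{\partial x^j\partial y^k}+2G^j\frac{\partial^2G^i}{\partial y^j\partial y^k}-\frac{\partial G^i}{\partial y^j}\frac{\partial G^j}{\partial y^k}$, and the flag curvature of a flag $P=\mathrm{span}\{y,u\}\subset T_xM$ with flagpole $y$ is $K(x,y,P)=\frac{g_y(u,R_y(u))}{g_y(y,y)g_y(u,u)-g_y(y,u)^2}$. The Busemann–Hausdorff volume density is $\sigma_F(x)=\mathrm{Vol}(\mathbb B^n)/\mathrm{Vol}\{(y^i)\in\mathbb R^n: F(y^i\partial_i|_x)<1\}$, and the S-curvature is ${\bf S}(x,y)=\frac{\partial G^i}{\partial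 y^i}(x,y)-y^i\frac{\partial}{\partial x^i}\ln\sigma_F(x)$. $(M,F)$ is homogeneous if its group of isometries acts transitively on $M$. $F$ is Riemannian if $g_{ij}$ does not depend on $y$; $F$ is locally Minkowskian if around every point there are local coordinates in which $F$ depends only on $y$. *)

theory Defs
  imports "HOL-Analysis.Analysis"
begin

definition pd :: "'a::real_normed_vector \<Rightarrow> ('a \<Rightarrow> real) \<Rightarrow> 'a \<Rightarrow> real" where
  "pd v f x = frechet_derivative f (at x) v"

fun pds :: "'a::real_normed_vector list \<Rightarrow> ('a \<Rightarrow> real) \<Rightarrow> 'a \<Rightarrow> real" where
  "pds [] f = f"
| "pds (v # vs) f = pd v (pds vs f)"

definition smooth_on :: "'a::euclidean_space set \<Rightarrow> ('a \<Rightarrow> real) \<Rightarrow> bool" where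
  "smooth_on S f \<longleftrightarrow> (\<forall>vs. set vs \<subseteq> Basis \<longrightarrow> pds vs f differentiable_on S)"

definition smooth_map_on :: "'a::euclidean_space set \<Rightarrow> ('a \<Rightarrow> 'b::euclidean_space) \<Rightarrow> bool" where
  "smooth_map_on S f \<longleftrightarrow> (\<forall>b\<in>Basis. smooth_on S (\<lambda>x. f x \<bullet> b))"

type_synonym ('m, 'n) chart = "'m set \<times> ('m \<Rightarrow> real^'n)"

definition is_chart :: "('m::topological_space, 'n::finite) chart \<Rightarrow> bool" where
  "is_chart c \<longleftrightarrow> open (fst c) \<and> open (snd c ` fst c) \<and>
     homeomorphism (fst c) (snd c ` fst c) (snd c) (inv_into (fst c) (snd c))"

definition cinv :: "('m, 'n::finite) chart \<Rightarrow> real^'n \<Rightarrow> 'm" where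
  "cinv c = inv_into (fst c) (snd c)"

definition smooth_compat :: "('m, 'n::finite) chart \<Rightarrow> ('m, 'n) chart \<Rightarrow> bool" where
  "smooth_compat c d \<longleftrightarrow> smooth_map_on (snd c ` (fst c \<inter> fst d)) (snd d \<circ> cinv c)"

definition smooth_atlas :: "('m::topological_space, 'n::finite) chart set \<Rightarrow> bool" where
  "smooth_atlas A \<longleftrightarrow> (\<forall>c\<in>A. is_chart c) \<and> (\<Union>(fst ` A) = UNIV) \<and>
     (\<forall>c\<in>A. \<forall>d\<in>A. smooth_compat c d)"

definition trans_map :: "('m, 'n::finite) chart \<Rightarrow> ('m, 'n) chart \<Rightarrow> real^'n \<Rightarrow> real^'n" where
  "trans_map c d = snd d \<circ> cinv c"

definition dtrans :: "('m, 'n::finite) chart \<Rightarrow> ('m, 'n) chart \<Rightarrow> 'm \<Rightarrow> real^'n \<Rightarrow> real^'n" where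
  "dtrans c d p y = frechet_derivative (trans_map c d) (at (snd c p)) y"

text \<open>A function on the tangent bundle is represented by its coordinate expressions:
  F c p y is the value of F at the tangent vector at p (p in the domain of chart c)
  with components y with respect to the coordinate basis of c.\<close>

type_synonym ('m, 'n) tbfun = "('m, 'n) chart \<Rightarrow> 'm \<Rightarrow> real^'n \<Rightarrow> real"

definition Floc :: "('m, 'n::finite) tbfun \<Rightarrow> ('m, 'n) chart \<Rightarrow> (real^'n) \<times> (real^'n) \<Rightarrow> real" where
  "Floc F c z = F c (cinv c (fst z)) (snd z)"

definition Lsq :: "('m, 'n::finite) tbfun \<Rightarrow> ('m, 'n) chart \<Rightarrow> (real^'n) \<times> (real^'n) \<Rightarrow> real" where
  "Lsq F c z = (Floc F c z)^2"

definition DX :: "'n::finite \<Rightarrow> ((real^'n) \<times> (real^'n) \<Rightarrow> real) \<Rightarrow> (real^'n) \<times> (real^'n) \<Rightarrow> real" where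
  "DX i h = pd (axis i 1, 0) h"

definition DY :: "'n::finite \<Rightarrow> ((real^'n) \<times> (real^'n) \<Rightarrow> real) \<Rightarrow> (real^'n) \<times> (real^'n) \<Rightarrow> real" where
  "DY i h = pd (0, axis i 1) h"

definition gten :: "('m, 'n::finite) tbfun \<Rightarrow> ('m, 'n) chart \<Rightarrow> 'n \<Rightarrow> 'n \<Rightarrow> (real^'n) \<times> (real^'n) \<Rightarrow> real" where
  "gten F c i j z = 1/2 * DY i (DY j (Lsq F c)) z"

definition gform :: "('m, 'n::finite) tbfun \<Rightarrow> ('m, 'n) chart \<Rightarrow> (real^'n) \<times> (real^'n) \<Rightarrow> real^'n \<Rightarrow> real^'n \<Rightarrow> real" where
  "gform F c z u v = (\<Sum>i\<in>UNIV. \<Sum>j\<in>UNIV. gten F c i j z * u$i * v$j)"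

definition ginv :: "('m, 'n::finite) tbfun \<Rightarrow> ('m, 'n) chart \<Rightarrow> (real^'n) \<times> (real^'n) \<Rightarrow> real^'n^'n" where
  "ginv F c z = matrix_inv (\<chi> i j. gten F c i j z)"

definition spray :: "('m, 'n::finite) tbfun \<Rightarrow> ('m, 'n) chart \<Rightarrow> 'n \<Rightarrow> (real^'n) \<times> (real^'n) \<Rightarrow> real" where
  "spray F c i z = 1/4 * (\<Sum>l\<in>UNIV. ginv F c z $ i $ l *
      ((\<Sum>k\<in>UNIV. DX k (DY l (Lsq F c)) z * snd z $ k) - DX l (Lsq F c) z))"

definition riem :: "('m, 'n::finite) tbfun \<Rightarrow> ('m, 'n) chart \<Rightarrow> 'n \<Rightarrow> 'n \<Rightarrow> (real^'n) \<times> (real^'n) \<Rightarrow> real" where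
  "riem F c i k z =
     2 * DX k (spray F c i) z
     - (\<Sum>j\<in>UNIV. snd z $ j * DX j (DY k (spray F c i)) z)
     + 2 * (\<Sum>j\<in>UNIV. spray F c j z * DY j (DY k (spray F c i)) z)
     - (\<Sum>j\<in>UNIV. DY j (spray F c i) z * DY k (spray F c j) z)"

definition riem_op :: "('m, 'n::finite) tbfun \<Rightarrow> ('m, 'n) chart \<Rightarrow> (real^'n) \<times> (real^'n) \<Rightarrow> real^'n \<Rightarrow> real^'n" where
  "riem_op F c z u = (\<chi> i. \<Sum>k\<in>UNIV. riem F c i k z * u$k)"

definition flag_curv :: "('m, 'n::finite) tbfun \<Rightarrow> ('m, 'n) chart \<Rightarrow> real^'n \<Rightarrow> real^'n \<Rightarrow> real^'n \<Rightarrow> real" where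
  "flag_curv F c x y u =
     gform F c (x, y) u (riem_op F c (x, y) u) /
     (gform F c (x, y) y y * gform F c (x, y) u u - (gform F c (x, y) y u)^2)"

definition sigmaBH :: "('m, 'n::finite) tbfun \<Rightarrow> ('m, 'n) chart \<Rightarrow> real^'n \<Rightarrow> real" where
  "sigmaBH F c x = measure lebesgue (ball (0::real^'n) 1) / measure lebesgue {y. Floc F c (x, y) < 1}"

definition Scurv :: "('m, 'n::finite) tbfun \<Rightarrow> ('m, 'n) chart \<Rightarrow> (real^'n) \<times> (real^'n) \<Rightarrow> real" where
  "Scurv F c z = (\<Sum>i\<in>UNIV. DY i (spray F c i) z)
      - (\<Sum>i\<in>UNIV. snd z $ i * pd (axis i 1) (\<lambda>x. ln (sigmaBH F c x)) (fst z))"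

definition finsler :: "('m::topological_space, 'n::finite) chart set \<Rightarrow> ('m, 'n) tbfun \<Rightarrow> bool" where
  "finsler A F \<longleftrightarrow> smooth_atlas A \<and>
     (\<forall>c\<in>A. \<forall>d\<in>A. \<forall>p\<in>fst c \<inter> fst d. \<forall>y. F d p (dtrans c d p y) = F c p y) \<and>
     (\<forall>c\<in>A. \<forall>p\<in>fst c. \<forall>y. F c p y \<ge> 0) \<and>
     (\<forall>c\<in>A. \<forall>p\<in>fst c. \<forall>y. \<forall>t>0. F c p (t *\<^sub>R y) = t * F c p y) \<and>
     (\<forall>c\<in>A. smooth_on (snd c ` fst c \<times> (UNIV - {0})) (Floc F c)) \<and>
     (\<forall>c\<in>A. \<forall>x\<in>snd c ` fst c. \<forall>y. y \<noteq> 0 \<longrightarrow> (\<forall>v. v \<noteq> 0 \<longrightarrow> gform F c (x, y) v v > 0))"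

definition diffeo :: "('m::topological_space, 'n::finite) chart set \<Rightarrow> ('m \<Rightarrow> 'm) \<Rightarrow> bool" where
  "diffeo A \<psi> \<longleftrightarrow> bij \<psi> \<and> continuous_on UNIV \<psi> \<and> continuous_on UNIV (inv \<psi>) \<and>
     (\<forall>c\<in>A. \<forall>d\<in>A. smooth_map_on (snd c ` (fst c \<inter> \<psi> -` fst d)) (snd d \<circ> \<psi> \<circ> cinv c)) \<and>
     (\<forall>c\<in>A. \<forall>d\<in>A. smooth_map_on (snd c ` (fst c \<inter> inv \<psi> -` fst d)) (snd d \<circ> inv \<psi> \<circ> cinv c))"

definition isometry :: "('m::topological_space, 'n::finite) chart set \<Rightarrow> ('m, 'n) tbfun \<Rightarrow> ('m \<Rightarrow> 'm) \<Rightarrow> bool" where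
  "isometry A F \<psi> \<longleftrightarrow> diffeo A \<psi> \<and>
     (\<forall>c\<in>A. \<forall>d\<in>A. \<forall>p\<in>fst c. \<psi> p \<in> fst d \<longrightarrow> (\<forall>y.
        F d (\<psi> p) (frechet_derivative (snd d \<circ> \<psi> \<circ> cinv c) (at (snd c p)) y) = F c p y))"

definition homogeneous :: "('m::topological_space, 'n::finite) chart set \<Rightarrow> ('m, 'n) tbfun \<Rightarrow> bool" where
  "homogeneous A F \<longleftrightarrow> (\<forall>p q. \<exists>\<psi>. isometry A F \<psi> \<and> \<psi> p = q)"

definition isotropic_S :: "('m::topological_space, 'n::finite) chart set \<Rightarrow> ('m, 'n) tbfun \<Rightarrow> bool" where
  "isotropic_S A F \<longleftrightarrow> (\<exists>cf :: 'm \<Rightarrow> real. \<forall>c\<in>A. \<forall>x\<in>snd c ` fst c. \<forall>y. y \<noteq> 0 \<longrightarrow>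
      Scurv F c (x, y) = (real CARD('n) + 1) * cf (cinv c x) * Floc F c (x, y))"

definition flag_curv_le0 :: "('m::topological_space, 'n::finite) chart set \<Rightarrow> ('m, 'n) tbfun \<Rightarrow> bool" where
  "flag_curv_le0 A F \<longleftrightarrow> (\<forall>c\<in>A. \<forall>x\<in>snd c ` fst c. \<forall>y u. y \<noteq> 0 \<longrightarrow> u \<notin> span {y} \<longrightarrow>
      flag_curv F c x y u \<le> 0)"

definition flag_curv_lt0 :: "('m::topological_space, 'n::finite) chart set \<Rightarrow> ('m, 'n) tbfun \<Rightarrow> bool" where
  "flag_curv_lt0 A F \<longleftrightarrow> (\<forall>c\<in>A. \<forall>x\<in>snd c ` fst c. \<forall>y u. y \<noteq> 0 \<longrightarrow> u \<notin> span {y} \<longrightarrow>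
      flag_curv F c x y u < 0)"

definition riemannian :: "('m::topological_space, 'n::finite) chart set \<Rightarrow> ('m, 'n) tbfun \<Rightarrow> bool" where
  "riemannian A F \<longleftrightarrow> (\<forall>c\<in>A. \<forall>x\<in>snd c ` fst c. \<forall>y y' i j. y \<noteq> 0 \<longrightarrow> y' \<noteq> 0 \<longrightarrow>
      gten F c i j (x, y) = gten F c i j (x, y'))"

definition locally_minkowskian :: "('m::topological_space, 'n::finite) chart set \<Rightarrow> ('m, 'n) tbfun \<Rightarrow> bool" where
  "locally_minkowskian A F \<longleftrightarrow> (\<forall>p. \<exists>e :: ('m, 'n) chart. p \<in> fst e \<and> is_chart e \<and>
      (\<forall>c\<in>A. smooth_compat e c \<and> smooth_compat c e) \<and>
      (\<forall>q1\<in>fst e. \<forall>q2\<in>fst e. \<forall>c1\<in>A. \<forall>c2\<in>A. \<forall>y. q1 \<in> fst c1 \<longrightarrow> q2 \<in> fst c2 \<longrightarrow>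
         F c1 q1 (dtrans e c1 q1 y) = F c2 q2 (dtrans e c2 q2 y)))"

end

theory Submission
  imports Defs
begin

text \<open>
  Let \<open>\<tau>\<close> be the distortion, \<open>I\<close> its fibre derivative (the mean Cartan torsion) and \<open>G\<close> the geodesic
  spray, so that \<open>S = G \<tau>\<close>. By homogeneity an isometry-invariant function on the unit sphere bundle
  attains its maximum over every point, and there its derivative along \<open>G\<close> vanishes; applied to \<open>\<tau>\<close>,
  this turns isotropic S-curvature into \<open>S = 0\<close>. Commuting \<open>G\<close> with the coordinate fields then yields the
  Jacobi-type equation \<open>I'' + R I = 0\<close> along \<open>G\<close>. Hence \<open>\<phi> = |I|\<^sup>2\<close>, scaled to degree \<open>0\<close>, satisfies
  \<open>G (G \<phi>) = 2 |I'|\<^sup>2 - 2 g (I, R I) \<ge> 0\<close>, and maximizing \<open>\<plusminus> G \<phi> + \<epsilon> \<phi>\<close> on the unit sphere bundle and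
  letting \<open>\<epsilon>\<close> tend to \<open>0\<close> gives \<open>G \<phi> = 0\<close> without any completeness or geodesic flow. So \<open>I' = 0\<close> and \<open>g (I, R I) = 0\<close>.

  For negative curvature \<open>I = 0\<close>, and the metric is Riemannian by Deicke's theorem, which follows by
  integrating the divergence of the gradient of \<open>g\<^sub>k\<^sub>k\<close> over a fibre. On a surface, \<open>I' = 0\<close> and \<open>S = 0\<close> make
  the metric Berwald, with \<open>F\<close> and \<open>\<tau>\<close> constant along horizontal curves. Where \<open>I \<noteq> 0\<close>, prescribing the values
  of \<open>F\<close> and \<open>\<tau>\<close> determines a parallel vector field by the inverse function theorem; the fibre
  differentials of \<open>F\<^sup>2\<close> and \<open>\<tau>\<close> along it are closed 1-forms, and their primitives are coordinates in which
  \<open>F\<close> does not depend on the point.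
\<close>

section \<open>Smooth functions\<close>

text \<open>Nothing is assumed about the regularity of the volume density. Replacing the unit ball
  by a cutoff of \<open>F\<close> shows that it is differentiable, which is enough for
  \<open>S = G tau\<close> and for the first maximum argument. Its smoothness follows only after
  \<open>S = 0\<close>, which writes its logarithmic derivative as a trace of the spray. The term
  \<open>e * phi\<close> is needed because a maximum of \<open>GG phi / F\<close> alone yields just
  \<open>GG (GG phi) = 0\<close> there and no bound on \<open>GG phi\<close>; with the extra term
  the critical point equation ties \<open>GG phi\<close> to the convexity of \<open>phi\<close>. On
  a surface the third vertical derivative of the spray is symmetric and annihilates the flagpole, so
  a single vector \<open>b\<close> is left in it. The conditions \<open>S = 0\<close> and
  \<open>I' = 0\<close> each give one linear equation for \<open>b\<close>, and the two are
  independent. This is how a surface gets by with curvature that may vanish. Homogeneity acts twice: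
  it makes a fibrewise maximum a global one, and it carries a nonzero \<open>I\<close> from one
  point to every point, where the flat coordinates can then start.\<close>

lemma pd_has_derivative:
  assumes "f differentiable (at x)"
  shows "(f has_derivative (\<lambda>v. pd v f x)) (at x)"
proof -
  have "(f has_derivative (frechet_derivative f (at x))) (at x)"
    using assms frechet_derivative_works by blast
  moreover have "(\<lambda>v. pd v f x) = frechet_derivative f (at x)"
    by (auto simp: pd_def)
  ultimately show ?thesis by simp
qed

lemma pd_eqI: "(f has_derivative f') (at x) \<Longrightarrow> pd v f x = f' v"
  unfolding pd_def by (metis frechet_derivative_at)

lemma has_derivative_cong_open:
  assumes "open S" "x \<in> S" "\<And>y. y \<in> S \<Longrightarrow> f y = g y"
  shows "(f has_derivative D) (at x) \<longleftrightarrow> (g has_derivative D) (at x)"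
  using has_derivative_transform_within_open[of f D x UNIV S g]
    has_derivative_transform_within_open[of g D x UNIV S f] assms by auto

lemma pd_cong_open:
  assumes "open S" "x \<in> S" "\<And>y. y \<in> S \<Longrightarrow> f y = g y"
  shows "pd v f x = pd v g x"
  unfolding pd_def frechet_derivative_def using has_derivative_cong_open[OF assms] by simp

lemma differentiable_cong_open:
  assumes "open S" "x \<in> S" "\<And>y. y \<in> S \<Longrightarrow> f y = g y" "f differentiable (at x)"
  shows "g differentiable (at x)"
  using has_derivative_cong_open[of S x f g] assms unfolding differentiable_def by blast

lemma differentiable_on_openD:
  assumes "f differentiable_on S" "open S" "x \<in> S" shows "f differentiable (at x)"
  using assms by (simp add: differentiable_on_eq_differentiable_at)

lemma pd_const [simp]: "pd v (\<lambda>x. k) x = 0"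
  by (rule pd_eqI[where f'="\<lambda>_. 0", simplified]) auto

lemma pd_add:
  assumes "f differentiable (at x)" "g differentiable (at x)"
  shows "pd v (\<lambda>x. f x + g x) x = pd v f x + pd v g x"
  by (rule pd_eqI) (intro has_derivative_add pd_has_derivative assms)

lemma pd_diff:
  assumes "f differentiable (at x)" "g differentiable (at x)"
  shows "pd v (\<lambda>x. f x - g x) x = pd v f x - pd v g x"
  by (rule pd_eqI) (intro has_derivative_diff pd_has_derivative assms)

lemma pd_mult:
  assumes "f differentiable (at x)" "g differentiable (at x)"
  shows "pd v (\<lambda>x. f x * g x) x = pd v f x * g x + f x * pd v g x"
  using pd_eqI[OF has_derivative_mult[OF pd_has_derivative[OF assms(1)] pd_has_derivative[OF assms(2)]]]
  by (simp add: add.commute)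

lemma pd_cmult:
  assumes "f differentiable (at x)"
  shows "pd v (\<lambda>x. k * f x) x = k * pd v f x"
  using pd_mult[OF _ assms, of "\<lambda>_. k"] by simp

lemma pd_sum:
  assumes "\<And>i. i \<in> I \<Longrightarrow> f i differentiable (at x)"
  shows "pd v (\<lambda>x. \<Sum>i\<in>I. f i x) x = (\<Sum>i\<in>I. pd v (f i) x)"
  by (rule pd_eqI) (intro has_derivative_sum pd_has_derivative assms)

lemma pd_inverse:
  assumes "f differentiable (at x)" "f x \<noteq> 0"
  shows "pd v (\<lambda>x. inverse (f x)) x = - (pd v f x * inverse (f x) * inverse (f x))"
  by (rule pd_eqI[OF has_derivative_eq_rhs[OF Deriv.has_derivative_inverse[OF assms(2) pd_has_derivative[OF assms(1)]]]])
     (auto simp: fun_eq_iff)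

lemma pd_ln:
  assumes "f differentiable (at x)" "f x > 0"
  shows "pd v (\<lambda>x. ln (f x)) x = pd v f x * inverse (f x)"
  by (rule pd_eqI[OF has_derivative_eq_rhs[OF has_derivative_ln[OF assms(2) pd_has_derivative[OF assms(1)]]]])
     (auto simp: fun_eq_iff divide_inverse)

lemma pd_linear:
  assumes "f differentiable (at x)"
  shows "linear (\<lambda>v. pd v f x)"
  using has_derivative_linear[OF pd_has_derivative[OF assms]] .

lemma pd_expand:
  fixes x :: "'a::euclidean_space"
  assumes "f differentiable (at x)"
  shows "pd v f x = (\<Sum>b\<in>Basis. (v \<bullet> b) * pd b f x)"
proof -
  have "pd v f x = pd (\<Sum>b\<in>Basis. (v \<bullet> b) *\<^sub>R b) f x" by (simp add: euclidean_representation)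
  also have "\<dots> = (\<Sum>b\<in>Basis. (v \<bullet> b) * pd b f x)"
    using linear_sum[OF pd_linear[OF assms], of "\<lambda>b. (v \<bullet> b) *\<^sub>R b" Basis] linear_cmul[OF pd_linear[OF assms]] by simp
  finally show ?thesis .
qed

lemma pd_chain:
  assumes "(\<phi> has_derivative D) (at x)" "h differentiable (at (\<phi> x))"
  shows "pd v (\<lambda>x. h (\<phi> x)) x = pd (D v) h (\<phi> x)"
  using pd_eqI[OF has_derivative_compose[OF assms(1) pd_has_derivative[OF assms(2)]]] by simp

section \<open>Calculus of functions with all iterated partial derivatives\<close>

lemma pds_append: "pds (vs @ ws) f = pds vs (pds ws f)"
  by (induction vs) auto

lemma smooth_on_imp_differentiable:
  assumes "smooth_on S f" "open S" "x \<in> S" shows "f differentiable (at x)"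
  using assms differentiable_on_openD unfolding smooth_on_def by (metis empty_set empty_subsetI pds.simps(1))

lemma smooth_on_pd:
  assumes "smooth_on S f" "b \<in> Basis" shows "smooth_on S (pd b f)"
  unfolding smooth_on_def
proof (intro allI impI)
  fix vs assume "set vs \<subseteq> (Basis::'a set)"
  then have "set (vs @ [b]) \<subseteq> Basis" using assms by auto
  then have "pds (vs @ [b]) f differentiable_on S" using assms unfolding smooth_on_def by blast
  then show "pds vs (pd b f) differentiable_on S" by (simp add: pds_append)
qed

text \<open>Iterated partials never leave a class \<open>P\<close> that is closed under basis
  partials. Agreement on the open set \<open>S\<close> is enough for this, since derivatives there
  see only local values. Most closure properties below, and several regularity bootstraps later,
  amount to exhibiting a suitable \<open>P\<close>.\<close>

lemma smooth_coinduct: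
  assumes S: "open S" and f: "P f"
    and diff: "\<And>f x. P f \<Longrightarrow> x \<in> S \<Longrightarrow> f differentiable (at x)"
    and step: "\<And>f b. P f \<Longrightarrow> b \<in> Basis \<Longrightarrow> \<exists>g. P g \<and> (\<forall>x\<in>S. pd b f x = g x)"
  shows "smooth_on S f"
  unfolding smooth_on_def
proof (intro allI impI)
  fix vs :: "'a list" assume vs: "set vs \<subseteq> Basis"
  have "\<exists>g. P g \<and> (\<forall>x\<in>S. pds vs f x = g x)" using vs
  proof (induction vs)
    case Nil then show ?case using f by auto
  next
    case (Cons v vs)
    then obtain g where g: "P g" "\<forall>x\<in>S. pds vs f x = g x" by auto
    moreover obtain k where "P k" "\<forall>x\<in>S. pd v g x = k x" using step[OF g(1), of v] Cons.prems by auto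
    ultimately show ?case using pd_cong_open[OF S, of _ "pds vs f" g v] by fastforce
  qed
  then obtain g where g: "P g" "\<forall>x\<in>S. pds vs f x = g x" by auto
  have "pds vs f differentiable (at x)" if "x \<in> S" for x
    using differentiable_cong_open[OF S that, of g "pds vs f"] g(2) diff[OF g(1) that] by auto
  then show "pds vs f differentiable_on S"
    by (simp add: differentiable_on_eq_differentiable_at S)
qed

lemma smooth_on_cong:
  assumes "open S" "smooth_on S f" "\<And>x. x \<in> S \<Longrightarrow> f x = g x"
  shows "smooth_on S g"
proof (rule smooth_coinduct[OF assms(1), where P="\<lambda>g. \<exists>f. smooth_on S f \<and> (\<forall>x\<in>S. f x = g x)"])
  show "\<exists>f. smooth_on S f \<and> (\<forall>x\<in>S. f x = g x)" using assms by auto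
next
  fix g x assume "\<exists>f. smooth_on S f \<and> (\<forall>x\<in>S. f x = g x)" "x \<in> S"
  then show "g differentiable (at x)"
    using differentiable_cong_open[OF assms(1)] smooth_on_imp_differentiable assms(1) by metis
next
  fix g and b :: 'a assume "\<exists>f. smooth_on S f \<and> (\<forall>x\<in>S. f x = g x)" "b \<in> Basis"
  then obtain f where f: "smooth_on S f" "\<forall>x\<in>S. f x = g x" by auto
  have "\<forall>x\<in>S. pd b g x = pd b f x" using pd_cong_open[OF assms(1), of _ g f b] f(2) by auto
  then show "\<exists>k. (\<exists>f. smooth_on S f \<and> (\<forall>x\<in>S. f x = k x)) \<and> (\<forall>x\<in>S. pd b g x = k x)"
    using smooth_on_pd[OF f(1) \<open>b \<in> Basis\<close>] by auto
qed

lemma smooth_on_subset: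
  assumes "smooth_on S f" "T \<subseteq> S" shows "smooth_on T f"
  using assms differentiable_on_subset unfolding smooth_on_def by blast

text \<open>The derivative of a product, an inverse or a logarithm mixes these operations. The
  generated algebra is stable under all partials at once and so serves as one common invariant for
  \<open>smooth_coinduct\<close>.\<close>

inductive smooth_alg :: "'a::euclidean_space set \<Rightarrow> ('a \<Rightarrow> real) \<Rightarrow> bool" for S where
  base: "smooth_on S f \<Longrightarrow> smooth_alg S f"
| const: "smooth_alg S (\<lambda>_. k)"
| add: "smooth_alg S f \<Longrightarrow> smooth_alg S g \<Longrightarrow> smooth_alg S (\<lambda>x. f x + g x)"
| mult: "smooth_alg S f \<Longrightarrow> smooth_alg S g \<Longrightarrow> smooth_alg S (\<lambda>x. f x * g x)"
| inverse: "smooth_alg S f \<Longrightarrow> (\<And>x. x \<in> S \<Longrightarrow> f x \<noteq> 0) \<Longrightarrow> smooth_alg S (\<lambda>x. inverse (f x))"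
| ln: "smooth_alg S f \<Longrightarrow> (\<And>x. x \<in> S \<Longrightarrow> f x > 0) \<Longrightarrow> smooth_alg S (\<lambda>x. ln (f x))"

lemma smooth_alg_step:
  assumes "smooth_alg S f" "open S"
  shows "(\<forall>x\<in>S. f differentiable (at x)) \<and> (\<forall>b\<in>Basis. \<exists>g. smooth_alg S g \<and> (\<forall>x\<in>S. pd b f x = g x))"
  using assms(1)
proof (induction rule: smooth_alg.induct)
  case (base f)
  then show ?case using smooth_on_imp_differentiable[OF _ assms(2)] smooth_on_pd smooth_alg.base by blast
next
  case (const k)
  then show ?case using smooth_alg.const[of S 0] by auto
next
  case (add f g)
  show ?case
  proof (intro conjI ballI)
    fix b :: 'a assume b: "b \<in> Basis"
    then obtain f1 g1 where "smooth_alg S f1" "\<forall>x\<in>S. pd b f x = f1 x" "smooth_alg S g1" "\<forall>x\<in>S. pd b g x = g1 x"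
      using add.IH by metis
    then show "\<exists>h. smooth_alg S h \<and> (\<forall>x\<in>S. pd b (\<lambda>x. f x + g x) x = h x)"
      using add.IH by (intro exI[of _ "\<lambda>x. f1 x + g1 x"]) (auto simp: pd_add intro: smooth_alg.intros)
  qed (use add.IH in auto)
next
  case (mult f g)
  show ?case
  proof (intro conjI ballI)
    fix b :: 'a assume b: "b \<in> Basis"
    then obtain f1 g1 where "smooth_alg S f1" "\<forall>x\<in>S. pd b f x = f1 x" "smooth_alg S g1" "\<forall>x\<in>S. pd b g x = g1 x"
      using mult.IH by metis
    then show "\<exists>h. smooth_alg S h \<and> (\<forall>x\<in>S. pd b (\<lambda>x. f x * g x) x = h x)"
      using mult.IH mult.hyps by (intro exI[of _ "\<lambda>x. f1 x * g x + f x * g1 x"]) (auto simp: pd_mult intro!: smooth_alg.add smooth_alg.mult)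
  qed (use mult.IH in auto)
next
  case (inverse f)
  show ?case
  proof (intro conjI ballI)
    fix b :: 'a assume b: "b \<in> Basis"
    then obtain f1 where "smooth_alg S f1" "\<forall>x\<in>S. pd b f x = f1 x"
      using inverse.IH by metis
    then show "\<exists>h. smooth_alg S h \<and> (\<forall>x\<in>S. pd b (\<lambda>x. inverse (f x)) x = h x)"
      using inverse.IH inverse.hyps
      by (intro exI[of _ "\<lambda>x. (-1) * (f1 x * inverse (f x) * inverse (f x))"] conjI smooth_alg.mult smooth_alg.const smooth_alg.inverse)
         (auto simp: pd_inverse)
  qed (use inverse in \<open>auto intro!: differentiable_inverse\<close>)
next
  case (ln f)
  show ?case
  proof (intro conjI ballI)
    fix b :: 'a assume b: "b \<in> Basis"
    then obtain f1 where "smooth_alg S f1" "\<forall>x\<in>S. pd b f x = f1 x"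
      using ln.IH by metis
    moreover have "smooth_alg S (\<lambda>x. inverse (f x))"
      by (rule smooth_alg.inverse) (use ln.hyps in force)+
    ultimately show "\<exists>h. smooth_alg S h \<and> (\<forall>x\<in>S. pd b (\<lambda>x. ln (f x)) x = h x)"
      using ln.IH ln.hyps
      by (intro exI[of _ "\<lambda>x. f1 x * inverse (f x)"]) (auto simp: pd_ln intro!: smooth_alg.mult)
  next
    fix x assume "x \<in> S"
    then show "(\<lambda>x. ln (f x)) differentiable (at x)" using ln has_derivative_ln
      unfolding differentiable_def by blast
  qed
qed

lemma smooth_alg_smooth:
  assumes "open S" "smooth_alg S f" shows "smooth_on S f"
  by (rule smooth_coinduct[of S "smooth_alg S"]) (use assms smooth_alg_step in blast)+

lemma smooth_on_const [simp]: "open S \<Longrightarrow> smooth_on S (\<lambda>_. k)"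
  by (blast intro: smooth_alg_smooth smooth_alg.intros)

lemma smooth_on_add: "open S \<Longrightarrow> smooth_on S f \<Longrightarrow> smooth_on S g \<Longrightarrow> smooth_on S (\<lambda>x. f x + g x)"
  by (blast intro: smooth_alg_smooth smooth_alg.intros)

lemma smooth_on_mult: "open S \<Longrightarrow> smooth_on S f \<Longrightarrow> smooth_on S g \<Longrightarrow> smooth_on S (\<lambda>x. f x * g x)"
  by (blast intro: smooth_alg_smooth smooth_alg.intros)

lemma smooth_on_inverse:
  "open S \<Longrightarrow> smooth_on S f \<Longrightarrow> (\<And>x. x \<in> S \<Longrightarrow> f x \<noteq> 0) \<Longrightarrow> smooth_on S (\<lambda>x. inverse (f x))"
  by (rule smooth_alg_smooth) (auto intro: smooth_alg.intros)

lemma smooth_on_ln: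
  "open S \<Longrightarrow> smooth_on S f \<Longrightarrow> (\<And>x. x \<in> S \<Longrightarrow> f x > 0) \<Longrightarrow> smooth_on S (\<lambda>x. ln (f x))"
  by (rule smooth_alg_smooth) (auto intro: smooth_alg.intros)

lemma smooth_on_cmult: "open S \<Longrightarrow> smooth_on S f \<Longrightarrow> smooth_on S (\<lambda>x. k * f x)"
  by (rule smooth_on_mult) auto

lemma smooth_on_diff: "open S \<Longrightarrow> smooth_on S f \<Longrightarrow> smooth_on S g \<Longrightarrow> smooth_on S (\<lambda>x. f x - g x)"
  using smooth_on_add[of S f "\<lambda>x. (-1) * g x"] smooth_on_cmult[of S g "-1"] by simp

lemma smooth_on_sum:
  assumes "open S" "\<And>i. i \<in> I \<Longrightarrow> smooth_on S (f i)"
  shows "smooth_on S (\<lambda>x. \<Sum>i\<in>I. f i x)"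
  using assms by (induction I rule: infinite_finite_induct) (auto intro: smooth_on_add)

lemma smooth_on_prod:
  assumes "open S" "\<And>i. i \<in> I \<Longrightarrow> smooth_on S (f i)"
  shows "smooth_on S (\<lambda>x. \<Prod>i\<in>I. f i x)"
  using assms by (induction I rule: infinite_finite_induct) (auto intro: smooth_on_mult)

lemma smooth_on_power: "open S \<Longrightarrow> smooth_on S f \<Longrightarrow> smooth_on S (\<lambda>x. f x ^ k)"
  by (induction k) (auto intro: smooth_on_mult)

lemma smooth_on_divide:
  "open S \<Longrightarrow> smooth_on S f \<Longrightarrow> smooth_on S g \<Longrightarrow> (\<And>x. x \<in> S \<Longrightarrow> g x \<noteq> 0) \<Longrightarrow> smooth_on S (\<lambda>x. f x / g x)"
  unfolding divide_inverse by (intro smooth_on_mult smooth_on_inverse)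

lemma smooth_on_bounded_linear:
  assumes "open S" "bounded_linear f" shows "smooth_on S f"
proof (rule smooth_coinduct[OF assms(1), where P="\<lambda>f. bounded_linear f \<or> (\<exists>k. f = (\<lambda>_. k))"])
  fix f :: "'a \<Rightarrow> real" and b :: 'a assume f: "bounded_linear f \<or> (\<exists>k. f = (\<lambda>_. k))"
  have "\<exists>k. \<forall>x\<in>S. pd b f x = k"
  proof (cases "bounded_linear f")
    case True
    then show ?thesis using pd_eqI[OF bounded_linear_imp_has_derivative[OF True]] by blast
  qed (use f in auto)
  then show "\<exists>g. (bounded_linear g \<or> (\<exists>k. g = (\<lambda>_. k))) \<and> (\<forall>x\<in>S. pd b f x = g x)" by blast
qed (use assms bounded_linear_imp_differentiable in auto)

lemma smooth_on_imp_continuous: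
  assumes "smooth_on S f" "open S" shows "continuous_on S f"
  using assms by (simp add: continuous_at_imp_continuous_on differentiable_imp_continuous_within smooth_on_imp_differentiable)

lemma smooth_map_on_has_derivative:
  assumes "smooth_map_on S \<phi>" "open S" "x \<in> S"
  shows "(\<phi> has_derivative (\<lambda>v. \<Sum>b\<in>Basis. pd v (\<lambda>x. \<phi> x \<bullet> b) x *\<^sub>R b)) (at x)"
proof (subst has_derivative_componentwise_within, intro ballI)
  fix b :: 'b assume b: "b \<in> Basis"
  have "((\<lambda>x. \<phi> x \<bullet> b) has_derivative (\<lambda>v. pd v (\<lambda>x. \<phi> x \<bullet> b) x)) (at x)"
    using assms b smooth_on_imp_differentiable[OF _ assms(2,3)]
    by (intro pd_has_derivative) (auto simp: smooth_map_on_def)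
  then show "((\<lambda>x. \<phi> x \<bullet> b) has_derivative (\<lambda>v. (\<Sum>b\<in>Basis. pd v (\<lambda>x. \<phi> x \<bullet> b) x *\<^sub>R b) \<bullet> b)) (at x)"
    using b by (simp add: inner_sum_left inner_Basis if_distrib sum.delta cong: if_cong)
qed

lemma pd_chain_Basis:
  fixes \<phi> :: "'a::euclidean_space \<Rightarrow> 'b::euclidean_space"
  assumes "\<And>b. b \<in> Basis \<Longrightarrow> (\<lambda>x. \<phi> x \<bullet> b) differentiable (at x)" "h differentiable (at (\<phi> x))"
  shows "(\<lambda>x. h (\<phi> x)) differentiable (at x)"
    and "pd v (\<lambda>x. h (\<phi> x)) x = (\<Sum>b\<in>Basis. pd b h (\<phi> x) * pd v (\<lambda>x. \<phi> x \<bullet> b) x)"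
proof -
  have D: "(\<phi> has_derivative (\<lambda>v. \<Sum>b\<in>Basis. pd v (\<lambda>x. \<phi> x \<bullet> b) x *\<^sub>R b)) (at x)" (is "(_ has_derivative ?D) _")
  proof (subst has_derivative_componentwise_within, intro ballI)
    fix b :: 'b assume b: "b \<in> Basis"
    show "((\<lambda>x. \<phi> x \<bullet> b) has_derivative (\<lambda>v. (\<Sum>b\<in>Basis. pd v (\<lambda>x. \<phi> x \<bullet> b) x *\<^sub>R b) \<bullet> b)) (at x)"
      using pd_has_derivative[OF assms(1)[OF b]] b
      by (simp add: inner_sum_left inner_Basis if_distrib sum.delta cong: if_cong)
  qed
  show "(\<lambda>x. h (\<phi> x)) differentiable (at x)"
    using has_derivative_compose[OF D pd_has_derivative[OF assms(2)]] unfolding differentiable_def by blast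
  have "pd v (\<lambda>x. h (\<phi> x)) x = pd (?D v) h (\<phi> x)"
    by (rule pd_chain[OF D assms(2)])
  also have "\<dots> = (\<Sum>b\<in>Basis. (?D v \<bullet> b) * pd b h (\<phi> x))" by (rule pd_expand[OF assms(2)])
  also have "\<dots> = (\<Sum>b\<in>Basis. pd b h (\<phi> x) * pd v (\<lambda>x. \<phi> x \<bullet> b) x)"
    by (intro sum.cong refl) (simp add: inner_sum_left inner_Basis if_distrib sum.delta cong: if_cong)
  finally show "pd v (\<lambda>x. h (\<phi> x)) x = (\<Sum>b\<in>Basis. pd b h (\<phi> x) * pd v (\<lambda>x. \<phi> x \<bullet> b) x)" .
qed

text \<open>By the chain rule, partials of \<open>h (\<phi> x)\<close> are sums of functions of
  \<open>\<phi> x\<close> times functions of \<open>x\<close>. Finite sums of this shape form the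
  invariant class; their index sets are sets of naturals so that the class can be described by an
  existential over a fixed type.\<close>

lemma smooth_on_compose:
  fixes \<phi> :: "'a::euclidean_space \<Rightarrow> 'b::euclidean_space"
  assumes S: "open S" and T: "open T" and \<phi>: "smooth_map_on S \<phi>" "\<And>x. x \<in> S \<Longrightarrow> \<phi> x \<in> T"
    and h: "smooth_on T h"
  shows "smooth_on S (\<lambda>x. h (\<phi> x))"
proof (rule smooth_coinduct[OF S, where P="\<lambda>f. \<exists>(I::nat set) h k. finite I \<and> (\<forall>i\<in>I. smooth_on T (h i) \<and> smooth_on S (k i)) \<and> f = (\<lambda>x. \<Sum>i\<in>I. h i (\<phi> x) * k i x)"])
  show "\<exists>(I::nat set) h' k. finite I \<and> (\<forall>i\<in>I. smooth_on T (h' i) \<and> smooth_on S (k i)) \<and> (\<lambda>x. h (\<phi> x)) = (\<lambda>x. \<Sum>i\<in>I. h' i (\<phi> x) * k i x)"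
    by (intro exI[of _ "{0::nat}"] exI[of _ "\<lambda>_. h"] exI[of _ "\<lambda>_ _. 1"]) (auto simp: h S)
next
  fix f x assume "\<exists>(I::nat set) h k. finite I \<and> (\<forall>i\<in>I. smooth_on T (h i) \<and> smooth_on S (k i)) \<and> f = (\<lambda>x. \<Sum>i\<in>I. h i (\<phi> x) * k i x)" and x: "x \<in> S"
  then obtain I :: "nat set" and h k where *: "finite I" "\<forall>i\<in>I. smooth_on T (h i) \<and> smooth_on S (k i)" "f = (\<lambda>x. \<Sum>i\<in>I. h i (\<phi> x) * k i x)" by blast
  have "(\<lambda>x. h i (\<phi> x) * k i x) differentiable (at x)" if "i \<in> I" for i
  proof (rule differentiable_mult)
    show "(\<lambda>x. h i (\<phi> x)) differentiable (at x)"
      using that * \<phi> x smooth_on_imp_differentiable[OF _ S] smooth_on_imp_differentiable[OF _ T]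
      by (intro pd_chain_Basis(1)[of \<phi> x "h i"]) (auto simp: smooth_map_on_def)
    show "k i differentiable (at x)" using that * x S smooth_on_imp_differentiable by blast
  qed
  then show "f differentiable (at x)" unfolding *(3) using *(1) by (intro differentiable_sum) auto
next
  fix f and b :: 'a assume "\<exists>(I::nat set) h k. finite I \<and> (\<forall>i\<in>I. smooth_on T (h i) \<and> smooth_on S (k i)) \<and> f = (\<lambda>x. \<Sum>i\<in>I. h i (\<phi> x) * k i x)" and b: "b \<in> Basis"
  then obtain I :: "nat set" and h k where *: "finite I" "\<forall>i\<in>I. smooth_on T (h i) \<and> smooth_on S (k i)" "f = (\<lambda>x. \<Sum>i\<in>I. h i (\<phi> x) * k i x)" by blast
  \<comment> \<open>The index \<open>(i, 0)\<close> stands for the term in which the derivative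
    falls on \<open>k i\<close>, and \<open>(i, c)\<close> with a basis vector \<open>c\<close> for
    one term of the chain rule. The vector 0 is free as a tag, being no basis vector.\<close>
  define K where "K = I \<times> (insert 0 Basis :: 'b set)"
  define h' where "h' = (\<lambda>(i,c::'b). if c = 0 then h i else pd c (h i))"
  define k' where "k' = (\<lambda>(i,c::'b) x. if c = 0 then pd b (k i) x else pd b (\<lambda>x. \<phi> x \<bullet> c) x * k i x)"
  have finK: "finite K" unfolding K_def using * by auto
  have smk: "smooth_on T (h' p) \<and> smooth_on S (k' p)" if pK: "p \<in> K" for p
  proof -
    obtain i c where p: "p = (i,c)" "i \<in> I" "c = 0 \<or> c \<in> Basis" using pK unfolding K_def by auto
    show ?thesis
    proof (cases "c = 0")
      case True
      then show ?thesis using p * b by (simp add: h'_def k'_def smooth_on_pd)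
    next
      case False
      then have "c \<in> Basis" using p by auto
      then have "smooth_on S (pd b (\<lambda>x. \<phi> x \<bullet> c))" using \<phi> b by (auto simp: smooth_map_on_def smooth_on_pd)
      then show ?thesis using p * b False \<open>c \<in> Basis\<close>
        by (auto simp: h'_def k'_def smooth_on_pd intro!: smooth_on_mult S)
    qed
  qed
  have eq: "pd b f x = (\<Sum>p\<in>K. h' p (\<phi> x) * k' p x)" if x: "x \<in> S" for x
  proof -
    have c1: "(\<lambda>x. \<phi> x \<bullet> c) differentiable (at x)" if "c \<in> Basis" for c
      using that \<phi> smooth_on_imp_differentiable[OF _ S x] by (simp add: smooth_map_on_def)
    have c2: "h i differentiable (at (\<phi> x))" if "i \<in> I" for i
      using that * \<phi> x T smooth_on_imp_differentiable by blast
    have d2: "k i differentiable (at x)" if "i \<in> I" for i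
      using that * x S smooth_on_imp_differentiable by blast
    note d1 = pd_chain_Basis(1)[OF c1 c2] and d3 = pd_chain_Basis(2)[OF c1 c2]
    have "pd b f x = (\<Sum>i\<in>I. pd b (\<lambda>x. h i (\<phi> x) * k i x) x)"
      unfolding *(3) by (rule pd_sum) (intro differentiable_mult d1 d2)
    also have "\<dots> = (\<Sum>i\<in>I. h i (\<phi> x) * pd b (k i) x + (\<Sum>c\<in>Basis. pd c (h i) (\<phi> x) * pd b (\<lambda>x. \<phi> x \<bullet> c) x) * k i x)"
      by (intro sum.cong refl) (simp add: pd_mult d1 d2 d3)
    also have "\<dots> = (\<Sum>i\<in>I. \<Sum>c\<in>insert 0 Basis. h' (i,c) (\<phi> x) * k' (i,c) x)"
    proof (intro sum.cong refl)
      fix i assume "i \<in> I"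
      have "(\<Sum>c\<in>Basis. h' (i,c) (\<phi> x) * k' (i,c) x) = (\<Sum>c\<in>Basis. pd c (h i) (\<phi> x) * pd b (\<lambda>x. \<phi> x \<bullet> c) x) * k i x"
        unfolding sum_distrib_right by (intro sum.cong refl) (auto simp: h'_def k'_def)
      then show "h i (\<phi> x) * pd b (k i) x + (\<Sum>c\<in>Basis. pd c (h i) (\<phi> x) * pd b (\<lambda>x. \<phi> x \<bullet> c) x) * k i x = (\<Sum>c\<in>insert 0 Basis. h' (i,c) (\<phi> x) * k' (i,c) x)"
        by (simp add: h'_def k'_def)
    qed
    also have "\<dots> = (\<Sum>p\<in>K. h' p (\<phi> x) * k' p x)"
      unfolding K_def sum.cartesian_product by (simp add: case_prod_unfold)
    finally show ?thesis .
  qed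
  \<comment> \<open>Renumbering by naturals returns to the index type fixed in the
    invariant.\<close>
  obtain e :: "nat \<Rightarrow> nat \<times> 'b" where e: "bij_betw e {0..<card K} K" using ex_bij_betw_nat_finite[OF finK] by blast
  have "(\<Sum>p\<in>K. h' p (\<phi> x) * k' p x) = (\<Sum>i\<in>{0..<card K}. h' (e i) (\<phi> x) * k' (e i) x)" for x
    using sum.reindex_bij_betw[OF e, of "\<lambda>p. h' p (\<phi> x) * k' p x"] by simp
  then have eq': "\<forall>x\<in>S. pd b f x = (\<lambda>x. \<Sum>i\<in>{0..<card K}. h' (e i) (\<phi> x) * k' (e i) x) x" using eq by simp
  have sm': "\<forall>i\<in>{0..<card K}. smooth_on T (h' (e i)) \<and> smooth_on S (k' (e i))"
    using smk bij_betwE[OF e] by blast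
  show "\<exists>g. (\<exists>(I::nat set) h k. finite I \<and> (\<forall>i\<in>I. smooth_on T (h i) \<and> smooth_on S (k i)) \<and> g = (\<lambda>x. \<Sum>i\<in>I. h i (\<phi> x) * k i x)) \<and> (\<forall>x\<in>S. pd b f x = g x)"
    by (rule exI, rule conjI[OF _ eq'], rule exI[of _ "{0..<card K}"], rule exI[of _ "\<lambda>i. h' (e i)"], rule exI[of _ "\<lambda>i. k' (e i)"])
       (use sm' in auto)
qed

section \<open>Symmetry of second partial derivatives\<close>

lemma mixed_difference_mvt:
  fixes f :: "'a::euclidean_space \<Rightarrow> real"
  assumes S: "open S" "smooth_on S f" and uv: "u \<in> Basis" "v \<in> Basis"
    and d: "ball x d \<subseteq> S" "0 < h" "2 * h < d"
  shows "\<exists>y\<in>ball x d. f (x + h *\<^sub>R u + h *\<^sub>R v) - f (x + h *\<^sub>R u) - f (x + h *\<^sub>R v) + f x = h * h * pd v (pd u f) y"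
proof -
  have inb: "x + s *\<^sub>R u + t *\<^sub>R v \<in> ball x d" if "0 \<le> s" "s \<le> h" "0 \<le> t" "t \<le> h" for s t
  proof -
    have "norm (s *\<^sub>R u + t *\<^sub>R v) \<le> s + t"
      using norm_triangle_ineq[of "s *\<^sub>R u" "t *\<^sub>R v"] that uv by simp
    moreover have "dist x (x + s *\<^sub>R u + t *\<^sub>R v) = norm (s *\<^sub>R u + t *\<^sub>R v)"
      by (subst dist_commute) (simp add: dist_norm add.assoc)
    ultimately show ?thesis using that d(3) by simp
  qed
  have du: "((\<lambda>s. f (x + s *\<^sub>R u + t *\<^sub>R v)) has_derivative (\<lambda>r. r * pd u f (x + s *\<^sub>R u + t *\<^sub>R v))) (at s)"
    if "0 \<le> s" "s \<le> h" "0 \<le> t" "t \<le> h" for s t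
  proof -
    have "f differentiable (at (x + s *\<^sub>R u + t *\<^sub>R v))"
      using inb[OF that] d(1) smooth_on_imp_differentiable S by blast
    note D = pd_has_derivative[OF this]
    have "((\<lambda>s. x + s *\<^sub>R u + t *\<^sub>R v) has_derivative (\<lambda>r. r *\<^sub>R u)) (at s)"
      by (auto intro!: derivative_eq_intros)
    from has_derivative_compose[OF this D] show ?thesis
      by (rule has_derivative_eq_rhs) (simp add: linear_cmul[OF has_derivative_linear[OF D]])
  qed
  \<comment> \<open>Mean value theorem in the direction \<open>u\<close>, applied to the difference
    of \<open>f\<close> along two parallel segments; a second application in the direction
    \<open>v\<close> follows below.\<close>
  have "\<exists>s\<in>{0<..<h}. (f (x + h *\<^sub>R u + h *\<^sub>R v) - f (x + h *\<^sub>R u + 0 *\<^sub>R v)) - (f (x + 0 *\<^sub>R u + h *\<^sub>R v) - f (x + 0 *\<^sub>R u + 0 *\<^sub>R v))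
      = (h - 0) * pd u f (x + s *\<^sub>R u + h *\<^sub>R v) - (h - 0) * pd u f (x + s *\<^sub>R u + 0 *\<^sub>R v)"
  proof (rule mvt_simple[OF d(2), where f="\<lambda>s. f (x + s *\<^sub>R u + h *\<^sub>R v) - f (x + s *\<^sub>R u + 0 *\<^sub>R v)" and f'="\<lambda>s r. r * pd u f (x + s *\<^sub>R u + h *\<^sub>R v) - r * pd u f (x + s *\<^sub>R u + 0 *\<^sub>R v)"])
    fix s assume "0 \<le> s" "s \<le> h"
    then show "((\<lambda>s. f (x + s *\<^sub>R u + h *\<^sub>R v) - f (x + s *\<^sub>R u + 0 *\<^sub>R v)) has_derivative
       (\<lambda>r. r * pd u f (x + s *\<^sub>R u + h *\<^sub>R v) - r * pd u f (x + s *\<^sub>R u + 0 *\<^sub>R v))) (at s within {0..h})"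
      by (intro has_derivative_at_withinI[OF has_derivative_diff[OF du[of s h] du[of s 0]]]) (use d(2) in simp_all)
  qed
  then obtain s where s0: "s \<in> {0<..<h}" and eq0: "(f (x + h *\<^sub>R u + h *\<^sub>R v) - f (x + h *\<^sub>R u + 0 *\<^sub>R v)) - (f (x + 0 *\<^sub>R u + h *\<^sub>R v) - f (x + 0 *\<^sub>R u + 0 *\<^sub>R v))
      = (h - 0) * pd u f (x + s *\<^sub>R u + h *\<^sub>R v) - (h - 0) * pd u f (x + s *\<^sub>R u + 0 *\<^sub>R v)" by (elim bexE)
  have s: "0 < s" "s < h" using s0 by auto
  have eq1: "f (x + h *\<^sub>R u + h *\<^sub>R v) - f (x + h *\<^sub>R u) - f (x + h *\<^sub>R v) + f x
      = h * (pd u f (x + s *\<^sub>R u + h *\<^sub>R v) - pd u f (x + s *\<^sub>R u + 0 *\<^sub>R v))"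
    using eq0 by (simp add: right_diff_distrib)
  have dv: "((\<lambda>t. pd u f (x + s *\<^sub>R u + t *\<^sub>R v)) has_derivative (\<lambda>r. r * pd v (pd u f) (x + s *\<^sub>R u + t *\<^sub>R v))) (at t)"
    if "0 \<le> t" "t \<le> h" for t
  proof -
    have "pd u f differentiable (at (x + s *\<^sub>R u + t *\<^sub>R v))"
      using inb[of s t] that s d(1) smooth_on_imp_differentiable[OF smooth_on_pd[OF S(2) uv(1)] S(1)] by auto
    note D = pd_has_derivative[OF this]
    have "((\<lambda>t. x + s *\<^sub>R u + t *\<^sub>R v) has_derivative (\<lambda>r. r *\<^sub>R v)) (at t)"
      by (auto intro!: derivative_eq_intros)
    from has_derivative_compose[OF this D] show ?thesis
      by (rule has_derivative_eq_rhs) (simp add: linear_cmul[OF has_derivative_linear[OF D]])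
  qed
  have "\<exists>t\<in>{0<..<h}. pd u f (x + s *\<^sub>R u + h *\<^sub>R v) - pd u f (x + s *\<^sub>R u + 0 *\<^sub>R v) = (h - 0) * pd v (pd u f) (x + s *\<^sub>R u + t *\<^sub>R v)"
    by (rule mvt_simple[OF d(2)]) (auto intro: has_derivative_at_withinI[OF dv])
  then obtain t where "0 < t" "t < h" "pd u f (x + s *\<^sub>R u + h *\<^sub>R v) - pd u f (x + s *\<^sub>R u + 0 *\<^sub>R v) = h * pd v (pd u f) (x + s *\<^sub>R u + t *\<^sub>R v)" by auto
  then show ?thesis using eq1 inb[of s t] s by (intro bexI[of _ "x + s *\<^sub>R u + t *\<^sub>R v"]) auto
qed

text \<open>The second difference is symmetric in \<open>u\<close> and \<open>v\<close>, so near
  \<open>x\<close> the two mixed partials share a value, though at different points. If they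
  differed at \<open>x\<close>, continuity would keep those values apart.\<close>

lemma pd_commute:
  fixes f :: "'a::euclidean_space \<Rightarrow> real"
  assumes S: "open S" "smooth_on S f" "x \<in> S" and uv: "u \<in> Basis" "v \<in> Basis"
  shows "pd u (pd v f) x = pd v (pd u f) x"
proof (rule ccontr)
  assume ne: "pd u (pd v f) x \<noteq> pd v (pd u f) x"
  define e where "e = \<bar>pd u (pd v f) x - pd v (pd u f) x\<bar> / 2"
  have e: "e > 0" using ne by (simp add: e_def)
  have c: "continuous (at x) (pd u (pd v f))" "continuous (at x) (pd v (pd u f))"
    using smooth_on_imp_differentiable[OF smooth_on_pd[OF smooth_on_pd] S(1,3)] S uv differentiable_imp_continuous_within by blast+
  obtain d1 where d1: "d1 > 0" "\<And>y. dist y x < d1 \<Longrightarrow> dist (pd u (pd v f) y) (pd u (pd v f) x) < e"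
    using c(1) e unfolding continuous_at_eps_delta by (auto simp: dist_norm)
  obtain d2 where d2: "d2 > 0" "\<And>y. dist y x < d2 \<Longrightarrow> dist (pd v (pd u f) y) (pd v (pd u f) x) < e"
    using c(2) e unfolding continuous_at_eps_delta by (auto simp: dist_norm)
  obtain d3 where d3: "d3 > 0" "ball x d3 \<subseteq> S" using S by (meson openE)
  define d where "d = min d1 (min d2 d3)"
  have d: "d > 0" "ball x d \<subseteq> S" using d1 d2 d3 by (auto simp: d_def)
  define h where "h = d / 3"
  have h: "0 < h" "2 * h < d" using d by (auto simp: h_def)
  obtain y where y: "y \<in> ball x d" "f (x + h *\<^sub>R u + h *\<^sub>R v) - f (x + h *\<^sub>R u) - f (x + h *\<^sub>R v) + f x = h * h * pd v (pd u f) y"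
    using mixed_difference_mvt[OF S(1,2) uv d(2) h] by blast
  obtain y' where y': "y' \<in> ball x d" "f (x + h *\<^sub>R v + h *\<^sub>R u) - f (x + h *\<^sub>R v) - f (x + h *\<^sub>R u) + f x = h * h * pd u (pd v f) y'"
    using mixed_difference_mvt[OF S(1,2) uv(2,1) d(2) h] by blast
  have "f (x + h *\<^sub>R v + h *\<^sub>R u) = f (x + h *\<^sub>R u + h *\<^sub>R v)" by (simp add: ac_simps)
  then have "h * h * pd v (pd u f) y = h * h * pd u (pd v f) y'" using y(2) y'(2) by linarith
  then have "pd v (pd u f) y = pd u (pd v f) y'" using h by simp
  moreover have "\<bar>pd u (pd v f) y' - pd u (pd v f) x\<bar> < e" "\<bar>pd v (pd u f) y - pd v (pd u f) x\<bar> < e"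
    using d1(2)[of y'] d2(2)[of y] y(1) y'(1) by (auto simp: d_def dist_commute dist_real_def)
  ultimately show False unfolding e_def by argo
qed

section \<open>Matrices\<close>

lemma
  fixes A :: "real^'n^'n"
  assumes "invertible A"
  shows matrix_inv_right: "A ** matrix_inv A = mat 1" and matrix_inv_left: "matrix_inv A ** A = mat 1"
  using someI_ex[of "\<lambda>B. A ** B = mat 1 \<and> B ** A = mat 1"] assms
  unfolding matrix_inv_def invertible_def by auto

lemma matrix_inv_right_entry:
  fixes A :: "real^'n^'n"
  assumes "invertible A"
  shows "(\<Sum>l\<in>UNIV. A $ k $ l * matrix_inv A $ l $ j) = (if k = j then 1 else 0)"
  using arg_cong[OF matrix_inv_right[OF assms], of "\<lambda>B. B $ k $ j"]
  by (simp add: matrix_matrix_mult_def mat_def)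

lemma matrix_inv_left_entry:
  fixes A :: "real^'n^'n"
  assumes "invertible A"
  shows "(\<Sum>l\<in>UNIV. matrix_inv A $ k $ l * A $ l $ j) = (if k = j then 1 else 0)"
  using arg_cong[OF matrix_inv_left[OF assms], of "\<lambda>B. B $ k $ j"]
  by (simp add: matrix_matrix_mult_def mat_def)

text \<open>Cramer's rule shows each entry of the inverse to be a quotient of polynomials in the
  entries of \<open>A\<close>; smoothness of the inverse metric rests on this.\<close>

lemma matrix_inv_cramer:
  fixes A :: "real^'n^'n"
  assumes "det A \<noteq> 0"
  shows "matrix_inv A $ i $ j = det (\<chi> k l. if l = i then (if k = j then 1 else 0) else A $ k $ l) / det A"
proof -
  have inv: "invertible A" using assms invertible_det_nz by blast
  have "A *v (\<chi> l. matrix_inv A $ l $ j) = (\<chi> k. if k = j then 1 else 0)"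
    by (simp add: matrix_vector_mult_def matrix_inv_right_entry[OF inv])
  then have "(\<chi> l. matrix_inv A $ l $ j) = (\<chi> k. det (\<chi> i l. if l = k then (\<chi> k. if k = j then 1 else 0) $ i else A $ i $ l) / det A)"
    by (simp only: cramer[OF assms])
  from arg_cong[OF this, of "\<lambda>v. v $ i"] show ?thesis by (simp add: if_distrib cong: if_cong)
qed

lemma smooth_on_det:
  fixes M :: "'a::euclidean_space \<Rightarrow> real^'n^'n"
  assumes "open S" "\<And>i j. smooth_on S (\<lambda>x. M x $ i $ j)"
  shows "smooth_on S (\<lambda>x. det (M x))"
  unfolding det_def by (intro smooth_on_sum smooth_on_mult smooth_on_prod smooth_on_const assms)

lemma smooth_on_matrix_inv:
  fixes M :: "'a::euclidean_space \<Rightarrow> real^'n^'n"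
  assumes S: "open S" and M: "\<And>i j. smooth_on S (\<lambda>x. M x $ i $ j)" and nz: "\<And>x. x \<in> S \<Longrightarrow> det (M x) \<noteq> 0"
  shows "smooth_on S (\<lambda>x. matrix_inv (M x) $ i $ j)"
proof (rule smooth_on_cong[OF S])
  have "smooth_on S (\<lambda>x. (\<chi> k l. if l = i then (if k = j then 1 else 0) else M x $ k $ l) $ a $ b)" for a b
    using M S by (cases "b = i") auto
  then show "smooth_on S (\<lambda>x. det (\<chi> k l. if l = i then (if k = j then 1 else 0) else M x $ k $ l) / det (M x))"
    by (intro smooth_on_divide smooth_on_det S M nz)
qed (simp add: matrix_inv_cramer nz)

lemma det_replace_row:
  fixes A :: "real^'n^'n"
  assumes "invertible A"
  shows "det (\<chi> k. if k = i then r else A $ k) = (\<Sum>j\<in>UNIV. r $ j * matrix_inv A $ j $ i) * det A"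
proof -
  define c where "c = (\<chi> i. \<Sum>j\<in>UNIV. r $ j * matrix_inv A $ j $ i)"
  have "(\<Sum>i\<in>UNIV. c $ i *s row i A) $ k = r $ k" for k
  proof -
    have "(\<Sum>i\<in>UNIV. c $ i *s row i A) $ k = (\<Sum>i\<in>UNIV. \<Sum>j\<in>UNIV. r $ j * (matrix_inv A $ j $ i * A $ i $ k))"
      by (simp add: c_def row_def sum_distrib_right mult.assoc)
    also have "\<dots> = (\<Sum>j\<in>UNIV. r $ j * (\<Sum>i\<in>UNIV. matrix_inv A $ j $ i * A $ i $ k))"
      by (subst sum.swap) (simp add: sum_distrib_left)
    also have "\<dots> = r $ k" by (simp add: matrix_inv_left_entry[OF assms] if_distrib sum.delta cong: if_cong)
    finally show ?thesis .
  qed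
  then have "(\<Sum>i\<in>UNIV. c $ i *s row i A) = r" by (simp add: vec_eq_iff)
  then have "(\<chi> k. if k = i then r else A $ k) = (\<chi> k. if k = i then (\<Sum>i\<in>UNIV. c $ i *s row i A) else row k A)"
    by (simp add: vec_eq_iff row_def)
  then have "det (\<chi> k. if k = i then r else A $ k) = c $ i * det A"
    by (simp only: cramer_lemma_transpose)
  then show ?thesis by (simp add: c_def)
qed

text \<open>Jacobi's formula. In the Leibniz expansion the derivative falls on one row at a time,
  which leaves determinants with a replaced row for \<open>det_replace_row\<close>.\<close>

lemma pd_det:
  fixes M :: "'a::euclidean_space \<Rightarrow> real^'n^'n"
  assumes M: "\<And>i j. (\<lambda>x. M x $ i $ j) differentiable (at x)" and nz: "det (M x) \<noteq> 0"
  shows "(\<lambda>x. det (M x)) differentiable (at x)"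
    and "pd v (\<lambda>x. det (M x)) x = det (M x) * (\<Sum>i\<in>UNIV. \<Sum>j\<in>UNIV. matrix_inv (M x) $ j $ i * pd v (\<lambda>x. M x $ i $ j) x)"
proof -
  have inv: "invertible (M x)" using nz invertible_det_nz by blast
  let ?D = "\<lambda>v. \<Sum>p\<in>{p. p permutes UNIV}. of_int (sign p) * (\<Sum>i\<in>UNIV. pd v (\<lambda>x. M x $ i $ p i) x * (\<Prod>j\<in>UNIV - {i}. M x $ j $ p j))"
  have D: "((\<lambda>x. det (M x)) has_derivative ?D) (at x)"
    unfolding det_def
    by (intro has_derivative_sum has_derivative_mult_right has_derivative_prod pd_has_derivative M)
  then show "(\<lambda>x. det (M x)) differentiable (at x)" unfolding differentiable_def by blast
  have row: "(\<Sum>p\<in>{p. p permutes UNIV}. of_int (sign p) * (r $ p i * (\<Prod>j\<in>UNIV - {i}. M x $ j $ p j)))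
      = det (\<chi> k. if k = i then r else M x $ k)" for r i
    unfolding det_def
  proof (intro sum.cong refl)
    fix p :: "'n \<Rightarrow> 'n"
    have "(\<Prod>k\<in>UNIV. (\<chi> k. if k = i then r else M x $ k) $ k $ p k)
      = (\<chi> k. if k = i then r else M x $ k) $ i $ p i * (\<Prod>k\<in>UNIV-{i}. (\<chi> k. if k = i then r else M x $ k) $ k $ p k)"
      by (rule prod.remove) auto
    also have "\<dots> = r $ p i * (\<Prod>j\<in>UNIV - {i}. M x $ j $ p j)"
      by (auto intro!: prod.cong)
    finally show "of_int (sign p) * (r $ p i * (\<Prod>j\<in>UNIV - {i}. M x $ j $ p j)) = of_int (sign p) * (\<Prod>k\<in>UNIV. (\<chi> k. if k = i then r else M x $ k) $ k $ p k)" by simp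
  qed
  have "pd v (\<lambda>x. det (M x)) x = ?D v" by (rule pd_eqI[OF D])
  also have "\<dots> = (\<Sum>i\<in>UNIV. \<Sum>p\<in>{p. p permutes UNIV}. of_int (sign p) * ((\<chi> j. pd v (\<lambda>x. M x $ i $ j) x) $ p i * (\<Prod>j\<in>UNIV - {i}. M x $ j $ p j)))"
    unfolding sum_distrib_left by (subst sum.swap) simp
  also have "\<dots> = (\<Sum>i\<in>UNIV. (\<Sum>j\<in>UNIV. pd v (\<lambda>x. M x $ i $ j) x * matrix_inv (M x) $ j $ i) * det (M x))"
    unfolding row det_replace_row[OF inv] by simp
  finally show "pd v (\<lambda>x. det (M x)) x = det (M x) * (\<Sum>i\<in>UNIV. \<Sum>j\<in>UNIV. matrix_inv (M x) $ j $ i * pd v (\<lambda>x. M x $ i $ j) x)"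
    by (simp add: sum_distrib_left sum_distrib_right mult_ac)
qed

lemma pd_matrix_inv:
  fixes M :: "'a::euclidean_space \<Rightarrow> real^'n^'n"
  assumes S: "open S" and M: "\<And>i j. smooth_on S (\<lambda>x. M x $ i $ j)" and nz: "\<And>x. x \<in> S \<Longrightarrow> det (M x) \<noteq> 0"
    and x: "x \<in> S"
  shows "pd v (\<lambda>x. matrix_inv (M x) $ i $ j) x
    = - (\<Sum>k\<in>UNIV. \<Sum>l\<in>UNIV. matrix_inv (M x) $ i $ k * pd v (\<lambda>x. M x $ k $ l) x * matrix_inv (M x) $ l $ j)"
proof -
  let ?V = "\<lambda>i j x. matrix_inv (M x) $ i $ j"
  have inv: "invertible (M x)" if "x \<in> S" for x using nz that invertible_det_nz by blast
  have dM: "(\<lambda>x. M x $ k $ l) differentiable (at x)" for k l using M S x smooth_on_imp_differentiable by blast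
  have dV: "(\<lambda>x. ?V k l x) differentiable (at x)" for k l
    using smooth_on_matrix_inv[OF S M nz] S x smooth_on_imp_differentiable by blast
  have *: "(\<Sum>l\<in>UNIV. pd v (\<lambda>x. M x $ k $ l) x * ?V l j x + M x $ k $ l * pd v (?V l j) x) = 0" for k
  proof -
    have "pd v (\<lambda>x. \<Sum>l\<in>UNIV. M x $ k $ l * ?V l j x) x = pd v (\<lambda>x. if k = j then 1 else 0) x"
      by (rule pd_cong_open[OF S x]) (use matrix_inv_right_entry inv in blast)
    also have "\<dots> = 0" by simp
    finally have "pd v (\<lambda>x. \<Sum>l\<in>UNIV. M x $ k $ l * ?V l j x) x = 0" .
    moreover have "pd v (\<lambda>x. \<Sum>l\<in>UNIV. M x $ k $ l * ?V l j x) x = (\<Sum>l\<in>UNIV. pd v (\<lambda>x. M x $ k $ l * ?V l j x) x)"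
      by (intro pd_sum differentiable_mult dM dV)
    ultimately show ?thesis by (simp add: pd_mult dM dV)
  qed
  \<comment> \<open>The derivative of \<open>M\<close> times its inverse is 0; multiplying by the
    inverse from the left isolates the derivative of the inverse.\<close>
  have "0 = (\<Sum>k\<in>UNIV. ?V i k x * (\<Sum>l\<in>UNIV. pd v (\<lambda>x. M x $ k $ l) x * ?V l j x + M x $ k $ l * pd v (?V l j) x))"
    by (simp add: *)
  also have "\<dots> = (\<Sum>k\<in>UNIV. \<Sum>l\<in>UNIV. ?V i k x * pd v (\<lambda>x. M x $ k $ l) x * ?V l j x) + (\<Sum>k\<in>UNIV. \<Sum>l\<in>UNIV. (?V i k x * M x $ k $ l) * pd v (?V l j) x)"
    by (simp add: sum_distrib_left distrib_left sum.distrib mult.assoc)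
  also have "(\<Sum>k\<in>UNIV. \<Sum>l\<in>UNIV. (?V i k x * M x $ k $ l) * pd v (?V l j) x) = (\<Sum>l\<in>UNIV. (\<Sum>k\<in>UNIV. ?V i k x * M x $ k $ l) * pd v (?V l j) x)"
    by (subst sum.swap) (simp add: sum_distrib_right)
  also have "\<dots> = pd v (?V i j) x"
    by (simp add: matrix_inv_left_entry[OF inv[OF x]] if_distrib if_distribR sum.delta cong: if_cong)
  finally show ?thesis by linarith
qed

text \<open>A Cholesky factorization by induction on the index set: complete the square in the
  variable \<open>s\<close> and factor what remains.\<close>

lemma posdef_decomp:
  fixes K :: "'i \<Rightarrow> 'i \<Rightarrow> real"
  assumes "finite S" "\<And>i j. K i j = K j i"
    "\<And>x. (\<exists>i\<in>S. x i \<noteq> 0) \<Longrightarrow> (\<Sum>i\<in>S. \<Sum>j\<in>S. K i j * x i * x j) > 0"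
  shows "\<exists>p. \<forall>i\<in>S. \<forall>j\<in>S. K i j = (\<Sum>m\<in>S. p m i * p m j)"
  using assms
proof (induction S arbitrary: K rule: finite_induct)
  case empty then show ?case by simp
next
  case (insert s S)
  have exp: "(\<Sum>i\<in>insert s S. \<Sum>j\<in>insert s S. K i j * x i * x j)
      = K s s * x s * x s + 2 * x s * (\<Sum>j\<in>S. K s j * x j) + (\<Sum>i\<in>S. \<Sum>j\<in>S. K i j * x i * x j)" for x
  proof -
    have "(\<Sum>i\<in>S. K i s * x i * x s) = x s * (\<Sum>j\<in>S. K s j * x j)"
      unfolding sum_distrib_left by (intro sum.cong refl) (simp add: insert.prems(1)[of _ s] mult_ac)
    moreover have "(\<Sum>j\<in>S. K s j * x s * x j) = x s * (\<Sum>j\<in>S. K s j * x j)"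
      unfolding sum_distrib_left by (intro sum.cong refl) (simp add: mult_ac)
    ultimately show ?thesis using insert.hyps by (simp add: sum.distrib)
  qed
  have "(\<Sum>j\<in>S. K s j * (if j = s then 1 else 0)) = 0" "(\<Sum>i\<in>S. \<Sum>j\<in>S. K i j * (if i = s then 1 else 0) * (if j = s then 1 else 0)) = 0"
    using insert.hyps by (auto intro!: sum.neutral)
  then have Kss: "K s s > 0" using insert.prems(2)[of "\<lambda>i. if i = s then 1 else 0"] exp[of "\<lambda>i. if i = s then 1 else 0"] by auto
  \<comment> \<open>The Schur complement of the entry \<open>K s s\<close>.\<close>
  define K' where "K' = (\<lambda>i j. K i j - K s i * K s j / K s s)"
  have "(\<Sum>i\<in>S. \<Sum>j\<in>S. K' i j * x i * x j) > 0" if "\<exists>i\<in>S. x i \<noteq> 0" for x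
  proof -
    define B where "B = (\<Sum>j\<in>S. K s j * x j)"
    \<comment> \<open>The value at \<open>s\<close> that minimizes the form of \<open>K\<close>, so
      that this form at \<open>x'\<close> equals the form of \<open>K'\<close> at
      \<open>x\<close>.\<close>
    define x' where "x' = x(s := - B / K s s)"
    have B': "(\<Sum>j\<in>S. K s j * x' j) = B" "(\<Sum>i\<in>S. \<Sum>j\<in>S. K i j * x' i * x' j) = (\<Sum>i\<in>S. \<Sum>j\<in>S. K i j * x i * x j)"
      unfolding B_def x'_def using insert.hyps by (auto intro!: sum.cong)
    have "0 < (\<Sum>i\<in>insert s S. \<Sum>j\<in>insert s S. K i j * x' i * x' j)"
      by (rule insert.prems(2)) (use that insert.hyps in \<open>auto simp: x'_def\<close>)
    also have "\<dots> = (\<Sum>i\<in>S. \<Sum>j\<in>S. K i j * x i * x j) - B * B / K s s"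
      unfolding exp B' using Kss by (simp add: x'_def field_simps)
    also have "B * B / K s s = (\<Sum>i\<in>S. \<Sum>j\<in>S. K s i * K s j / K s s * x i * x j)"
      unfolding B_def sum_product sum_divide_distrib by (intro sum.cong refl) (simp add: field_simps)
    finally show ?thesis by (simp add: K'_def left_diff_distrib sum_subtractf)
  qed
  moreover have "K' i j = K' j i" for i j using insert.prems(1)[of i j] by (simp add: K'_def mult.commute)
  ultimately obtain p where p: "\<forall>i\<in>S. \<forall>j\<in>S. K' i j = (\<Sum>m\<in>S. p m i * p m j)"
    using insert.IH[of K'] by blast
  define q where "q = (\<lambda>m i. if m = s then K s i / sqrt (K s s) else if i = s then 0 else p m i)"
  have ss: "K s a / sqrt (K s s) * (K s b / sqrt (K s s)) = K s a * K s b / K s s" for a b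
    using Kss by (simp add: field_simps)
  have "K i j = (\<Sum>m\<in>insert s S. q m i * q m j)" if "i \<in> insert s S" "j \<in> insert s S" for i j
  proof -
    have e: "(\<Sum>m\<in>insert s S. q m i * q m j) = K s i * K s j / K s s + (\<Sum>m\<in>S. q m i * q m j)"
      using insert.hyps Kss by (simp add: q_def ss)
    show ?thesis
    proof (cases "i = s \<or> j = s")
      case True
      have "(\<Sum>m\<in>S. q m i * q m j) = 0"
        using True insert.hyps by (intro sum.neutral) (auto simp: q_def)
      then show ?thesis using e True Kss insert.prems(1)[of i j] by auto
    next
      case False
      then have "(\<Sum>m\<in>S. q m i * q m j) = (\<Sum>m\<in>S. p m i * p m j)"
        using insert.hyps by (intro sum.cong refl) (auto simp: q_def)
      also have "\<dots> = K' i j" using p False that by auto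
      finally show ?thesis using e by (simp add: K'_def)
    qed
  qed
  then show ?case by blast
qed

text \<open>Writing \<open>H = transpose P ** P\<close> turns the trace into the sum of the squared
  entries of the symmetric matrix \<open>P ** A ** transpose P\<close>. If that matrix is 0, so is
  \<open>H ** A ** H\<close>, and \<open>H\<close> can be cancelled.\<close>

lemma trace_sq_posdef:
  fixes H A :: "real^'n^'n"
  assumes H: "transpose H = H" "\<And>v. v \<noteq> 0 \<Longrightarrow> v \<bullet> (H *v v) > 0" and A: "transpose A = A"
  shows "trace (H ** A ** (H ** A)) \<ge> 0" and "trace (H ** A ** (H ** A)) = 0 \<Longrightarrow> A = 0"
proof -
  have quad: "(\<Sum>i\<in>UNIV. \<Sum>j\<in>UNIV. H $ i $ j * x i * x j) = (\<chi> i. x i) \<bullet> (H *v (\<chi> i. x i))" for x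
    by (simp add: inner_vec_def matrix_vector_mult_def sum_distrib_left mult_ac)
  have "\<exists>p::'n \<Rightarrow> 'n \<Rightarrow> real. \<forall>i\<in>UNIV. \<forall>j\<in>UNIV. H $ i $ j = (\<Sum>m\<in>UNIV. p m i * p m j)"
  proof (rule posdef_decomp[of UNIV "\<lambda>i j. H $ i $ j"])
    show "H $ i $ j = H $ j $ i" for i j using arg_cong[OF H(1), of "\<lambda>B. B $ j $ i"] by (simp add: transpose_def)
    fix x :: "'n \<Rightarrow> real" assume "\<exists>i\<in>UNIV. x i \<noteq> 0"
    then have "(\<chi> i. x i) \<noteq> 0" by (auto simp: vec_eq_iff)
    then show "(\<Sum>i\<in>UNIV. \<Sum>j\<in>UNIV. H $ i $ j * x i * x j) > 0" unfolding quad by (rule H(2))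
  qed auto
  then obtain p :: "'n \<Rightarrow> 'n \<Rightarrow> real" where p: "\<And>i j. H $ i $ j = (\<Sum>m\<in>UNIV. p m i * p m j)" by auto
  define P :: "real^'n^'n" where "P = (\<chi> m i. p m i)"
  have HP: "H = transpose P ** P" by (simp add: vec_eq_iff matrix_matrix_mult_def transpose_def P_def p)
  define T where "T = P ** A ** transpose P"
  have "trace (H ** A ** (H ** A)) = trace (transpose P ** (P ** A ** transpose P ** P ** A))"
    unfolding HP by (simp add: matrix_mul_assoc)
  also have "\<dots> = trace (T ** T)" unfolding T_def
    by (subst trace_mul_sym) (simp add: matrix_mul_assoc)
  also have "\<dots> = (\<Sum>i\<in>UNIV. \<Sum>j\<in>UNIV. T $ i $ j * T $ j $ i)" by (simp add: trace_def matrix_matrix_mult_def)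
  also have "\<dots> = (\<Sum>i\<in>UNIV. \<Sum>j\<in>UNIV. (T $ i $ j)\<^sup>2)"
  proof -
    have "transpose T = T" unfolding T_def by (simp add: matrix_transpose_mul A matrix_mul_assoc)
    then have "T $ j $ i = T $ i $ j" for i j by (metis column_def column_transpose row_def vec_lambda_beta)
    then show ?thesis by (simp add: power2_eq_square)
  qed
  finally have tr: "trace (H ** A ** (H ** A)) = (\<Sum>i\<in>UNIV. \<Sum>j\<in>UNIV. (T $ i $ j)\<^sup>2)" .
  show "trace (H ** A ** (H ** A)) \<ge> 0" unfolding tr by (intro sum_nonneg) auto
  assume "trace (H ** A ** (H ** A)) = 0"
  then have "\<And>i. (\<Sum>j\<in>UNIV. (T $ i $ j)\<^sup>2) = 0"
    unfolding tr by (subst (asm) sum_nonneg_eq_0_iff) (auto intro: sum_nonneg)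
  then have "(T $ i $ j)\<^sup>2 = 0" for i j by (subst (asm) sum_nonneg_eq_0_iff) auto
  then have T0: "T = 0" by (simp add: vec_eq_iff)
  have "H ** A ** H = transpose P ** T ** P" unfolding HP T_def by (simp add: matrix_mul_assoc)
  then have HAH: "H ** A ** H = 0" using T0 by simp
  have "inj ((*v) H)"
  proof (rule injI)
    fix x y assume "H *v x = H *v y"
    then have "H *v (x - y) = 0" by (simp add: matrix_vector_mult_diff_distrib)
    then show "x = y" using H(2)[of "x - y"] by force
  qed
  then have inv: "invertible H" using matrix_left_invertible_injective invertible_left_inverse by blast
  have "A = matrix_inv H ** (H ** A ** H) ** matrix_inv H"
    using inv by (metis matrix_inv_left matrix_inv_right matrix_mul_assoc matrix_mul_lid matrix_mul_rid)
  then show "A = 0" using HAH by simp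
qed

section \<open>The spray of a Finsler metric in a chart\<close>

lemma axis_Basis_pair [simp]:
  "(axis i (1::real), 0) \<in> Basis" "(0, axis i (1::real)) \<in> Basis"
  by (auto simp: Basis_prod_def axis_in_Basis_iff)

lemma vec_eq_sum_axis: "(v::real^'n) = (\<Sum>i\<in>UNIV. v $ i *\<^sub>R axis i 1)"
  by (simp add: vec_eq_iff axis_def if_distrib sum.delta cong: if_cong)

lemma pd_pair:
  fixes f :: "(real^'n) \<times> (real^'n) \<Rightarrow> real"
  assumes "f differentiable (at z)"
  shows "pd (a, b) f z = (\<Sum>k\<in>UNIV. a $ k * DX k f z) + (\<Sum>k\<in>UNIV. b $ k * DY k f z)"
proof -
  note lin = pd_linear[OF assms]
  have "(a, b) = (\<Sum>k\<in>UNIV. a $ k *\<^sub>R (axis k 1, 0)) + (\<Sum>k\<in>UNIV. b $ k *\<^sub>R (0, axis k 1))"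
    by (simp add: prod_eq_iff fst_sum snd_sum flip: vec_eq_sum_axis)
  then have "pd (a, b) f z = pd ((\<Sum>k\<in>UNIV. a $ k *\<^sub>R (axis k 1, 0)) + (\<Sum>k\<in>UNIV. b $ k *\<^sub>R (0, axis k 1))) f z" by simp
  also have "\<dots> = (\<Sum>k\<in>UNIV. pd (a $ k *\<^sub>R (axis k 1, 0)) f z) + (\<Sum>k\<in>UNIV. pd (b $ k *\<^sub>R (0, axis k 1)) f z)"
    by (simp only: linear_add[OF lin] linear_sum[OF lin])
  also have "\<dots> = (\<Sum>k\<in>UNIV. a $ k * DX k f z) + (\<Sum>k\<in>UNIV. b $ k * DY k f z)"
    unfolding DX_def DY_def linear_cmul[OF lin] by simp
  finally show ?thesis .
qed

lemma differentiable_snd_nth: "(\<lambda>z::(real^'n) \<times> (real^'n). snd z $ k) differentiable (at z)"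
  by (rule bounded_linear_imp_differentiable) (intro bounded_linear_vec_nth bounded_linear_compose[OF bounded_linear_vec_nth bounded_linear_snd])

lemma pd_snd_nth: "pd v (\<lambda>z::(real^'n) \<times> (real^'n). snd z $ k) z = snd v $ k"
  by (rule pd_eqI, rule bounded_linear_imp_has_derivative) (rule bounded_linear_compose[OF bounded_linear_vec_nth bounded_linear_snd])

lemma DX_snd_nth [simp]: "DX i (\<lambda>z::(real^'n) \<times> (real^'n). snd z $ k) z = 0"
  and DY_snd_nth [simp]: "DY i (\<lambda>z::(real^'n) \<times> (real^'n). snd z $ k) z = (if k = i then 1 else 0)"
  by (auto simp: DX_def DY_def pd_snd_nth axis_def)

lemma if_sum_left [simp]: "(\<Sum>k\<in>UNIV. (if k = i then 1 else 0) * f k) = (f (i::'n::finite) :: real)"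
  by (subst sum.cong[OF refl, of _ _ "\<lambda>k. if k = i then f k else 0"]) auto

lemma if_sum_right [simp]: "(\<Sum>k\<in>UNIV. f k * (if k = i then 1 else 0)) = (f (i::'n::finite) :: real)"
  by (simp add: if_distrib sum.delta cong: if_cong)

lemma if_sum_left' [simp]: "(\<Sum>k\<in>UNIV. (if i = k then 1 else 0) * f k) = (f (i::'n::finite) :: real)"
  by (subst sum.cong[OF refl, of _ _ "\<lambda>k. if i = k then f k else 0"]) auto

lemma if_sum_right' [simp]: "(\<Sum>k\<in>UNIV. f k * (if i = k then 1 else 0)) = (f (i::'n::finite) :: real)"
  by (simp add: if_distrib sum.delta cong: if_cong)

locale finsler_chart =
  fixes F :: "('m, 'n::finite) tbfun" and c :: "('m, 'n) chart"
  assumes open_U: "open (snd c ` fst c)"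
    and F_nonneg: "x \<in> snd c ` fst c \<Longrightarrow> Floc F c (x, y) \<ge> 0"
    and F_hom: "x \<in> snd c ` fst c \<Longrightarrow> t > 0 \<Longrightarrow> Floc F c (x, t *\<^sub>R y) = t * Floc F c (x, y)"
    and F_smooth: "smooth_on (snd c ` fst c \<times> (UNIV - {0})) (Floc F c)"
    and g_posdef: "x \<in> snd c ` fst c \<Longrightarrow> y \<noteq> 0 \<Longrightarrow> v \<noteq> 0 \<Longrightarrow> gform F c (x, y) v v > 0"
begin

abbreviation "U \<equiv> snd c ` fst c"
abbreviation "Om \<equiv> U \<times> (UNIV - {0::real^'n})"
abbreviation "sm \<equiv> smooth_on Om"
abbreviation "L \<equiv> Lsq F c"
abbreviation "G \<equiv> spray F c"
abbreviation "g \<equiv> gten F c"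
abbreviation "N i j \<equiv> DY i (G j)"
abbreviation "gi i j z \<equiv> ginv F c z $ i $ j"

lemma open_Om: "open Om"
  by (intro open_Times open_U open_Diff) auto

lemma sm_diff: "sm f \<Longrightarrow> z \<in> Om \<Longrightarrow> f differentiable (at z)"
  using smooth_on_imp_differentiable open_Om by blast

lemma sm_DX: "sm f \<Longrightarrow> sm (DX i f)" and sm_DY: "sm f \<Longrightarrow> sm (DY i f)"
  unfolding DX_def DY_def by (auto intro: smooth_on_pd)

lemma sm_y: "sm (\<lambda>z. snd z $ k)"
  by (rule smooth_on_bounded_linear[OF open_Om]) (rule bounded_linear_compose[OF bounded_linear_vec_nth bounded_linear_snd])

lemma sm_L: "sm L"
  unfolding Lsq_def[abs_def] by (intro smooth_on_power open_Om F_smooth)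

lemma sm_g: "sm (g i j)"
  unfolding gten_def[abs_def] by (intro smooth_on_cmult open_Om sm_DY sm_L)

lemma DXX: "sm f \<Longrightarrow> z \<in> Om \<Longrightarrow> DX i (DX j f) z = DX j (DX i f) z"
  and DXY: "sm f \<Longrightarrow> z \<in> Om \<Longrightarrow> DX i (DY j f) z = DY j (DX i f) z"
  and DYY: "sm f \<Longrightarrow> z \<in> Om \<Longrightarrow> DY i (DY j f) z = DY j (DY i f) z"
  unfolding DX_def DY_def using pd_commute[OF open_Om] by auto

lemma DX_cong: "(\<And>z. z \<in> Om \<Longrightarrow> f z = h z) \<Longrightarrow> z \<in> Om \<Longrightarrow> DX i f z = DX i h z"
  and DY_cong: "(\<And>z. z \<in> Om \<Longrightarrow> f z = h z) \<Longrightarrow> z \<in> Om \<Longrightarrow> DY i f z = DY i h z"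
  unfolding DX_def DY_def by (rule pd_cong_open[OF open_Om]; blast)+

lemma g_sym: "z \<in> Om \<Longrightarrow> g i j z = g j i z"
  unfolding gten_def using DYY[OF sm_L] by simp

definition gm :: "(real^'n) \<times> (real^'n) \<Rightarrow> real^'n^'n" where "gm z = (\<chi> i j. g i j z)"

lemma gform_matrix: "gform F c z u v = u \<bullet> (gm z *v v)"
  by (simp add: gform_def gm_def inner_vec_def matrix_vector_mult_def sum_distrib_left mult_ac)

lemma gm_sym: "z \<in> Om \<Longrightarrow> transpose (gm z) = gm z"
  by (simp add: transpose_def gm_def vec_eq_iff g_sym)

lemma gm_invertible: assumes "z \<in> Om" shows "invertible (gm z)"
proof -
  have "inj ((*v) (gm z))"
  proof (rule injI)
    fix u v assume "gm z *v u = gm z *v v"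
    then have "gm z *v (u - v) = 0" by (simp add: matrix_vector_mult_diff_distrib)
    then have "gform F c z (u - v) (u - v) = 0" by (simp add: gform_matrix)
    then show "u = v" using g_posdef[of "fst z" "snd z" "u - v"] assms by force
  qed
  then show ?thesis using matrix_left_invertible_injective invertible_left_inverse by blast
qed

lemma det_nz: "z \<in> Om \<Longrightarrow> det (gm z) \<noteq> 0"
  using gm_invertible invertible_det_nz by blast

lemma ginv_gm: "ginv F c z = matrix_inv (gm z)"
  by (simp add: ginv_def gm_def)

lemma gm_nth [simp]: "gm z $ i $ j = g i j z" by (simp add: gm_def)

lemma sm_gi: "sm (gi i j)"
  unfolding ginv_gm by (rule smooth_on_matrix_inv[OF open_Om]) (auto simp: sm_g det_nz)

lemma g_gi: "z \<in> Om \<Longrightarrow> (\<Sum>l\<in>UNIV. g k l z * gi l j z) = (if k = j then 1 else 0)"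
  and gi_g: "z \<in> Om \<Longrightarrow> (\<Sum>l\<in>UNIV. gi k l z * g l j z) = (if k = j then 1 else 0)"
  using matrix_inv_right_entry[OF gm_invertible] matrix_inv_left_entry[OF gm_invertible]
  by (auto simp: ginv_gm)

lemma gi_sym: assumes "z \<in> Om" shows "gi i j z = gi j i z"
proof -
  have a: "gm z ** ginv F c z = mat 1" using matrix_inv_right gm_invertible assms ginv_gm by metis
  have "transpose (gm z ** ginv F c z) = mat 1" unfolding a by (simp add: transpose_mat)
  then have "transpose (ginv F c z) ** gm z = mat 1" by (simp add: matrix_transpose_mul gm_sym[OF assms])
  then have "transpose (ginv F c z) ** (gm z ** ginv F c z) = ginv F c z"
    by (simp add: matrix_mul_assoc)
  then have "transpose (ginv F c z) = ginv F c z" using a by simp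
  from arg_cong[OF this, of "\<lambda>B. B $ j $ i"] show ?thesis by (simp add: transpose_def)
qed

lemma sm_G: "sm (G i)"
  unfolding spray_def[abs_def]
  by (intro smooth_on_cmult smooth_on_sum smooth_on_mult smooth_on_diff open_Om sm_gi sm_y sm_DX sm_DY sm_L)

subsection \<open>Homogeneity\<close>

text \<open>Real exponents and the restriction to \<open>y \<noteq> 0\<close> admit the negative
  degrees that vertical derivatives produce, such as degree -1 for the mean Cartan torsion.\<close>

definition hom :: "real \<Rightarrow> ((real^'n) \<times> (real^'n) \<Rightarrow> real) \<Rightarrow> bool" where
  "hom r f \<longleftrightarrow> (\<forall>x\<in>U. \<forall>y. y \<noteq> 0 \<longrightarrow> (\<forall>t>0. f (x, t *\<^sub>R y) = t powr r * f (x, y)))"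

lemma homD: "hom r f \<Longrightarrow> x \<in> U \<Longrightarrow> y \<noteq> 0 \<Longrightarrow> t > 0 \<Longrightarrow> f (x, t *\<^sub>R y) = t powr r * f (x, y)"
  by (auto simp: hom_def)

lemma hom_pd:
  assumes f: "sm f" "hom r f" and x: "x \<in> U" "y \<noteq> 0" and t: "t > 0"
  shows "pd (a, t *\<^sub>R b) f (x, t *\<^sub>R y) = t powr r * pd (a, b) f (x, y)"
proof -
  have z: "(x, y) \<in> Om" "(x, t *\<^sub>R y) \<in> Om" using x t by auto
  have D: "((\<lambda>z::(real^'n) \<times> (real^'n). (fst z, t *\<^sub>R snd z)) has_derivative (\<lambda>v. (fst v, t *\<^sub>R snd v))) (at (x,y))"
    by (auto intro!: derivative_eq_intros)
  have "pd (a, b) (\<lambda>z. f (fst z, t *\<^sub>R snd z)) (x, y) = pd (a, t *\<^sub>R b) f (x, t *\<^sub>R y)"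
    using pd_chain[OF D, of f "(a,b)"] sm_diff[OF f(1) z(2)] by simp
  moreover have "pd (a, b) (\<lambda>z. f (fst z, t *\<^sub>R snd z)) (x, y) = pd (a, b) (\<lambda>z. t powr r * f z) (x, y)"
  proof (rule pd_cong_open[OF open_Om z(1)])
    fix z' assume "z' \<in> Om"
    then show "f (fst z', t *\<^sub>R snd z') = t powr r * f z'"
      using homD[OF f(2), of "fst z'" "snd z'" t] t by (cases z') auto
  qed
  ultimately show ?thesis using pd_cmult[OF sm_diff[OF f(1) z(1)]] by simp
qed

lemma hom_DX: assumes "sm f" "hom r f" shows "hom r (DX i f)"
  unfolding hom_def DX_def using hom_pd[OF assms, of _ _ _ _ 0] by auto

lemma hom_DY: assumes "sm f" "hom r f" shows "hom (r - 1) (DY i f)"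
  unfolding hom_def
proof (intro ballI allI impI)
  fix x y :: "real^'n" and t :: real assume x: "x \<in> U" "y \<noteq> 0" and t: "t > 0"
  have z: "(x, t *\<^sub>R y) \<in> Om" using x t by auto
  have "pd (0, t *\<^sub>R axis i 1) f (x, t *\<^sub>R y) = t powr r * DY i f (x, y)"
    unfolding DY_def by (rule hom_pd[OF assms x t])
  moreover have "pd (0, t *\<^sub>R axis i 1) f (x, t *\<^sub>R y) = t * DY i f (x, t *\<^sub>R y)"
    using linear_cmul[OF pd_linear[OF sm_diff[OF assms(1) z]], of t "(0, axis i 1)"] by (simp add: DY_def)
  ultimately show "DY i f (x, t *\<^sub>R y) = t powr (r - 1) * DY i f (x, y)"
    using t by (simp add: powr_diff field_simps)
qed

lemma euler:
  assumes "sm f" "hom r f" "z \<in> Om"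
  shows "(\<Sum>i\<in>UNIV. snd z $ i * DY i f z) = r * f z"
proof -
  obtain x y where z: "z = (x, y)" "x \<in> U" "y \<noteq> 0" using assms(3) by auto
  have d: "f differentiable (at (x, 1 *\<^sub>R y))" using sm_diff[OF assms(1,3)] z by simp
  have D: "((\<lambda>t::real. (x, t *\<^sub>R y)) has_derivative (\<lambda>s. (0, s *\<^sub>R y))) (at 1)"
    by (auto intro!: derivative_eq_intros)
  have "((\<lambda>t. f (x, t *\<^sub>R y)) has_derivative (\<lambda>s. pd (0, s *\<^sub>R y) f (x, 1 *\<^sub>R y))) (at 1)"
    using has_derivative_compose[OF D pd_has_derivative[OF d]] by simp
  moreover have "(\<lambda>s. pd (0, s *\<^sub>R y) f (x, 1 *\<^sub>R y)) = (*) (pd (0, y) f (x, y))"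
    using linear_cmul[OF pd_linear[OF d], of _ "(0, y)"] by (auto simp: fun_eq_iff)
  ultimately have 1: "((\<lambda>t. f (x, t *\<^sub>R y)) has_real_derivative pd (0, y) f (x, y)) (at 1)"
    by (simp add: has_field_derivative_def)
  have 2: "((\<lambda>t. t powr r * f (x, y)) has_real_derivative r * f (x, y)) (at 1)"
    by (auto intro!: derivative_eq_intros)
  have "((\<lambda>t. f (x, t *\<^sub>R y)) has_real_derivative r * f (x, y)) (at 1)"
    by (rule has_field_derivative_transform_within_open[OF 2, of "{0<..}"]) (use homD[OF assms(2) z(2,3)] in auto)
  with 1 have "pd (0, y) f (x, y) = r * f (x, y)" using DERIV_unique by blast
  then show ?thesis using pd_pair[OF sm_diff[OF assms(1,3)], of 0 y] z by simp
qed

lemma hom_mult: "hom r f \<Longrightarrow> hom s h \<Longrightarrow> hom (r + s) (\<lambda>z. f z * h z)"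
  unfolding hom_def by (auto simp: powr_add)

lemma hom_cmult: "hom r f \<Longrightarrow> hom r (\<lambda>z. k * f z)"
  unfolding hom_def by auto

lemma hom_sum: "(\<And>i. i \<in> I \<Longrightarrow> hom r (f i)) \<Longrightarrow> hom r (\<lambda>z. \<Sum>i\<in>I. f i z)"
  unfolding hom_def by (auto simp: sum_distrib_left)

lemma hom_diff: "hom r f \<Longrightarrow> hom r h \<Longrightarrow> hom r (\<lambda>z. f z - h z)"
  unfolding hom_def by (auto simp: right_diff_distrib)

lemma hom_y: "hom 1 (\<lambda>z. snd z $ k)" unfolding hom_def by auto

lemma hom_F: "hom 1 (Floc F c)" unfolding hom_def by (auto simp: F_hom)

lemma hom_L: "hom 2 L"
  using hom_mult[OF hom_F hom_F] unfolding Lsq_def[abs_def] by (simp add: power2_eq_square)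

lemma hom_L1: "hom 1 (DY i L)" using hom_DY[OF sm_L hom_L] by simp
lemma hom_L2: "hom 0 (DY j (DY i L))" using hom_DY[OF sm_DY[OF sm_L] hom_L1] by simp
lemma hom_g: "hom 0 (g i j)" unfolding gten_def[abs_def] by (intro hom_cmult hom_L2)

lemma gm_hom: "x \<in> U \<Longrightarrow> y \<noteq> 0 \<Longrightarrow> t > 0 \<Longrightarrow> gm (x, t *\<^sub>R y) = gm (x, y)"
  using homD[OF hom_g] by (simp add: gm_def)

lemma hom_gi: "hom 0 (gi i j)" unfolding hom_def ginv_gm by (auto simp: gm_hom)

lemma hom_G: "hom 2 (G i)"
proof -
  have "hom (0 + 2) (\<lambda>z. gi i l z * ((\<Sum>k\<in>UNIV. DX k (DY l L) z * snd z $ k) - DX l L z))" for l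
  proof (intro hom_mult hom_gi hom_diff hom_sum)
    show "hom 2 (\<lambda>z. DX k (DY l L) z * snd z $ k)" for k
      using hom_mult[OF hom_DX[OF sm_DY[OF sm_L] hom_L1] hom_y] by simp
    show "hom 2 (DX l L)" by (intro hom_DX sm_L hom_L)
  qed
  then show ?thesis unfolding spray_def[abs_def] by (intro hom_cmult hom_sum) simp
qed

lemma hom_N: "hom 1 (N i j)" using hom_DY[OF sm_G hom_G] by simp

text \<open>Two uses of Euler's identity give \<open>gform F c z y y = L z\<close> for
  \<open>y = snd z\<close>, so positive definiteness applies.\<close>

lemma L_pos: assumes "z \<in> Om" shows "L z > 0"
proof -
  obtain x y where z: "z = (x, y)" "x \<in> U" "y \<noteq> 0" using assms by auto
  have "gform F c z y y = (\<Sum>i\<in>UNIV. 1/2 * y $ i * (\<Sum>j\<in>UNIV. snd z $ j * DY j (DY i L) z))"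
    unfolding gform_def sum_distrib_left gten_def using DYY[OF sm_L assms] z by (simp add: mult_ac)
  also have "\<dots> = (\<Sum>i\<in>UNIV. 1/2 * (snd z $ i * DY i L z))"
    using euler[OF sm_DY[OF sm_L] hom_L1 assms] z by simp
  also have "\<dots> = L z" using euler[OF sm_L hom_L assms] by (simp flip: sum_divide_distrib)
  finally have "L z = gform F c (x, y) y y" using z by simp
  then show ?thesis using g_posdef[OF z(2,3,3)] by simp
qed

lemma F_pos: "z \<in> Om \<Longrightarrow> Floc F c z > 0"
  using L_pos[of z] F_nonneg[of "fst z" "snd z"] unfolding Lsq_def by (cases z) (auto simp: less_le)

lemma F_zero: "x \<in> U \<Longrightarrow> Floc F c (x, 0) = 0"
  using F_hom[of x 2 0] by simp

subsection \<open>The spray as a vector field\<close>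

definition GG :: "((real^'n) \<times> (real^'n) \<Rightarrow> real) \<Rightarrow> (real^'n) \<times> (real^'n) \<Rightarrow> real" where
  "GG f z = (\<Sum>k\<in>UNIV. snd z $ k * DX k f z) - 2 * (\<Sum>k\<in>UNIV. G k z * DY k f z)"

lemma sm_GG: "sm f \<Longrightarrow> sm (GG f)"
  unfolding GG_def[abs_def]
  by (intro smooth_on_cmult smooth_on_sum smooth_on_mult smooth_on_diff open_Om sm_y sm_G sm_DX sm_DY)

lemma hom_GG: assumes "sm f" "hom r f" shows "hom (r + 1) (GG f)"
proof -
  have "hom (1 + r) (\<lambda>z. snd z $ k * DX k f z)" for k
    by (intro hom_mult hom_y hom_DX assms)
  moreover have "hom (2 + (r - 1)) (\<lambda>z. G k z * DY k f z)" for k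
    by (intro hom_mult hom_G hom_DY assms)
  ultimately show ?thesis unfolding GG_def[abs_def]
    by (intro hom_diff hom_cmult hom_sum) (simp_all add: add.commute)
qed

lemma GG_pd:
  assumes "f differentiable (at z)"
  shows "GG f z = pd (snd z, \<chi> k. -2 * G k z) f z"
  unfolding pd_pair[OF assms] GG_def by (simp add: sum_distrib_left sum_negf mult_ac)

lemma GG_cong: "(\<And>z. z \<in> Om \<Longrightarrow> f z = h z) \<Longrightarrow> z \<in> Om \<Longrightarrow> GG f z = GG h z"
  unfolding GG_def using DX_cong[of f h] DY_cong[of f h] by simp

lemma GG_mult: "sm f \<Longrightarrow> sm h \<Longrightarrow> z \<in> Om \<Longrightarrow> GG (\<lambda>z. f z * h z) z = GG f z * h z + f z * GG h z"
  by (simp add: GG_pd sm_diff pd_mult differentiable_mult)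

lemma GG_sum: "(\<And>i. i \<in> I \<Longrightarrow> sm (f i)) \<Longrightarrow> z \<in> Om \<Longrightarrow> finite I \<Longrightarrow> GG (\<lambda>z. \<Sum>i\<in>I. f i z) z = (\<Sum>i\<in>I. GG (f i) z)"
  by (simp add: GG_pd sm_diff pd_sum differentiable_sum)

lemma GG_cmult: "sm f \<Longrightarrow> z \<in> Om \<Longrightarrow> GG (\<lambda>z. k * f z) z = k * GG f z"
  by (simp add: GG_pd sm_diff pd_cmult differentiable_mult)

lemma GG_diff: "sm f \<Longrightarrow> sm h \<Longrightarrow> z \<in> Om \<Longrightarrow> GG (\<lambda>z. f z - h z) z = GG f z - GG h z"
  by (simp add: GG_pd sm_diff pd_diff differentiable_diff)

text \<open>The commutator of the spray with a vertical coordinate field. Together with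
  \<open>DX_GG\<close> it is the source of every connection and curvature term below.\<close>

lemma DY_GG:
  assumes f: "sm f" and z: "z \<in> Om"
  shows "DY i (GG f) z = GG (DY i f) z + DX i f z - 2 * (\<Sum>j\<in>UNIV. N i j z * DY j f z)"
proof -
  note d = sm_diff[OF _ z]
  have 1: "DY i (\<lambda>z. snd z $ k * DX k f z) z = (if k = i then 1 else 0) * DX k f z + snd z $ k * DX k (DY i f) z" for k
    using pd_mult[OF differentiable_snd_nth d[OF sm_DX[OF f]], of "(0, axis i 1)" k k] DY_snd_nth[of i k z] DXY[OF f z, of k i]
    by (simp add: DY_def)
  have 2: "DY i (\<lambda>z. G k z * DY k f z) z = N i k z * DY k f z + G k z * DY k (DY i f) z" for k
    using pd_mult[OF d[OF sm_G] d[OF sm_DY[OF f]], of "(0, axis i 1)" k k] DYY[OF f z, of i k]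
    by (simp add: DY_def)
  have "DY i (GG f) z = DY i (\<lambda>z. \<Sum>k\<in>UNIV. snd z $ k * DX k f z) z - DY i (\<lambda>z. 2 * (\<Sum>k\<in>UNIV. G k z * DY k f z)) z"
    unfolding GG_def[abs_def] DY_def
    by (rule pd_diff) (intro d smooth_on_cmult smooth_on_sum smooth_on_mult open_Om sm_y sm_G sm_DX sm_DY[unfolded DY_def] f)+
  also have "DY i (\<lambda>z. \<Sum>k\<in>UNIV. snd z $ k * DX k f z) z = (\<Sum>k\<in>UNIV. DY i (\<lambda>z. snd z $ k * DX k f z) z)"
    unfolding DY_def by (rule pd_sum) (intro d smooth_on_mult open_Om sm_y sm_DX f)
  also have "DY i (\<lambda>z. 2 * (\<Sum>k\<in>UNIV. G k z * DY k f z)) z = 2 * DY i (\<lambda>z. \<Sum>k\<in>UNIV. G k z * DY k f z) z"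
    unfolding DY_def by (rule pd_cmult) (intro d smooth_on_sum smooth_on_mult open_Om sm_G sm_DY[unfolded DY_def] f)
  also have "DY i (\<lambda>z. \<Sum>k\<in>UNIV. G k z * DY k f z) z = (\<Sum>k\<in>UNIV. DY i (\<lambda>z. G k z * DY k f z) z)"
    unfolding DY_def by (rule pd_sum) (intro d smooth_on_mult open_Om sm_G sm_DY[unfolded DY_def] f)
  finally show ?thesis unfolding 1 2 sum.distrib GG_def by simp
qed

lemma DX_GG:
  assumes f: "sm f" and z: "z \<in> Om"
  shows "DX i (GG f) z = GG (DX i f) z - 2 * (\<Sum>j\<in>UNIV. DX i (G j) z * DY j f z)"
proof -
  note d = sm_diff[OF _ z]
  have 1: "DX i (\<lambda>z. snd z $ k * DX k f z) z = snd z $ k * DX k (DX i f) z" for k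
    using pd_mult[OF differentiable_snd_nth d[OF sm_DX[OF f]], of "(axis i 1, 0)" k k] DX_snd_nth[of i k z] DXX[OF f z, of k i]
    by (simp add: DX_def)
  have 2: "DX i (\<lambda>z. G k z * DY k f z) z = DX i (G k) z * DY k f z + G k z * DY k (DX i f) z" for k
    using pd_mult[OF d[OF sm_G] d[OF sm_DY[OF f]], of "(axis i 1, 0)" k k] DXY[OF f z, of i k]
    by (simp add: DX_def)
  have "DX i (GG f) z = DX i (\<lambda>z. \<Sum>k\<in>UNIV. snd z $ k * DX k f z) z - DX i (\<lambda>z. 2 * (\<Sum>k\<in>UNIV. G k z * DY k f z)) z"
    unfolding GG_def[abs_def] DX_def
    by (rule pd_diff) (intro d smooth_on_cmult smooth_on_sum smooth_on_mult open_Om sm_y sm_G sm_DX[unfolded DX_def] sm_DY f)+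
  also have "DX i (\<lambda>z. \<Sum>k\<in>UNIV. snd z $ k * DX k f z) z = (\<Sum>k\<in>UNIV. DX i (\<lambda>z. snd z $ k * DX k f z) z)"
    unfolding DX_def by (rule pd_sum) (intro d smooth_on_mult open_Om sm_y sm_DX[unfolded DX_def] f)
  also have "DX i (\<lambda>z. 2 * (\<Sum>k\<in>UNIV. G k z * DY k f z)) z = 2 * DX i (\<lambda>z. \<Sum>k\<in>UNIV. G k z * DY k f z) z"
    unfolding DX_def by (rule pd_cmult) (intro d smooth_on_sum smooth_on_mult open_Om sm_G sm_DY f)
  also have "DX i (\<lambda>z. \<Sum>k\<in>UNIV. G k z * DY k f z) z = (\<Sum>k\<in>UNIV. DX i (\<lambda>z. G k z * DY k f z) z)"
    unfolding DX_def by (rule pd_sum) (intro d smooth_on_mult open_Om sm_G sm_DY f)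
  finally show ?thesis unfolding 1 2 sum.distrib GG_def by simp
qed

text \<open>Lowering the index in the definition of \<open>spray\<close> leaves the Euler-Lagrange
  equation of the energy \<open>L\<close>. Later proofs use this equation and never unfold the
  coordinate formula again.\<close>

lemma euler_lagrange:
  assumes z: "z \<in> Om" shows "GG (DY l L) z = DX l L z"
proof -
  define e where "e = (\<lambda>l. (\<Sum>k\<in>UNIV. DX k (DY l L) z * snd z $ k) - DX l L z)"
  have "(\<Sum>i\<in>UNIV. g l i z * G i z) = 1/4 * (\<Sum>i\<in>UNIV. \<Sum>m\<in>UNIV. g l i z * gi i m z * e m)"
    unfolding spray_def e_def by (simp add: sum_distrib_left mult_ac)
  also have "(\<Sum>i\<in>UNIV. \<Sum>m\<in>UNIV. g l i z * gi i m z * e m) = (\<Sum>m\<in>UNIV. (\<Sum>i\<in>UNIV. g l i z * gi i m z) * e m)"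
    by (subst sum.swap) (simp add: sum_distrib_right)
  also have "\<dots> = e l" by (simp add: g_gi[OF z])
  finally have "(\<Sum>i\<in>UNIV. g l i z * G i z) = 1/4 * e l" .
  moreover have "g l i z = 1/2 * DY i (DY l L) z" for i using DYY[OF sm_L z, of i l] by (simp add: gten_def)
  ultimately have "(\<Sum>i\<in>UNIV. G i z * DY i (DY l L) z) = 1/2 * e l"
    by (simp add: mult_ac flip: sum_divide_distrib)
  then show ?thesis unfolding GG_def e_def by (simp add: mult_ac)
qed

text \<open>Conservation of energy: contract the Euler-Lagrange equation with the flagpole and
  evaluate the contractions by Euler's identity.\<close>

lemma GG_L: assumes z: "z \<in> Om" shows "GG L z = 0"
proof -
  have "(\<Sum>l\<in>UNIV. snd z $ l * DX l L z) = (\<Sum>l\<in>UNIV. snd z $ l * GG (DY l L) z)"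
    using euler_lagrange[OF z] by simp
  also have "\<dots> = (\<Sum>l\<in>UNIV. \<Sum>k\<in>UNIV. snd z $ k * (snd z $ l * DY l (DX k L) z)) - 2 * (\<Sum>l\<in>UNIV. \<Sum>k\<in>UNIV. G k z * (snd z $ l * DY l (DY k L) z))"
    unfolding GG_def DXY[OF sm_L z] DYY[OF sm_L z, of _ l for l]
    by (simp add: right_diff_distrib sum_subtractf sum_distrib_left mult_ac DYY[OF sm_L z])
  also have "\<dots> = (\<Sum>k\<in>UNIV. snd z $ k * (2 * DX k L z)) - 2 * (\<Sum>k\<in>UNIV. G k z * DY k L z)"
    by (subst (1 2) sum.swap)
       (simp add: euler[OF sm_DX[OF sm_L] hom_DX[OF sm_L hom_L] z] euler[OF sm_DY[OF sm_L] hom_L1 z] flip: sum_distrib_left)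
  finally show ?thesis unfolding GG_def by (simp add: mult.left_commute flip: sum_distrib_left)
qed

text \<open>Inserting the Euler-Lagrange equation into the vertical derivative of
  \<open>GG_L\<close> doubles both sides of the claim. It says that \<open>L\<close> is constant
  along the horizontal fields \<open>DX i - (\<Sum>j. N i j * DY j)\<close>.\<close>

lemma DX_L: assumes z: "z \<in> Om" shows "DX i L z = (\<Sum>j\<in>UNIV. N i j z * DY j L z)"
proof -
  have "DY i (GG L) z = DY i (\<lambda>_. 0) z" by (rule DY_cong) (use GG_L z in auto)
  then have "DY i (GG L) z = 0" by (simp add: DY_def)
  then show ?thesis using DY_GG[OF sm_L z, of i] euler_lagrange[OF z, of i] by simp
qed

text \<open>A vertical derivative of the Euler-Lagrange equation is not symmetric in
  \<open>j\<close> and \<open>l\<close>; adding the two versions cancels the mixed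
  \<open>x\<close>-\<open>y\<close> derivatives. The outcome is the metric compatibility of the
  spray.\<close>

lemma GG_L2: assumes z: "z \<in> Om"
  shows "GG (DY j (DY l L)) z = (\<Sum>k\<in>UNIV. N j k z * DY k (DY l L) z) + (\<Sum>k\<in>UNIV. N l k z * DY k (DY j L) z)"
proof -
  have *: "GG (DY j (DY l L)) z + DX j (DY l L) z - 2 * (\<Sum>k\<in>UNIV. N j k z * DY k (DY l L) z) = DY j (DX l L) z" for j l
    unfolding DY_GG[OF sm_DY[OF sm_L] z, symmetric] by (rule DY_cong) (use euler_lagrange z in auto)
  have "GG (DY l (DY j L)) z = GG (DY j (DY l L)) z" by (rule GG_cong) (use DYY[OF sm_L] z in auto)
  then show ?thesis using *[of j l] *[of l j] DXY[OF sm_L z, of j l] DXY[OF sm_L z, of l j] by linarith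
qed

lemma GG_g: assumes z: "z \<in> Om"
  shows "GG (g i j) z = (\<Sum>k\<in>UNIV. N i k z * g k j z) + (\<Sum>k\<in>UNIV. N j k z * g k i z)"
  using GG_L2[OF z, of i j] GG_cmult[OF sm_DY[OF sm_DY[OF sm_L]] z, of "1/2" i j]
  unfolding gten_def[abs_def] by (simp add: sum_divide_distrib add_divide_distrib)

lemma GG_gi: assumes z: "z \<in> Om"
  shows "GG (gi i j) z = - (\<Sum>k\<in>UNIV. N k i z * gi k j z) - (\<Sum>k\<in>UNIV. N k j z * gi i k z)"
proof -
  let ?w = "(snd z, \<chi> k. -2 * G k z)"
  have "GG (gi i j) z = - (\<Sum>k\<in>UNIV. \<Sum>l\<in>UNIV. gi i k z * GG (g k l) z * gi l j z)"
    using pd_matrix_inv[OF open_Om _ det_nz z, where v="?w" and i=i and j=j] sm_g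
    by (simp add: GG_pd sm_diff sm_g sm_gi z ginv_gm sm_gi[unfolded ginv_gm])
  also have "(\<Sum>k\<in>UNIV. \<Sum>l\<in>UNIV. gi i k z * GG (g k l) z * gi l j z)
      = (\<Sum>k\<in>UNIV. \<Sum>l\<in>UNIV. \<Sum>m\<in>UNIV. gi i k z * N k m z * (g m l z * gi l j z))
       + (\<Sum>k\<in>UNIV. \<Sum>l\<in>UNIV. \<Sum>m\<in>UNIV. (gi i k z * g k m z) * (N l m z * gi l j z))"
    unfolding GG_g[OF z] using g_sym[OF z]
    by (simp add: sum_distrib_left sum_distrib_right distrib_left distrib_right sum.distrib mult_ac)
  also have "(\<Sum>k\<in>UNIV. \<Sum>l\<in>UNIV. \<Sum>m\<in>UNIV. gi i k z * N k m z * (g m l z * gi l j z)) = (\<Sum>k\<in>UNIV. gi i k z * N k j z)"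
    by (intro sum.cong refl, subst sum.swap) (simp add: g_gi[OF z] flip: sum_distrib_left)
  also have "(\<Sum>k\<in>UNIV. \<Sum>l\<in>UNIV. \<Sum>m\<in>UNIV. (gi i k z * g k m z) * (N l m z * gi l j z)) = (\<Sum>l\<in>UNIV. N l i z * gi l j z)"
    by (subst sum.swap, intro sum.cong refl, subst sum.swap) (simp add: gi_g[OF z] flip: sum_distrib_right)
  finally show ?thesis by (simp add: mult_ac)
qed

end

section \<open>The mean Cartan torsion along the spray\<close>

context finsler_chart
begin

text \<open>The distortion up to the volume density. Squaring the determinant spares a proof of its positivity.\<close>

definition tau0 :: "(real^'n) \<times> (real^'n) \<Rightarrow> real" where
  "tau0 z = 1/4 * ln ((det (gm z))\<^sup>2)"

lemma sm_ln_det: "sm (\<lambda>z. ln ((det (gm z))\<^sup>2))"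
  by (intro smooth_on_ln smooth_on_power smooth_on_det open_Om) (auto simp: sm_g det_nz)

lemma sm_tau0: "sm tau0"
  unfolding tau0_def[abs_def] by (intro smooth_on_cmult open_Om sm_ln_det)

lemma hom_tau0: "hom 0 tau0" unfolding hom_def tau0_def by (auto simp: gm_hom)

lemma pd_tau0:
  assumes z: "z \<in> Om"
  shows "pd v tau0 z = 1/2 * (\<Sum>i\<in>UNIV. \<Sum>j\<in>UNIV. gi i j z * pd v (g i j) z)"
proof -
  have d: "(\<lambda>z. gm z $ i $ j) differentiable (at z)" for i j using sm_diff[OF sm_g z] by simp
  note dd = pd_det[OF d det_nz[OF z]]
  have "pd v tau0 z = 1/4 * (pd v (\<lambda>z. (det (gm z))\<^sup>2) z * inverse ((det (gm z))\<^sup>2))"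
    unfolding tau0_def[abs_def] pd_cmult[OF sm_diff[OF sm_ln_det z]]
    by (subst pd_ln) (use det_nz[OF z] dd(1) in auto)
  also have "pd v (\<lambda>z. (det (gm z))\<^sup>2) z = 2 * det (gm z) * pd v (\<lambda>z. det (gm z)) z"
    unfolding power2_eq_square using pd_mult[OF dd(1) dd(1)] by simp
  also have "pd v (\<lambda>z. det (gm z)) z = det (gm z) * (\<Sum>i\<in>UNIV. \<Sum>j\<in>UNIV. gi i j z * pd v (g i j) z)"
    using dd(2)[of v] gi_sym[OF z] by (simp flip: ginv_gm)
  finally show ?thesis using det_nz[OF z] by (simp add: field_simps power2_eq_square)
qed

lemma DY_tau0: "z \<in> Om \<Longrightarrow> DY k tau0 z = 1/2 * (\<Sum>i\<in>UNIV. \<Sum>j\<in>UNIV. gi i j z * DY k (g i j) z)"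
  and DX_tau0: "z \<in> Om \<Longrightarrow> DX k tau0 z = 1/2 * (\<Sum>i\<in>UNIV. \<Sum>j\<in>UNIV. gi i j z * DX k (g i j) z)"
  unfolding DY_def DX_def by (rule pd_tau0; assumption)+

lemma gi_N_g:
  assumes z: "z \<in> Om"
  shows "(\<Sum>i\<in>UNIV. \<Sum>j\<in>UNIV. gi i j z * (\<Sum>k\<in>UNIV. A i k * g k j z)) = (\<Sum>i\<in>UNIV. A i i)"
    and "(\<Sum>i\<in>UNIV. \<Sum>j\<in>UNIV. gi i j z * (\<Sum>k\<in>UNIV. A j k * g k i z)) = (\<Sum>i\<in>UNIV. A i i)"
proof -
  have *: "(\<Sum>i\<in>UNIV. \<Sum>j\<in>UNIV. gi i j z * (\<Sum>k\<in>UNIV. A i k * g k j z)) = (\<Sum>i\<in>UNIV. A i i)" for A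
  proof (intro sum.cong refl)
    fix i
    have "(\<Sum>j\<in>UNIV. gi i j z * (\<Sum>k\<in>UNIV. A i k * g k j z)) = (\<Sum>j\<in>UNIV. \<Sum>k\<in>UNIV. A i k * (gi i j z * g j k z))"
      using g_sym[OF z] by (simp add: sum_distrib_left mult_ac)
    also have "\<dots> = (\<Sum>k\<in>UNIV. A i k * (\<Sum>j\<in>UNIV. gi i j z * g j k z))"
      by (subst sum.swap) (simp add: sum_distrib_left)
    also have "\<dots> = A i i" by (simp add: gi_g[OF z])
    finally show "(\<Sum>j\<in>UNIV. gi i j z * (\<Sum>k\<in>UNIV. A i k * g k j z)) = A i i" .
  qed
  then show "(\<Sum>i\<in>UNIV. \<Sum>j\<in>UNIV. gi i j z * (\<Sum>k\<in>UNIV. A i k * g k j z)) = (\<Sum>i\<in>UNIV. A i i)" .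
  have "(\<Sum>i\<in>UNIV. \<Sum>j\<in>UNIV. gi i j z * (\<Sum>k\<in>UNIV. A j k * g k i z)) = (\<Sum>i\<in>UNIV. \<Sum>j\<in>UNIV. gi i j z * (\<Sum>k\<in>UNIV. A i k * g k j z))"
    by (subst sum.swap) (simp add: gi_sym[OF z])
  then show "(\<Sum>i\<in>UNIV. \<Sum>j\<in>UNIV. gi i j z * (\<Sum>k\<in>UNIV. A j k * g k i z)) = (\<Sum>i\<in>UNIV. A i i)" using * by simp
qed

text \<open>Half the trace of \<open>GG_g\<close>. The right side is the divergence term of the
  S-curvature, so only the volume density is missing for \<open>S = G tau\<close>.\<close>

lemma GG_tau0: assumes z: "z \<in> Om" shows "GG tau0 z = (\<Sum>i\<in>UNIV. N i i z)"
proof -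
  have "GG tau0 z = 1/2 * (\<Sum>i\<in>UNIV. \<Sum>j\<in>UNIV. gi i j z * GG (g i j) z)"
    by (simp add: GG_pd sm_diff sm_tau0 sm_g z pd_tau0)
  also have "(\<Sum>i\<in>UNIV. \<Sum>j\<in>UNIV. gi i j z * GG (g i j) z)
      = (\<Sum>i\<in>UNIV. \<Sum>j\<in>UNIV. gi i j z * (\<Sum>k\<in>UNIV. N i k z * g k j z)) + (\<Sum>i\<in>UNIV. \<Sum>j\<in>UNIV. gi i j z * (\<Sum>k\<in>UNIV. N j k z * g k i z))"
    unfolding GG_g[OF z] by (simp add: distrib_left sum.distrib)
  finally show ?thesis by (simp add: gi_N_g[OF z])
qed

lemma tau0_euler: "z \<in> Om \<Longrightarrow> (\<Sum>i\<in>UNIV. snd z $ i * DY i tau0 z) = 0"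
  using euler[OF sm_tau0 hom_tau0] by simp

subsection \<open>The dual inner product\<close>

definition ip :: "('n \<Rightarrow> real) \<Rightarrow> ('n \<Rightarrow> real) \<Rightarrow> (real^'n) \<times> (real^'n) \<Rightarrow> real" where
  "ip a b z = (\<Sum>i\<in>UNIV. \<Sum>j\<in>UNIV. gi i j z * a i * b j)"

definition raise :: "('n \<Rightarrow> real) \<Rightarrow> (real^'n) \<times> (real^'n) \<Rightarrow> real^'n" where
  "raise a z = (\<chi> i. \<Sum>j\<in>UNIV. gi i j z * a j)"

lemma lower_raise: assumes "z \<in> Om" shows "(\<Sum>j\<in>UNIV. g i j z * raise a z $ j) = a i"
proof -
  have "(\<Sum>j\<in>UNIV. g i j z * raise a z $ j) = (\<Sum>j\<in>UNIV. \<Sum>k\<in>UNIV. (g i j z * gi j k z) * a k)"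
    by (simp add: raise_def sum_distrib_left mult_ac)
  also have "\<dots> = (\<Sum>k\<in>UNIV. (\<Sum>j\<in>UNIV. g i j z * gi j k z) * a k)"
    by (subst sum.swap) (simp add: sum_distrib_right)
  finally show ?thesis by (simp add: g_gi[OF assms])
qed

lemma gform_raise: assumes "z \<in> Om" shows "gform F c z v (raise a z) = (\<Sum>i\<in>UNIV. v $ i * a i)"
proof -
  have "gform F c z v (raise a z) = (\<Sum>i\<in>UNIV. v $ i * (\<Sum>j\<in>UNIV. g i j z * raise a z $ j))"
    unfolding gform_def by (simp add: sum_distrib_left mult_ac)
  then show ?thesis by (simp add: lower_raise[OF assms])
qed

lemma gform_sym: assumes "z \<in> Om" shows "gform F c z u v = gform F c z v u"
  unfolding gform_def by (subst sum.swap) (simp add: g_sym[OF assms] mult_ac)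

lemma ip_raise: "ip a b z = (\<Sum>i\<in>UNIV. a i * raise b z $ i)"
  by (simp add: ip_def raise_def sum_distrib_left mult_ac)

lemma ip_gform: assumes "z \<in> Om" shows "ip a a z = gform F c z (raise a z) (raise a z)"
  unfolding gform_raise[OF assms] ip_raise by (simp add: mult_ac)

lemma raise_eq_0: assumes "z \<in> Om" "raise a z = 0" shows "a i = 0"
  using lower_raise[OF assms(1), of i a] assms(2) by simp

lemma gform_nonneg: "z \<in> Om \<Longrightarrow> gform F c z v v \<ge> 0"
  using g_posdef[of "fst z" "snd z" v] by (cases "v = 0") (auto simp: gform_def intro: less_imp_le)

lemma ip_nonneg: "z \<in> Om \<Longrightarrow> ip a a z \<ge> 0"
  unfolding ip_gform by (rule gform_nonneg)

lemma ip_eq_0: assumes "z \<in> Om" "ip a a z = 0" shows "a i = 0"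
proof -
  have "raise a z = 0" using g_posdef[of "fst z" "snd z" "raise a z"] assms ip_gform[OF assms(1), of a] by (cases z) force
  then show ?thesis by (rule raise_eq_0[OF assms(1)])
qed

lemma ip_sym: "z \<in> Om \<Longrightarrow> ip a b z = ip b a z"
  unfolding ip_def by (subst sum.swap) (simp add: gi_sym mult_ac)

lemma sm_ip: assumes "\<And>i. sm (A i)" "\<And>i. sm (B i)" shows "sm (\<lambda>z. ip (\<lambda>i. A i z) (\<lambda>i. B i z) z)"
  unfolding ip_def by (intro smooth_on_sum smooth_on_mult open_Om sm_gi assms)

text \<open>Product rule for the covariant derivative along the spray, which sends a covector field
  \<open>A\<close> to \<open>GG A - N A\<close>: the terms in which the spray differentiates
  \<open>gi\<close> are exactly those absorbed by \<open>N\<close>.\<close>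

lemma GG_ip:
  assumes A: "\<And>i. sm (A i)" and B: "\<And>i. sm (B i)" and z: "z \<in> Om"
  shows "GG (\<lambda>z. ip (\<lambda>i. A i z) (\<lambda>i. B i z) z) z
    = ip (\<lambda>i. GG (A i) z - (\<Sum>k\<in>UNIV. N i k z * A k z)) (\<lambda>i. B i z) z
    + ip (\<lambda>i. A i z) (\<lambda>i. GG (B i) z - (\<Sum>k\<in>UNIV. N i k z * B k z)) z"
proof -
  have s1: "sm (\<lambda>z. gi i j z * A i z)" for i j by (intro smooth_on_mult open_Om sm_gi A)
  have s2: "sm (\<lambda>z. gi i j z * A i z * B j z)" for i j by (intro smooth_on_mult open_Om s1 B)
  have "GG (\<lambda>z. ip (\<lambda>i. A i z) (\<lambda>i. B i z) z) z = (\<Sum>i\<in>UNIV. \<Sum>j\<in>UNIV. GG (\<lambda>z. gi i j z * A i z * B j z) z)"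
    unfolding ip_def by (subst GG_sum; (intro smooth_on_sum open_Om s2 z finite)?)+ simp
  also have "\<dots> = (\<Sum>i\<in>UNIV. \<Sum>j\<in>UNIV. GG (gi i j) z * A i z * B j z)
      + ip (\<lambda>i. GG (A i) z) (\<lambda>i. B i z) z + ip (\<lambda>i. A i z) (\<lambda>i. GG (B i) z) z"
    unfolding ip_def GG_mult[OF s1 B z] GG_mult[OF sm_gi A z]
    by (simp add: distrib_right distrib_left sum.distrib)
  also have "(\<Sum>i\<in>UNIV. \<Sum>j\<in>UNIV. GG (gi i j) z * A i z * B j z)
      = - (\<Sum>i\<in>UNIV. \<Sum>j\<in>UNIV. \<Sum>k\<in>UNIV. N k i z * gi k j z * A i z * B j z)
        - (\<Sum>i\<in>UNIV. \<Sum>j\<in>UNIV. \<Sum>k\<in>UNIV. N k j z * gi i k z * A i z * B j z)"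
    unfolding GG_gi[OF z] by (simp add: left_diff_distrib sum_subtractf sum_distrib_right sum_negf)
  also have "(\<Sum>i\<in>UNIV. \<Sum>j\<in>UNIV. \<Sum>k\<in>UNIV. N k i z * gi k j z * A i z * B j z) = ip (\<lambda>i. \<Sum>k\<in>UNIV. N i k z * A k z) (\<lambda>i. B i z) z"
  proof -
    have "(\<Sum>i\<in>UNIV. \<Sum>j\<in>UNIV. \<Sum>k\<in>UNIV. N k i z * gi k j z * A i z * B j z) = (\<Sum>i\<in>UNIV. \<Sum>k\<in>UNIV. \<Sum>j\<in>UNIV. N k i z * gi k j z * A i z * B j z)"
      by (intro sum.cong refl sum.swap)
    also have "\<dots> = (\<Sum>k\<in>UNIV. \<Sum>i\<in>UNIV. \<Sum>j\<in>UNIV. N k i z * gi k j z * A i z * B j z)" by (rule sum.swap)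
    also have "\<dots> = (\<Sum>k\<in>UNIV. \<Sum>j\<in>UNIV. \<Sum>i\<in>UNIV. N k i z * gi k j z * A i z * B j z)"
      by (intro sum.cong refl sum.swap)
    finally show ?thesis unfolding ip_def by (simp add: sum_distrib_left sum_distrib_right mult_ac)
  qed
  also have "(\<Sum>i\<in>UNIV. \<Sum>j\<in>UNIV. \<Sum>k\<in>UNIV. N k j z * gi i k z * A i z * B j z) = ip (\<lambda>i. A i z) (\<lambda>i. \<Sum>k\<in>UNIV. N i k z * B k z) z"
  proof -
    have "(\<Sum>i\<in>UNIV. \<Sum>j\<in>UNIV. \<Sum>k\<in>UNIV. N k j z * gi i k z * A i z * B j z) = (\<Sum>i\<in>UNIV. \<Sum>k\<in>UNIV. \<Sum>j\<in>UNIV. N k j z * gi i k z * A i z * B j z)"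
      by (intro sum.cong refl sum.swap)
    then show ?thesis unfolding ip_def by (simp add: sum_distrib_left mult_ac)
  qed
  finally show ?thesis unfolding ip_def by (simp add: right_diff_distrib left_diff_distrib sum_subtractf)
qed

end

text \<open>The hypothesis \<open>S0\<close> says that the S-curvature vanishes when \<open>ls\<close> is the logarithm of the volume density.\<close>

locale finsler_S0 = finsler_chart +
  fixes ls :: "real^'b \<Rightarrow> real"
  assumes ls_smooth: "smooth_on (snd c ` fst c) ls"
    and S0: "x \<in> snd c ` fst c \<Longrightarrow> y \<noteq> 0 \<Longrightarrow> (\<Sum>i\<in>UNIV. DY i (spray F c i) (x, y)) = (\<Sum>i\<in>UNIV. y $ i * pd (axis i 1) ls x)"
begin

definition tau :: "(real^'b) \<times> (real^'b) \<Rightarrow> real" where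
  "tau z = tau0 z - ls (fst z)"

lemma smooth_map_fst: "smooth_map_on Om fst"
  unfolding smooth_map_on_def
  by (auto intro!: smooth_on_bounded_linear open_Om bounded_linear_compose[OF bounded_linear_inner_left bounded_linear_fst])

lemma sm_ls: "sm (\<lambda>z. ls (fst z))"
  by (rule smooth_on_compose[OF open_Om open_U smooth_map_fst _ ls_smooth]) auto

lemma sm_tau: "sm tau"
  unfolding tau_def[abs_def] by (intro smooth_on_diff open_Om sm_tau0 sm_ls)

lemma pd_ls: assumes "z \<in> Om" shows "pd v (\<lambda>z. ls (fst z)) z = pd (fst v) ls (fst z)"
  by (rule pd_chain[where D=fst]) (use assms smooth_on_imp_differentiable[OF ls_smooth open_U] in \<open>auto intro!: derivative_eq_intros\<close>)

lemma DY_tau: assumes z: "z \<in> Om" shows "DY i tau z = DY i tau0 z"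
proof -
  have "ls differentiable (at (fst z))" using z smooth_on_imp_differentiable[OF ls_smooth open_U] by auto
  then have "pd (0::real^'b) ls (fst z) = 0" using linear_0[OF pd_linear] by blast
  then show ?thesis
    unfolding DY_def tau_def[abs_def] using pd_ls[OF z, of "(0, axis i 1)"]
    by (simp add: pd_diff sm_diff[OF _ z] sm_tau0 sm_ls)
qed

lemma DX_tau: assumes z: "z \<in> Om" shows "DX i tau z = DX i tau0 z - pd (axis i 1) ls (fst z)"
  unfolding DX_def tau_def[abs_def] using pd_ls[OF z, of "(axis i 1, 0)"]
  by (simp add: pd_diff sm_diff[OF _ z] sm_tau0 sm_ls)

lemma GG_tau: assumes z: "z \<in> Om" shows "GG tau z = 0"
proof -
  have "GG tau z = GG tau0 z - (\<Sum>i\<in>UNIV. snd z $ i * pd (axis i 1) ls (fst z))"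
    unfolding GG_def using DY_tau[OF z] DX_tau[OF z] by (simp add: right_diff_distrib sum_subtractf)
  then show ?thesis using GG_tau0[OF z] S0[of "fst z" "snd z"] z by (cases z) auto
qed

abbreviation "I i \<equiv> DY i tau"

text \<open>The mean Landsberg curvature, written as minus the horizontal derivative of
  \<open>tau\<close>. \<open>GG_I\<close> identifies it with the covariant derivative of
  \<open>I\<close> along the spray, and in this form \<open>J = 0\<close> reads directly as
  horizontal constancy of \<open>tau\<close>.\<close>

definition J :: "'b \<Rightarrow> (real^'b) \<times> (real^'b) \<Rightarrow> real" where
  "J i z = (\<Sum>j\<in>UNIV. N i j z * I j z) - DX i tau z"

lemma sm_I: "sm (I i)" by (intro sm_DY sm_tau)

lemma sm_J: "sm (J i)"
  unfolding J_def[abs_def] by (intro smooth_on_diff smooth_on_sum smooth_on_mult open_Om sm_DY sm_DX sm_G sm_tau)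

lemma GG_I: assumes z: "z \<in> Om" shows "GG (I i) z = (\<Sum>j\<in>UNIV. N i j z * I j z) + J i z"
proof -
  have "DY i (GG tau) z = DY i (\<lambda>_. 0) z" by (rule DY_cong) (use GG_tau z in auto)
  then have "DY i (GG tau) z = 0" by (simp add: DY_def)
  then show ?thesis using DY_GG[OF sm_tau z, of i] unfolding J_def by simp
qed

lemma GG_DX_tau: assumes z: "z \<in> Om" shows "GG (DX i tau) z = 2 * (\<Sum>j\<in>UNIV. DX i (G j) z * I j z)"
proof -
  have "DX i (GG tau) z = DX i (\<lambda>_. 0) z" by (rule DX_cong) (use GG_tau z in auto)
  then have "DX i (GG tau) z = 0" by (simp add: DX_def)
  then show ?thesis using DX_GG[OF sm_tau z, of i] by simp
qed

text \<open>The two middle sums of the coordinate formula form minus the spray derivative of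
  \<open>N i j\<close>. This is the shape in which the curvature comes out of the
  commutators.\<close>

lemma riem_GG: "riem F c j i z = 2 * DX i (G j) z - GG (N i j) z - (\<Sum>k\<in>UNIV. N k j z * N i k z)"
  unfolding riem_def GG_def by simp

text \<open>With \<open>GG_I\<close> this is the Jacobi-type equation for \<open>I\<close>. The
  \<open>x\<close>-derivatives of \<open>G\<close> come from \<open>GG_DX_tau\<close>, the rest from
  the product rule for \<open>N * I\<close>, and they assemble to \<open>riem_GG\<close>.\<close>

lemma GG_J: assumes z: "z \<in> Om"
  shows "GG (J i) z = (\<Sum>j\<in>UNIV. N i j z * J j z) - (\<Sum>j\<in>UNIV. riem F c j i z * I j z)"
proof -
  have "GG (J i) z = (\<Sum>j\<in>UNIV. GG (\<lambda>z. N i j z * I j z) z) - GG (DX i tau) z"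
    unfolding J_def[abs_def]
    by (subst GG_diff GG_sum; (intro smooth_on_sum smooth_on_mult open_Om sm_DY sm_DX sm_G sm_tau z finite)?)+ simp
  also have "(\<Sum>j\<in>UNIV. GG (\<lambda>z. N i j z * I j z) z) = (\<Sum>j\<in>UNIV. GG (N i j) z * I j z + N i j z * GG (I j) z)"
    by (simp add: GG_mult sm_DY sm_G sm_tau z)
  also have "\<dots> = (\<Sum>j\<in>UNIV. GG (N i j) z * I j z) + (\<Sum>j\<in>UNIV. \<Sum>k\<in>UNIV. N i j z * (N j k z * I k z)) + (\<Sum>j\<in>UNIV. N i j z * J j z)"
    unfolding GG_I[OF z] by (simp add: distrib_left sum.distrib sum_distrib_left)
  also have "(\<Sum>j\<in>UNIV. \<Sum>k\<in>UNIV. N i j z * (N j k z * I k z)) = (\<Sum>k\<in>UNIV. (\<Sum>j\<in>UNIV. N j k z * N i j z) * I k z)"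
    by (subst sum.swap) (simp add: sum_distrib_right sum_distrib_left mult_ac)
  finally show ?thesis
    unfolding riem_GG GG_DX_tau[OF z]
    by (simp add: left_diff_distrib right_diff_distrib sum_subtractf sum_distrib_left mult_ac)
qed

definition RI :: "'b \<Rightarrow> (real^'b) \<times> (real^'b) \<Rightarrow> real" where
  "RI i z = (\<Sum>j\<in>UNIV. riem F c j i z * I j z)"

definition phi :: "(real^'b) \<times> (real^'b) \<Rightarrow> real" where
  "phi z = L z * ip (\<lambda>i. I i z) (\<lambda>i. I i z) z"

lemma sm_phi: "sm phi"
  unfolding phi_def[abs_def] by (intro smooth_on_mult open_Om sm_L sm_ip sm_I)

lemma hom_I: "hom (-1) (I i)"
proof -
  have "hom (0 - 1) (DY i tau0)" by (rule hom_DY[OF sm_tau0 hom_tau0])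
  then show ?thesis unfolding hom_def using DY_tau by force
qed

lemma hom_phi: "hom 0 phi"
proof -
  have "hom (0 + (-1) + (-1)) (\<lambda>z. gi i j z * I i z * I j z)" for i j
    by (intro hom_mult hom_gi hom_I)
  then have "hom (-2) (\<lambda>z. ip (\<lambda>i. I i z) (\<lambda>i. I i z) z)" unfolding ip_def by (intro hom_sum) simp
  from hom_mult[OF hom_L this] show ?thesis unfolding phi_def[abs_def] by simp
qed

lemma GG_L_mult: assumes "sm f" and z: "z \<in> Om" shows "GG (\<lambda>z. L z * f z) z = L z * GG f z"
  using GG_mult[OF sm_L assms] GG_L[OF z] by simp

lemma GG_phi: assumes z: "z \<in> Om" shows "GG phi z = 2 * (L z * ip (\<lambda>i. I i z) (\<lambda>i. J i z) z)"
proof -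
  have "GG phi z = L z * GG (\<lambda>z. ip (\<lambda>i. I i z) (\<lambda>i. I i z) z) z"
    unfolding phi_def[abs_def] by (intro GG_L_mult sm_ip sm_I z)
  also have "GG (\<lambda>z. ip (\<lambda>i. I i z) (\<lambda>i. I i z) z) z = ip (\<lambda>i. J i z) (\<lambda>i. I i z) z + ip (\<lambda>i. I i z) (\<lambda>i. J i z) z"
    unfolding GG_ip[OF sm_I sm_I z] GG_I[OF z] by simp
  finally show ?thesis using ip_sym[OF z, of "\<lambda>i. J i z" "\<lambda>i. I i z"] by simp
qed

lemma GG_GG_phi: assumes z: "z \<in> Om"
  shows "GG (GG phi) z = 2 * L z * (ip (\<lambda>i. J i z) (\<lambda>i. J i z) z - ip (\<lambda>i. I i z) (\<lambda>i. RI i z) z)"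
proof -
  have "GG (GG phi) z = GG (\<lambda>z. 2 * (L z * ip (\<lambda>i. I i z) (\<lambda>i. J i z) z)) z"
    by (rule GG_cong) (use GG_phi z in auto)
  also have "\<dots> = 2 * (L z * GG (\<lambda>z. ip (\<lambda>i. I i z) (\<lambda>i. J i z) z) z)"
    by (subst GG_cmult GG_L_mult; (intro smooth_on_mult open_Om sm_L sm_ip sm_I sm_J z)?)+ simp
  also have "GG (\<lambda>z. ip (\<lambda>i. I i z) (\<lambda>i. J i z) z) z = ip (\<lambda>i. J i z) (\<lambda>i. J i z) z + ip (\<lambda>i. I i z) (\<lambda>i. - RI i z) z"
    unfolding GG_ip[OF sm_I sm_J z] GG_I[OF z] GG_J[OF z] RI_def[symmetric] by simp
  also have "ip (\<lambda>i. I i z) (\<lambda>i. - RI i z) z = - ip (\<lambda>i. I i z) (\<lambda>i. RI i z) z"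
    unfolding ip_def by (simp add: sum_negf)
  finally show ?thesis by simp
qed

lemma I_y: "z \<in> Om \<Longrightarrow> (\<Sum>i\<in>UNIV. snd z $ i * I i z) = 0"
  using tau0_euler[of z] DY_tau[of z] by simp

text \<open>The raised mean Cartan torsion is orthogonal to the flagpole, so it spans a flag with it.\<close>

lemma flag_curv_I:
  assumes z: "z \<in> Om" and ne: "I k z \<noteq> 0"
  defines "u \<equiv> raise (\<lambda>i. I i z) z"
  shows "u \<notin> span {snd z}"
    and "flag_curv F c (fst z) (snd z) u * (gform F c z (snd z) (snd z) * gform F c z u u) = ip (\<lambda>i. I i z) (\<lambda>i. RI i z) z"
    and "gform F c z (snd z) (snd z) * gform F c z u u > 0"
proof -
  have zz: "(fst z, snd z) = z" "fst z \<in> U" "snd z \<noteq> 0" using z by auto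
  have u0: "u \<noteq> 0" using raise_eq_0[OF z, of "\<lambda>i. I i z" k] ne unfolding u_def by auto
  have yu: "gform F c z (snd z) u = 0" unfolding u_def gform_raise[OF z] by (rule I_y[OF z])
  have pos: "gform F c z (snd z) (snd z) > 0" "gform F c z u u > 0"
    using g_posdef[OF zz(2,3)] u0 zz by auto
  then show "gform F c z (snd z) (snd z) * gform F c z u u > 0" by simp
  show "u \<notin> span {snd z}"
  proof
    assume "u \<in> span {snd z}"
    then obtain s where s: "u = s *\<^sub>R snd z" by (auto simp: span_singleton)
    then have "gform F c z (snd z) u = s * gform F c z (snd z) (snd z)"
      by (simp add: gform_def sum_distrib_left mult_ac)
    then have "s = 0" using yu pos by simp
    then show False using s u0 by simp
  qed
  have "gform F c z u (riem_op F c z u) = gform F c z (riem_op F c z u) u" by (rule gform_sym[OF z])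
  also have "\<dots> = (\<Sum>l\<in>UNIV. riem_op F c z u $ l * I l z)" unfolding u_def by (rule gform_raise[OF z])
  also have "\<dots> = (\<Sum>l\<in>UNIV. \<Sum>k\<in>UNIV. riem F c l k z * u $ k * I l z)"
    by (simp add: riem_op_def sum_distrib_right)
  also have "\<dots> = (\<Sum>k\<in>UNIV. RI k z * u $ k)"
    unfolding RI_def by (subst sum.swap) (simp add: sum_distrib_right sum_distrib_left mult_ac)
  also have "\<dots> = ip (\<lambda>i. RI i z) (\<lambda>i. I i z) z" unfolding ip_raise u_def ..
  also have "\<dots> = ip (\<lambda>i. I i z) (\<lambda>i. RI i z) z" by (rule ip_sym[OF z])
  finally show "flag_curv F c (fst z) (snd z) u * (gform F c z (snd z) (snd z) * gform F c z u u) = ip (\<lambda>i. I i z) (\<lambda>i. RI i z) z"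
    using pos yu unfolding flag_curv_def zz by simp
qed

lemma ip_zero_left: "(\<And>i. a i = 0) \<Longrightarrow> ip a b z = 0" by (simp add: ip_def)

lemma ip_I_RI_le:
  assumes z: "z \<in> Om" and K: "\<And>u. u \<notin> span {snd z} \<Longrightarrow> flag_curv F c (fst z) (snd z) u \<le> 0"
  shows "ip (\<lambda>i. I i z) (\<lambda>i. RI i z) z \<le> 0"
proof (cases "\<exists>k. I k z \<noteq> 0")
  case True
  then obtain k where k: "I k z \<noteq> 0" by blast
  show ?thesis using flag_curv_I[OF z k] K by (metis mult_nonpos_nonneg less_imp_le)
qed (simp add: ip_zero_left)

lemma ip_I_RI_lt:
  assumes z: "z \<in> Om" and K: "\<And>u. u \<notin> span {snd z} \<Longrightarrow> flag_curv F c (fst z) (snd z) u < 0" and k: "I k z \<noteq> 0"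
  shows "ip (\<lambda>i. I i z) (\<lambda>i. RI i z) z < 0"
  using flag_curv_I[OF z k] K by (metis mult_neg_pos)

end

section \<open>Differentiability of the volume density\<close>

text \<open>A cutoff that is positive exactly on the interval from 1 to 4, and squared so that its
  derivative is continuous. Composed with \<open>L = F^2\<close> it lives on the shell
  \<open>1 < F < 2\<close>, away from the zero section, where \<open>L\<close> need not be
  smooth.\<close>

definition bump :: "real \<Rightarrow> real" where "bump t = (max 0 ((t - 1) * (4 - t)))\<^sup>2"
definition bump' :: "real \<Rightarrow> real" where "bump' t = 2 * max 0 ((t - 1) * (4 - t)) * (5 - 2 * t)"

lemma has_real_derivative_max0_sq: "((\<lambda>s::real. (max 0 s)\<^sup>2) has_real_derivative 2 * max 0 s) (at s)"
proof -
  consider "s > 0" | "s < 0" | "s = 0" by linarith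
  then show ?thesis
  proof cases
    case 1
    have "((\<lambda>s::real. s\<^sup>2) has_real_derivative 2 * max 0 s) (at s)"
      using 1 by (auto intro!: derivative_eq_intros)
    then show ?thesis
      by (rule has_field_derivative_transform_within_open[where S="{0<..}"]) (use 1 in auto)
  next
    case 2
    have "((\<lambda>s::real. 0) has_real_derivative 2 * max 0 s) (at s)"
      using 2 by (auto intro!: derivative_eq_intros)
    then show ?thesis
      by (rule has_field_derivative_transform_within_open[where S="{..<0}"]) (use 2 in auto)
  next
    case 3
    have "((\<lambda>h::real. ((max 0 (0 + h))\<^sup>2 - (max 0 0)\<^sup>2) / h) \<longlongrightarrow> 0) (at 0)"
    proof (rule tendsto_rabs_zero_cancel, rule tendsto_sandwich[where f="\<lambda>_. 0" and h="\<lambda>h. \<bar>h\<bar>"])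
      show "((\<lambda>h::real. \<bar>h\<bar>) \<longlongrightarrow> 0) (at 0)" by (auto intro!: tendsto_eq_intros)
      have "\<bar>((max 0 (0 + h))\<^sup>2 - (max 0 0)\<^sup>2) / h\<bar> \<le> \<bar>h\<bar>" if "h \<noteq> 0" for h :: real
        using that by (auto simp: max_def power2_eq_square)
      then show "\<forall>\<^sub>F h in at 0. \<bar>((max 0 (0 + h))\<^sup>2 - (max 0 0)\<^sup>2) / h\<bar> \<le> \<bar>h::real\<bar>"
        by (auto simp: eventually_at_filter)
    qed auto
    then show ?thesis using 3 by (simp add: DERIV_def)
  qed
qed

lemma bump_deriv: "(bump has_real_derivative bump' t) (at t)"
proof -
  have "((\<lambda>t::real. (t - 1) * (4 - t)) has_real_derivative (5 - 2 * t)) (at t)"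
    by (auto intro!: derivative_eq_intros)
  from DERIV_chain2[OF has_real_derivative_max0_sq this]
  show ?thesis unfolding bump_def[abs_def] bump'_def by simp
qed

lemma bump_cont: "continuous_on S bump" "continuous_on S bump'"
  unfolding bump_def bump'_def by (intro continuous_intros)+

lemma bump_nonneg: "bump t \<ge> 0" by (simp add: bump_def)

lemma bump_pos: "1 < t \<Longrightarrow> t < 4 \<Longrightarrow> bump t > 0"
  by (simp add: bump_def max_def zero_less_mult_iff)

lemma bump_zero: "t \<le> 1 \<or> t \<ge> 4 \<Longrightarrow> bump t = 0" "t \<le> 1 \<or> t \<ge> 4 \<Longrightarrow> bump' t = 0"
proof -
  assume "t \<le> 1 \<or> t \<ge> 4"
  then have "(t - 1) * (4 - t) \<le> 0" by (auto simp: mult_le_0_iff)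
  then show "bump t = 0" "bump' t = 0" by (simp_all add: bump_def bump'_def max_def)
qed

context finsler_chart
begin

text \<open>\<open>F\<close> has positive extrema on the compact product of a closed ball with the
  unit sphere; homogeneity spreads them over whole fibres.\<close>

lemma F_bounds:
  assumes x0: "x0 \<in> U"
  obtains r a b where "r > 0" "cball x0 r \<subseteq> U" "a > 0" "b > 0"
    "\<And>x y. x \<in> cball x0 r \<Longrightarrow> a * norm y \<le> Floc F c (x, y)"
    "\<And>x y. x \<in> cball x0 r \<Longrightarrow> Floc F c (x, y) \<le> b * norm y"
proof -
  obtain r where r: "r > 0" "cball x0 r \<subseteq> U" using open_U x0 open_contains_cball by blast
  let ?K = "cball x0 r \<times> sphere (0::real^'n) 1"
  have K: "compact ?K" "?K \<subseteq> Om" using r by (auto intro: compact_Times)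
  have ne: "?K \<noteq> {}" using r(1) vector_choose_size[of 1] by (auto simp: dist_norm)
  have cont: "continuous_on ?K (Floc F c)"
    using smooth_on_imp_continuous[OF F_smooth open_Om] K(2) continuous_on_subset by blast
  obtain z1 where z1: "z1 \<in> ?K" "\<And>z. z \<in> ?K \<Longrightarrow> Floc F c z1 \<le> Floc F c z"
    using continuous_attains_inf[OF K(1) ne cont] by blast
  obtain z2 where z2: "z2 \<in> ?K" "\<And>z. z \<in> ?K \<Longrightarrow> Floc F c z \<le> Floc F c z2"
    using continuous_attains_sup[OF K(1) ne cont] by blast
  have pos: "Floc F c z1 > 0" "Floc F c z2 > 0" using F_pos z1(1) z2(1) K(2) by blast+
  have scale: "Floc F c (x, y) = norm y * Floc F c (x, y /\<^sub>R norm y)" if "x \<in> cball x0 r" "y \<noteq> 0" for x y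
    using F_hom[of x "norm y" "y /\<^sub>R norm y"] that r(2) by (simp add: subset_iff)
  have inK: "(x, y /\<^sub>R norm y) \<in> ?K" if "x \<in> cball x0 r" "y \<noteq> 0" for x y using that by simp
  show ?thesis
  proof (rule that[OF r pos])
    fix x y assume x: "x \<in> cball x0 r"
    show "Floc F c z1 * norm y \<le> Floc F c (x, y)"
    proof (cases "y = 0")
      case True
      then show ?thesis using F_zero[of x] x r(2) by auto
    next
      case False
      then show ?thesis using scale[OF x False] z1(2)[OF inK[OF x False]] by (simp add: mult.commute mult_left_mono)
    qed
    show "Floc F c (x, y) \<le> Floc F c z2 * norm y"
    proof (cases "y = 0")
      case True
      then show ?thesis using F_zero[of x] x r(2) by auto
    next
      case False
      then show ?thesis using scale[OF x False] z2(2)[OF inK[OF x False]] by (simp add: mult.commute mult_left_mono)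
    qed
  qed
qed

lemma cutoff_vanishes:
  assumes x0: "x0 \<in> U"
  obtains W where "open W" "(x0, 0) \<in> W" "W \<subseteq> U \<times> UNIV" "\<And>z. z \<in> W \<Longrightarrow> L z < 1"
proof -
  obtain r a b where r: "r > 0" "cball x0 r \<subseteq> U" "b > 0"
    and b: "\<And>x y. x \<in> cball x0 r \<Longrightarrow> Floc F c (x, y) \<le> b * norm y"
    using F_bounds[OF x0] by metis
  show ?thesis
  proof (rule that[of "ball x0 r \<times> ball 0 (1 / b)"])
    fix z assume z: "z \<in> ball x0 r \<times> ball (0::real^'n) (1 / b)"
    then have "Floc F c z \<le> b * norm (snd z)" using b[of "fst z" "snd z"] by auto
    also have "\<dots> < 1" using z r by (auto simp: field_simps)
    finally have "Floc F c z < 1" .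
    moreover have "Floc F c z \<ge> 0" using F_nonneg[of "fst z" "snd z"] z r(2) by (cases z) (auto simp: subset_iff)
    ultimately show "L z < 1" unfolding Lsq_def by (simp add: abs_square_less_1)
  qed (use r in \<open>auto intro: open_Times\<close>)
qed

text \<open>Each zero vector has a neighbourhood on which the factor \<open>\<rho> (L z)\<close>
  vanishes, so it does not matter how \<open>h\<close> behaves there.\<close>

lemma cutoff_continuous:
  assumes h: "continuous_on Om h" and \<rho>: "continuous_on UNIV \<rho>" and \<rho>0: "\<And>t. t \<le> 1 \<Longrightarrow> \<rho> t = (0::real)"
  shows "continuous_on (U \<times> UNIV) (\<lambda>z. \<rho> (L z) * h z)"
proof -
  have UU: "open (U \<times> (UNIV::(real^'n) set))" by (intro open_Times open_U open_UNIV)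
  have "isCont (\<lambda>z. \<rho> (L z) * h z) z" if zU: "z \<in> U \<times> UNIV" for z
  proof (cases "snd z = 0")
    case True
    then have "(fst z, 0) = z" "fst z \<in> U" using zU by (auto simp: prod_eq_iff)
    then obtain W where W: "open W" "z \<in> W" "\<And>z. z \<in> W \<Longrightarrow> L z < 1" using cutoff_vanishes[of "fst z"] by metis
    have "\<forall>\<^sub>F w in nhds z. \<rho> (L w) * h w = 0"
      unfolding eventually_nhds using W \<rho>0 by (intro exI[of _ W]) (simp add: less_imp_le)
    then show ?thesis using isCont_cong[of "\<lambda>z. \<rho> (L z) * h z" "\<lambda>_. 0" z] by simp
  next
    case False
    then have z: "z \<in> Om" using zU by (cases z) auto
    have "continuous_on Om (\<lambda>z. \<rho> (L z) * h z)"
      by (intro continuous_on_mult h continuous_on_compose2[OF \<rho>] smooth_on_imp_continuous[OF sm_L open_Om]) auto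
    then show ?thesis using z open_Om continuous_on_eq_continuous_at by blast
  qed
  then show ?thesis using continuous_on_eq_continuous_at[OF UU] by blast
qed

lemma F_cont_fibre: assumes x: "x \<in> U" shows "continuous_on UNIV (\<lambda>y. Floc F c (x, y))"
proof -
  obtain r a b where r: "r > 0" "cball x r \<subseteq> U" "b > 0" "\<And>x' y. x' \<in> cball x r \<Longrightarrow> Floc F c (x', y) \<le> b * norm y"
    using F_bounds[OF x] by metis
  have b: "\<bar>Floc F c (x, y)\<bar> \<le> b * norm y" for y using r(4)[of x y] F_nonneg[OF x, of y] r(1) by simp
  have "isCont (\<lambda>y. Floc F c (x, y)) y" for y
  proof (cases "y = 0")
    case True
    have "((\<lambda>y. Floc F c (x, y)) \<longlongrightarrow> 0) (at 0)"
      by (rule Lim_null_comparison[of _ "\<lambda>y. b * norm y"]) (use b in \<open>auto intro!: always_eventually tendsto_eq_intros\<close>)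
    then show ?thesis using True F_zero[OF x] by (simp add: isCont_def)
  next
    case False
    have "continuous_on (UNIV - {0}) (\<lambda>y. Floc F c (x, y))"
      by (rule continuous_on_compose2[OF smooth_on_imp_continuous[OF F_smooth open_Om]])
         (use x in \<open>auto intro!: continuous_intros\<close>)
    moreover have "open (UNIV - {0::real^'n})" by auto
    ultimately show ?thesis using False continuous_on_eq_continuous_at by blast
  qed
  then show ?thesis by (simp add: continuous_at_imp_continuous_on)
qed

lemma L_cont_fibre: assumes x: "x \<in> U" shows "continuous_on UNIV (\<lambda>y. L (x, y))"
  unfolding Lsq_def by (intro continuous_on_power F_cont_fibre x)

definition vol :: "real^'n \<Rightarrow> real" where "vol x = measure lebesgue {y. Floc F c (x, y) < 1}"

lemma ball_open: assumes "x \<in> U" shows "open {y. Floc F c (x, y) < s}"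
  using open_Collect_less[OF F_cont_fibre[OF assms] continuous_on_const] .

lemma ball_bounded: assumes "x \<in> U" shows "bounded {y. Floc F c (x, y) < s}"
proof -
  obtain r a b where r: "r > 0" "a > 0" "\<And>x' y. x' \<in> cball x r \<Longrightarrow> a * norm y \<le> Floc F c (x', y)"
    using F_bounds[OF assms] by metis
  have "norm y \<le> s / a" if "Floc F c (x, y) < s" for y
    using r(3)[of x y] r(1,2) that by (simp add: pos_le_divide_eq mult.commute)
  then show ?thesis unfolding bounded_iff by blast
qed

lemma ball_lmeasurable: assumes "x \<in> U" shows "{y. Floc F c (x, y) < s} \<in> lmeasurable"
  using lmeasurable_open[OF ball_bounded[OF assms] ball_open[OF assms]] .

lemma vol_pos: assumes "x \<in> U" shows "vol x > 0"
proof -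
  have "0 \<in> {y. Floc F c (x, y) < 1}" using F_zero[OF assms] by simp
  then have "\<not> negligible {y. Floc F c (x, y) < 1}" using open_not_negligible[OF ball_open[OF assms]] by blast
  then show ?thesis unfolding vol_def
    using negligible_iff_measure[of "{y. Floc F c (x, y) < 1}"] ball_lmeasurable[OF assms, of 1] by (simp add: zero_less_measure_iff)
qed

lemma emeasure_ball:
  assumes x: "x \<in> U"
  shows "emeasure lborel {y. Floc F c (x, y) < s} = ennreal (if s \<le> 0 then 0 else s ^ CARD('n) * vol x)"
proof (cases "s \<le> 0")
  case True
  then have "{y. Floc F c (x, y) < s} = {}" using F_nonneg[OF x] by (auto simp: not_less intro: order_trans)
  then show ?thesis using True by simp
next
  case False
  then have s: "s > 0" by simp
  have eq: "{y. Floc F c (x, y) < s} = (\<lambda>y. s *\<^sub>R y + 0) ` {y. Floc F c (x, y) < 1}"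
  proof (intro set_eqI iffI)
    fix y assume y: "y \<in> {y. Floc F c (x, y) < s}"
    have "Floc F c (x, inverse s *\<^sub>R y) = inverse s * Floc F c (x, y)" using F_hom[OF x] s by simp
    moreover have "inverse s * Floc F c (x, y) < 1" using y s by (simp add: field_simps)
    ultimately have "Floc F c (x, inverse s *\<^sub>R y) < 1" by simp
    moreover have "y = s *\<^sub>R (inverse s *\<^sub>R y) + 0" using s by simp
    ultimately show "y \<in> (\<lambda>y. s *\<^sub>R y + 0) ` {y. Floc F c (x, y) < 1}" by blast
  next
    fix y assume "y \<in> (\<lambda>y. s *\<^sub>R y + 0) ` {y. Floc F c (x, y) < 1}"
    then show "y \<in> {y. Floc F c (x, y) < s}" using F_hom[OF x s] s by auto
  qed
  have "{y. Floc F c (x, y) < s} \<in> sets lborel" using borel_open[OF ball_open[OF x]] by simp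
  then have "emeasure lborel {y. Floc F c (x, y) < s} = emeasure lebesgue {y. Floc F c (x, y) < s}" by simp
  also have "\<dots> = ennreal (\<bar>s\<bar> ^ CARD('n)) * emeasure lebesgue {y. Floc F c (x, y) < 1}"
    unfolding eq by (subst emeasure_lebesgue_affine) simp
  also have "emeasure lebesgue {y. Floc F c (x, y) < 1} = ennreal (vol x)"
    unfolding vol_def by (rule emeasure_eq_measure2[OF ball_lmeasurable[OF x]])
  finally show ?thesis using s by (simp add: ennreal_mult')
qed

text \<open>By homogeneity the distribution of \<open>F\<close> on a fibre depends on the base point
  only through the factor \<open>vol x\<close>. Integrals of a function of \<open>F\<close> over two
  fibres therefore have the ratio of the two volumes.\<close>

lemma nn_integral_bump:
  assumes x: "x \<in> U" and x0: "x0 \<in> U"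
  shows "ennreal (vol x0) * (\<integral>\<^sup>+y. ennreal (bump (L (x, y))) \<partial>lborel) = ennreal (vol x) * (\<integral>\<^sup>+y. ennreal (bump (L (x0, y))) \<partial>lborel)"
proof -
  \<comment> \<open>The sign turns the sublevel sets of \<open>F\<close> into the rays
    \<open>{s<..}\<close> on which \<open>measure_eqI_lessThan\<close> compares measures; it
    disappears again in \<open>bump (s^2)\<close>.\<close>
  let ?M = "\<lambda>x. distr lborel borel (\<lambda>y. - Floc F c (x, y))"
  have m: "(\<lambda>y. - Floc F c (x, y)) \<in> borel_measurable borel" if "x \<in> U" for x
    by (intro borel_measurable_continuous_onI continuous_on_minus F_cont_fibre that)
  have em: "emeasure (?M x) {s<..} = ennreal (if - s \<le> 0 then 0 else (-s) ^ CARD('n) * vol x)" if "x \<in> U" for x s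
  proof -
    have "emeasure (?M x) {s<..} = emeasure lborel {y. Floc F c (x, y) < - s}"
      using m[OF that] by (subst emeasure_distr) (auto intro!: arg_cong[where f="emeasure lborel"])
    then show ?thesis using emeasure_ball[OF that] by simp
  qed
  have "scale_measure (ennreal (vol x0)) (?M x) = scale_measure (ennreal (vol x)) (?M x0)"
  proof (rule measure_eqI_lessThan)
    fix s
    show "emeasure (scale_measure (ennreal (vol x0)) (?M x)) {s<..} < \<infinity>"
      using em[OF x] by (simp add: ennreal_mult_less_top)
    show "emeasure (scale_measure (ennreal (vol x0)) (?M x)) {s<..} = emeasure (scale_measure (ennreal (vol x)) (?M x0)) {s<..}"
      using em[OF x] em[OF x0] vol_pos[OF x] vol_pos[OF x0] by (simp add: mult_ac flip: ennreal_mult')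
  qed auto
  then have "(\<integral>\<^sup>+s. ennreal (bump (s\<^sup>2)) \<partial>scale_measure (ennreal (vol x0)) (?M x)) = (\<integral>\<^sup>+s. ennreal (bump (s\<^sup>2)) \<partial>scale_measure (ennreal (vol x)) (?M x0))" by simp
  moreover have bm: "(\<lambda>s. ennreal (bump (s\<^sup>2))) \<in> borel_measurable borel"
    by (intro measurable_compose[OF _ measurable_ennreal] borel_measurable_continuous_onI continuous_on_compose2[OF bump_cont(1)[of UNIV]] continuous_intros) auto
  ultimately show ?thesis
    using m[OF x] m[OF x0] by (simp add: nn_integral_scale_measure nn_integral_distr Lsq_def)
qed

text \<open>The indicator function of the unit ball cannot be differentiated under the integral
  sign, but the cutoff \<open>bump (L (x, y))\<close> can. By \<open>nn_integral_bump\<close> its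
  integral \<open>H\<close> is a constant multiple of \<open>vol\<close> near
  \<open>x0\<close>.\<close>

lemma vol_differentiable: assumes x0: "x0 \<in> U" shows "vol differentiable (at x0)"
proof -
  obtain r a b where r: "r > 0" "cball x0 r \<subseteq> U" "a > 0"
    and a: "\<And>x y. x \<in> cball x0 r \<Longrightarrow> a * norm y \<le> Floc F c (x, y)"
    using F_bounds[OF x0] by metis
  define B where "B = ball x0 r"
  have B: "open B" "convex B" "x0 \<in> B" "B \<subseteq> U" using r by (auto simp: B_def)
  \<comment> \<open>Since \<open>a * norm y\<close> bounds \<open>F\<close> from below, vectors
    outside the radius \<open>2 / a\<close> have \<open>L \<ge> 4\<close>, where \<open>bump\<close>
    is 0. One box thus serves all base points of \<open>B\<close>.\<close>
  obtain p q where box: "cball 0 (2 / a) \<subseteq> cbox p (q::real^'n)"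
    using bounded_subset_cbox_symmetric[of "cball 0 (2/a)"] by (metis bounded_cball)
  have outside: "bump (L (x, y)) = 0" if "x \<in> B" "y \<notin> cbox p q" for x y
  proof -
    have "y \<notin> cball 0 (2 / a)" using that box by blast
    then have "norm y > 2 / a" by simp
    then have "Floc F c (x, y) \<ge> 2" using a[of x y] that r(3) by (auto simp: B_def field_simps)
    then have "L (x, y) \<ge> 2\<^sup>2" unfolding Lsq_def by (intro power_mono) auto
    then show ?thesis using bump_zero by simp
  qed
  define w where "w k z = bump' (L z) * DX k L z" for k z
  define fx where "fx x y = (\<Sum>k\<in>UNIV. w k (x, y) *\<^sub>R Blinfun (\<lambda>v::real^'n. v $ k))" for x y
  have w_cont: "continuous_on (U \<times> UNIV) (w k)" for k unfolding w_def
    by (rule cutoff_continuous) (auto intro: bump_cont smooth_on_imp_continuous sm_DX sm_L open_Om simp: bump_zero)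
  have fx_apply: "blinfun_apply (fx x y) v = (\<Sum>k\<in>UNIV. w k (x, y) * v $ k)" for x y v
    unfolding fx_def blinfun.sum_left
    by (simp add: blinfun.scaleR_left bounded_linear_Blinfun_apply bounded_linear_vec_nth)
  define H where "H x = integral (cbox p q) (\<lambda>y. bump (L (x, y)))" for x
  have bump_int: "(\<lambda>y. bump (L (x, y))) integrable_on cbox p q" if "x \<in> U" for x
    by (intro integrable_continuous continuous_on_compose2[OF bump_cont(1)[of UNIV]] continuous_on_subset[OF L_cont_fibre[OF that]]) auto
  have "(H has_derivative integral (cbox p q) (fx x0)) (at x0 within B)"
    unfolding H_def
  proof (rule leibniz_rule)
    fix x y assume x: "x \<in> B"
    show "((\<lambda>x. bump (L (x, y))) has_derivative blinfun_apply (fx x y)) (at x within B)"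
    proof (rule has_derivative_at_withinI, cases "y = 0")
      case True
      have "((\<lambda>x. 0) has_derivative blinfun_apply (fx x y)) (at x)"
      proof -
        have "L (x, 0) = 0" using F_zero x B by (auto simp: Lsq_def)
        then have "blinfun_apply (fx x y) = (\<lambda>v. 0)" using True by (auto simp: fx_apply w_def bump_zero)
        then show ?thesis by simp
      qed
      then show "((\<lambda>x. bump (L (x, y))) has_derivative blinfun_apply (fx x y)) (at x)"
        by (rule has_derivative_transform_within_open[OF _ B(1) x]) (use True F_zero B in \<open>auto simp: Lsq_def bump_zero\<close>)
    next
      case False
      then have z: "(x, y) \<in> Om" using x B by auto
      have D: "((\<lambda>x. (x, y)) has_derivative (\<lambda>v. (v, 0))) (at x)"
        by (auto intro!: derivative_eq_intros)
      have "((\<lambda>x. L (x, y)) has_derivative (\<lambda>v. pd (v, 0) L (x, y))) (at x)"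
        using has_derivative_compose[OF D pd_has_derivative[OF sm_diff[OF sm_L z]]] .
      from has_derivative_compose[OF this bump_deriv[unfolded has_field_derivative_def]]
      have "((\<lambda>x. bump (L (x, y))) has_derivative (\<lambda>v. bump' (L (x, y)) * pd (v, 0) L (x, y))) (at x)" .
      moreover have "(\<lambda>v. bump' (L (x, y)) * pd (v, 0) L (x, y)) = blinfun_apply (fx x y)"
        by (simp add: fun_eq_iff fx_apply pd_pair[OF sm_diff[OF sm_L z]] w_def sum_distrib_left mult_ac)
      ultimately show "((\<lambda>x. bump (L (x, y))) has_derivative blinfun_apply (fx x y)) (at x)" by simp
    qed
  next
    show "continuous_on (B \<times> cbox p q) (\<lambda>(x, t). fx x t)"
      unfolding fx_def case_prod_unfold
      using B by (intro continuous_on_sum continuous_on_scaleR continuous_on_const)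
        (auto intro: continuous_on_subset[OF w_cont])
  qed (use B bump_int in auto)
  then have H_diff: "H differentiable (at x0)"
    using B at_within_open[of x0 B] unfolding differentiable_def by metis
  have nnH: "(\<integral>\<^sup>+y. ennreal (bump (L (x, y))) \<partial>lborel) = ennreal (H x)" if x: "x \<in> B" for x
  proof (rule nn_integral_has_integral_lborel)
    show "(\<lambda>y. bump (L (x, y))) \<in> borel_measurable borel"
      by (intro borel_measurable_continuous_onI continuous_on_compose2[OF bump_cont(1)[of UNIV]] L_cont_fibre) (use x B in auto)
    have "((\<lambda>y. bump (L (x, y))) has_integral H x) (cbox p q)"
      unfolding H_def using bump_int x B by blast
    then show "((\<lambda>y. bump (L (x, y))) has_integral H x) UNIV"
      by (rule has_integral_on_superset) (use outside[OF x] in auto)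
  qed (rule bump_nonneg)
  have H_nonneg: "H x \<ge> 0" if "x \<in> B" for x
    unfolding H_def by (rule integral_nonneg) (use bump_int B that in \<open>auto simp: bump_nonneg\<close>)
  have vol_H: "vol x0 * H x = vol x * H x0" if x: "x \<in> B" for x
  proof -
    have xU: "x \<in> U" using x B by blast
    have "ennreal (vol x0 * H x) = ennreal (vol x * H x0)"
      using nn_integral_bump[OF xU x0] nnH[OF x] nnH[OF B(3)] vol_pos[OF xU] vol_pos[OF x0] by (simp add: ennreal_mult')
    then show ?thesis using H_nonneg[OF x] H_nonneg[OF B(3)] vol_pos[OF xU] vol_pos[OF x0] by simp
  qed
  have "H x0 \<noteq> 0"
  proof
    assume "H x0 = 0"
    then have "((\<lambda>y. bump (L (x0, y))) has_integral 0) (cbox p q)" unfolding H_def using bump_int[OF x0] by (metis integrable_integral)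
    moreover obtain y :: "real^'n" where y: "y \<noteq> 0" using vector_choose_size[of 1] by (metis norm_zero zero_neq_one zero_le_one)
    \<comment> \<open>This scaling gives \<open>F = 3/2\<close>, hence \<open>L = 9/4\<close>,
      inside the interval on which \<open>bump\<close> is positive.\<close>
    define t where "t = 3/2 / Floc F c (x0, y)"
    have Fp: "Floc F c (x0, y) > 0" using F_pos[of "(x0,y)"] x0 y by auto
    have "Floc F c (x0, t *\<^sub>R y) = 3/2" using F_hom[OF x0, of t y] Fp by (simp add: t_def)
    then have Lt: "L (x0, t *\<^sub>R y) = 9/4" unfolding Lsq_def by (simp only:) (simp add: power2_eq_square)
    then have bp: "bump (L (x0, t *\<^sub>R y)) > 0" using bump_pos by simp
    then have ty: "t *\<^sub>R y \<in> cbox p q" using outside[OF B(3)] by force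
    have "box p q \<noteq> {}"
    proof -
      have "ball 0 (2/a) \<subseteq> interior (cbox p q)" using box by (meson ball_subset_cball interior_maximal open_ball order_trans)
      then show ?thesis using r(3) by (auto simp: interior_cbox)
    qed
    ultimately have "bump (L (x0, t *\<^sub>R y)) = 0"
      using ty by (intro has_integral_0_cbox_imp_0[where f="\<lambda>y. bump (L (x0, y))" and a=p and b=q])
         (auto intro!: continuous_on_compose2[OF bump_cont(1)[of UNIV]] continuous_on_subset[OF L_cont_fibre[OF x0]] simp: bump_nonneg)
    then show False using bp by simp
  qed
  have "(\<lambda>x. vol x0 / H x0 * H x) differentiable (at x0)" using H_diff by (intro differentiable_mult) auto
  then show ?thesis
    by (rule differentiable_cong_open[OF B(1,3), rotated]) (use vol_H \<open>H x0 \<noteq> 0\<close> in \<open>auto simp: field_simps\<close>)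
qed

lemma ln_sigma_differentiable:
  assumes x0: "x0 \<in> U" shows "(\<lambda>x. ln (sigmaBH F c x)) differentiable (at x0)"
proof -
  have b: "measure lebesgue (ball (0::real^'n) 1) > 0" by (simp add: content_ball_pos)
  have "(\<lambda>x. ln (measure lebesgue (ball (0::real^'n) 1)) - ln (vol x)) differentiable (at x0)"
    using has_derivative_diff[OF has_derivative_const has_derivative_ln[OF vol_pos[OF x0] pd_has_derivative[OF vol_differentiable[OF x0]]]]
    unfolding differentiable_def by blast
  then show ?thesis
  proof (rule differentiable_cong_open[OF open_U x0, rotated])
    fix x assume "x \<in> U"
    then show "ln (measure lebesgue (ball (0::real^'n) 1)) - ln (vol x) = ln (sigmaBH F c x)"
      using vol_pos[of x] b by (simp add: sigmaBH_def ln_div flip: vol_def)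
  qed
qed

end

section \<open>Deicke's theorem\<close>

text \<open>Differentiate the translation-invariant integral \<open>t \<mapsto> \<integral> u (y + t e) dy\<close> at \<open>0\<close>.\<close>

lemma integral_directional_derivative_zero:
  fixes u u' :: "'a::euclidean_space \<Rightarrow> real"
  assumes D: "\<And>y. (u has_derivative D y) (at y)" and u': "\<And>y. D y e = u' y"
    and cont: "continuous_on UNIV u'" and supp: "\<And>y. norm y > R \<Longrightarrow> u y = 0"
    and box: "cball 0 (R + norm e) \<subseteq> cbox p q"
  shows "(u' has_integral 0) (cbox p q)"
proof -
  have u_cont: "continuous_on UNIV u" by (intro continuous_at_imp_continuous_on ballI) (rule has_derivative_continuous[OF D])
  \<comment> \<open>The margin \<open>norm e\<close> of the box absorbs all translations with
    \<open>\<bar>t\<bar> < 1\<close>.\<close>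
  have supp': "u (y + t *\<^sub>R e) = 0" if "\<bar>t\<bar> < 1" "y \<notin> cbox p q" for t y
  proof (rule supp)
    have "y \<notin> cball 0 (R + norm e)" using that box by blast
    then have "norm y > R + norm e" by simp
    moreover have "norm y \<le> norm (y + t *\<^sub>R e) + norm (t *\<^sub>R e)" using norm_triangle_sub[of y "y + t *\<^sub>R e"] by simp
    moreover have "norm (t *\<^sub>R e) \<le> norm e" using that by (simp add: mult_left_le_one_le)
    ultimately show "norm (y + t *\<^sub>R e) > R" by linarith
  qed
  have u0: "u y = 0" if "y \<notin> cbox p q" for y using supp'[of 0 y] that by simp
  have int: "(\<lambda>y. u (y + t *\<^sub>R e)) integrable_on cbox p q" for t
    by (intro integrable_continuous continuous_on_compose2[OF u_cont] continuous_intros) auto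
  have const: "integral (cbox p q) (\<lambda>y. u (y + t *\<^sub>R e)) = integral (cbox p q) u" if t: "\<bar>t\<bar> < 1" for t
  proof -
    have "(u has_integral integral (cbox p q) u) (cbox p q)" using int[of 0] by (simp add: integrable_integral)
    from has_integral_affinity[OF this, of 1 "t *\<^sub>R e"]
    have "((\<lambda>y. u (y + t *\<^sub>R e)) has_integral integral (cbox p q) u) ((\<lambda>y. y - t *\<^sub>R e) ` cbox p q)" by simp
    then have "((\<lambda>y. u (y + t *\<^sub>R e)) has_integral integral (cbox p q) u) UNIV"
    proof (rule has_integral_on_superset)
      fix y assume "y \<notin> (\<lambda>y. y - t *\<^sub>R e) ` cbox p q"
      then have "y + t *\<^sub>R e \<notin> cbox p q" by (metis add_diff_cancel image_eqI)
      then show "u (y + t *\<^sub>R e) = 0" by (rule u0)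
    qed simp
    moreover have "((\<lambda>y. u (y + t *\<^sub>R e)) has_integral integral (cbox p q) (\<lambda>y. u (y + t *\<^sub>R e))) UNIV"
      by (rule has_integral_on_superset[OF integrable_integral[OF int]]) (use supp'[OF t] in auto)
    ultimately show ?thesis using has_integral_unique by blast
  qed
  let ?B = "{-1<..<1::real}"
  have "((\<lambda>t. integral (cbox p q) (\<lambda>y. u (y + t *\<^sub>R e))) has_field_derivative integral (cbox p q) (\<lambda>y. u' (y + 0 *\<^sub>R e))) (at 0 within ?B)"
  proof (rule leibniz_rule_field_derivative)
    fix t y
    have "((\<lambda>t. y + t *\<^sub>R e) has_derivative (\<lambda>s. s *\<^sub>R e)) (at t)" by (auto intro!: derivative_eq_intros)
    from has_derivative_compose[OF this D]
    have "((\<lambda>t. u (y + t *\<^sub>R e)) has_derivative (\<lambda>s. D (y + t *\<^sub>R e) (s *\<^sub>R e))) (at t)" .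
    moreover have "(\<lambda>s. D (y + t *\<^sub>R e) (s *\<^sub>R e)) = (*) (u' (y + t *\<^sub>R e))"
      using linear_cmul[OF has_derivative_linear[OF D]] u' by (auto simp: fun_eq_iff)
    ultimately show "((\<lambda>t. u (y + t *\<^sub>R e)) has_field_derivative u' (y + t *\<^sub>R e)) (at t within ?B)"
      unfolding has_field_derivative_def by (metis has_derivative_at_withinI)
  next
    show "continuous_on (?B \<times> cbox p q) (\<lambda>(t, y). u' (y + t *\<^sub>R e))"
      unfolding case_prod_unfold by (rule continuous_on_compose2[OF cont, of _ "\<lambda>p. snd p + fst p *\<^sub>R e"]) (auto intro!: continuous_intros)
  qed (simp_all add: int)
  then have "((\<lambda>t. integral (cbox p q) (\<lambda>y. u (y + t *\<^sub>R e))) has_field_derivative integral (cbox p q) u') (at 0)"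
    using at_within_open[of 0 ?B] by simp
  moreover have "((\<lambda>t. integral (cbox p q) (\<lambda>y. u (y + t *\<^sub>R e))) has_field_derivative 0) (at 0)"
  proof (rule has_field_derivative_transform_within_open[OF DERIV_const, where S="?B"])
    fix t assume "t \<in> ?B"
    then have "\<bar>t\<bar> < 1" by auto
    then show "integral (cbox p q) u = integral (cbox p q) (\<lambda>y. u (y + t *\<^sub>R e))" by (rule const[symmetric])
  qed auto
  ultimately have "integral (cbox p q) u' = 0" using DERIV_unique by blast
  moreover have "u' integrable_on cbox p q" by (intro integrable_continuous continuous_on_subset[OF cont]) auto
  ultimately show ?thesis by (metis integrable_integral)
qed

context finsler_chart
begin

lemma fibre_has_derivative:
  assumes "sm h" "x \<in> U" "y \<noteq> 0"
  shows "((\<lambda>y. h (x, y)) has_derivative (\<lambda>v. pd (0, v) h (x, y))) (at y)"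
proof -
  have "((\<lambda>y. (x, y)) has_derivative (\<lambda>v. (0, v))) (at y)" by (auto intro!: derivative_eq_intros)
  from has_derivative_compose[OF this pd_has_derivative[OF sm_diff[OF assms(1)]]] assms(2,3)
  show ?thesis by auto
qed

lemma fibre_zero_DY:
  assumes h: "sm h" and x: "x \<in> U" and 0: "\<And>y. y \<noteq> 0 \<Longrightarrow> h (x, y) = 0" and y: "y \<noteq> 0"
  shows "DY k h (x, y) = 0"
proof -
  have "((\<lambda>y. 0) has_derivative (\<lambda>v. pd (0, v) h (x, y))) (at y)"
    by (rule has_derivative_transform_within_open[OF fibre_has_derivative[OF h x y], of "UNIV - {0}"]) (use 0 y in auto)
  then have "(\<lambda>v. pd (0, v) h (x, y)) = (\<lambda>_. 0)" using has_derivative_unique has_derivative_const by blast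
  then show ?thesis unfolding DY_def by metis
qed

lemma g_total_sym: assumes z: "z \<in> Om" shows "DY k (g i j) z = DY i (g k j) z"
proof -
  have *: "DY k (g i j) z = 1/2 * DY k (DY i (DY j L)) z" for i j k
    unfolding gten_def[abs_def] DY_def[of k] by (rule pd_cmult) (intro sm_diff[OF _ z] sm_DY sm_L)
  show ?thesis unfolding * using DYY[OF sm_DY[OF sm_L] z, of k i j] by simp
qed

lemma g_total_sym': assumes z: "z \<in> Om" shows "DY k (g i j) z = DY k (g j i) z"
  by (rule DY_cong) (use g_sym z in auto)

lemma g_total_sym3: assumes z: "z \<in> Om" shows "DY i (g k l) z = DY l (g i k) z"
  using g_total_sym[OF z, of l i k] g_total_sym'[OF z, of i l k] by simp

lemma DY_gi: assumes z: "z \<in> Om"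
  shows "DY m (gi i j) z = - (\<Sum>k\<in>UNIV. \<Sum>l\<in>UNIV. gi i k z * DY m (g k l) z * gi l j z)"
  using pd_matrix_inv[OF open_Om _ det_nz z, where v="(0, axis m 1)" and i=i and j=j] sm_g
  unfolding DY_def ginv_gm by simp

lemma L1_g: assumes z: "z \<in> Om" shows "DY i L z = 2 * (\<Sum>m\<in>UNIV. g i m z * snd z $ m)"
proof -
  have "DY i L z = (\<Sum>m\<in>UNIV. snd z $ m * DY m (DY i L) z)" using euler[OF sm_DY[OF sm_L] hom_L1 z] by simp
  then show ?thesis unfolding gten_def using DYY[OF sm_L z] by (simp add: sum_distrib_left mult_ac)
qed

lemma L1_gi: assumes z: "z \<in> Om" shows "(\<Sum>i\<in>UNIV. DY i L z * gi i j z) = 2 * snd z $ j"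
proof -
  have "(\<Sum>i\<in>UNIV. DY i L z * gi i j z) = (\<Sum>i\<in>UNIV. \<Sum>m\<in>UNIV. 2 * snd z $ m * (g m i z * gi i j z))"
    unfolding L1_g[OF z] by (simp add: sum_distrib_left sum_distrib_right g_sym[OF z] mult_ac)
  also have "\<dots> = (\<Sum>m\<in>UNIV. 2 * snd z $ m * (\<Sum>i\<in>UNIV. g m i z * gi i j z))"
    by (subst sum.swap) (simp add: sum_distrib_left)
  finally show ?thesis by (simp add: g_gi[OF z])
qed

definition grad_g :: "'n \<Rightarrow> 'n \<Rightarrow> (real^'n) \<times> (real^'n) \<Rightarrow> real" where
  "grad_g k i z = (\<Sum>j\<in>UNIV. gi i j z * DY j (g k k) z)"

definition lap_g :: "'n \<Rightarrow> (real^'n) \<times> (real^'n) \<Rightarrow> real" where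
  "lap_g k z = (\<Sum>i\<in>UNIV. DY i (grad_g k i) z)"

lemma sm_grad_g: "sm (grad_g k i)"
  unfolding grad_g_def[abs_def] by (intro smooth_on_sum smooth_on_mult open_Om sm_gi sm_DY sm_g)

lemma sm_lap_g: "sm (lap_g k)"
  unfolding lap_g_def[abs_def] by (intro smooth_on_sum open_Om sm_DY sm_grad_g)

definition dg_mat :: "'n \<Rightarrow> (real^'n) \<times> (real^'n) \<Rightarrow> real^'n^'n" where
  "dg_mat k z = (\<chi> i j. DY k (g i j) z)"

text \<open>Total symmetry of the vertical derivatives of \<open>g\<close> plays three parts here:
  it turns the divergence of \<open>gi\<close> into the mean torsion, which is 0; it rewrites the
  Hessian of \<open>g k k\<close> as the second \<open>k\<close>-derivative of \<open>g i j\<close>;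
  and the \<open>k\<close>-derivative of the identity "mean torsion = 0" trades that second
  derivative for a square of first ones.\<close>

lemma lap_g_trace:
  assumes x: "x \<in> U" and I0: "\<And>y k. y \<noteq> 0 \<Longrightarrow> DY k tau0 (x, y) = 0" and y: "y \<noteq> 0"
  shows "lap_g k (x, y) = trace (ginv F c (x, y) ** dg_mat k (x, y) ** (ginv F c (x, y) ** dg_mat k (x, y)))"
proof -
  let ?z = "(x, y)"
  have z: "?z \<in> Om" using x y by auto
  note d = sm_diff[OF _ z]
  have lev: "DY i (grad_g k i) ?z = (\<Sum>j\<in>UNIV. DY i (gi i j) ?z * DY j (g k k) ?z + gi i j ?z * DY i (DY j (g k k)) ?z)" for i
    unfolding grad_g_def[abs_def] DY_def[of i]
    by (subst pd_sum; (intro d smooth_on_mult open_Om sm_gi sm_DY sm_g)?)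
       (simp add: pd_mult d sm_gi sm_DY sm_g)
  have divgi: "(\<Sum>i\<in>UNIV. DY i (gi i j) ?z) = 0" for j
  proof -
    have "DY i (gi i j) ?z = - (\<Sum>k\<in>UNIV. \<Sum>l\<in>UNIV. gi i k ?z * DY l (g i k) ?z * gi l j ?z)" for i
      unfolding DY_gi[OF z] by (intro arg_cong[where f=uminus] sum.cong refl) (simp only: g_total_sym3[OF z, of i])
    then have "(\<Sum>i\<in>UNIV. DY i (gi i j) ?z) = - (\<Sum>i\<in>UNIV. \<Sum>k\<in>UNIV. \<Sum>l\<in>UNIV. gi i k ?z * DY l (g i k) ?z * gi l j ?z)"
      by (simp only: sum_negf)
    also have "(\<Sum>i\<in>UNIV. \<Sum>k\<in>UNIV. \<Sum>l\<in>UNIV. gi i k ?z * DY l (g i k) ?z * gi l j ?z) = (\<Sum>i\<in>UNIV. \<Sum>l\<in>UNIV. \<Sum>k\<in>UNIV. gi i k ?z * DY l (g i k) ?z * gi l j ?z)"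
      by (intro sum.cong refl sum.swap)
    also have "\<dots> = (\<Sum>l\<in>UNIV. \<Sum>i\<in>UNIV. \<Sum>k\<in>UNIV. gi i k ?z * DY l (g i k) ?z * gi l j ?z)" by (rule sum.swap)
    also have "\<dots> = (\<Sum>l\<in>UNIV. (2 * DY l tau0 ?z) * gi l j ?z)"
      unfolding DY_tau0[OF z] by (simp add: sum_distrib_right)
    finally show ?thesis using I0[OF y] by simp
  qed
  have sym4: "DY i (DY j (g k k)) ?z = DY k (DY k (g i j)) ?z" for i j
  proof -
    have "DY i (DY j (g k k)) ?z = DY i (DY k (g j k)) ?z" by (rule DY_cong) (use g_total_sym z in auto)
    also have "\<dots> = DY k (DY i (g j k)) ?z" by (rule DYY[OF sm_g z])
    also have "\<dots> = DY k (DY k (g i j)) ?z"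
      by (rule DY_cong[OF g_total_sym3 z])
    finally show ?thesis .
  qed
  have "lap_g k ?z = (\<Sum>i\<in>UNIV. \<Sum>j\<in>UNIV. DY i (gi i j) ?z * DY j (g k k) ?z) + (\<Sum>i\<in>UNIV. \<Sum>j\<in>UNIV. gi i j ?z * DY k (DY k (g i j)) ?z)"
    unfolding lap_g_def lev sym4 by (simp add: sum.distrib)
  also have "(\<Sum>i\<in>UNIV. \<Sum>j\<in>UNIV. DY i (gi i j) ?z * DY j (g k k) ?z) = (\<Sum>j\<in>UNIV. (\<Sum>i\<in>UNIV. DY i (gi i j) ?z) * DY j (g k k) ?z)"
    by (subst sum.swap) (simp add: sum_distrib_right)
  finally have Q1: "lap_g k ?z = (\<Sum>i\<in>UNIV. \<Sum>j\<in>UNIV. gi i j ?z * DY k (DY k (g i j)) ?z)" by (simp add: divgi)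
  define h where "h = (\<lambda>z. \<Sum>i\<in>UNIV. \<Sum>j\<in>UNIV. gi i j z * DY k (g i j) z)"
  have smh: "sm h" unfolding h_def by (intro smooth_on_sum smooth_on_mult open_Om sm_gi sm_DY sm_g)
  have "h (x, y') = 0" if "y' \<noteq> 0" for y'
    using DY_tau0[of "(x,y')" k] I0[OF that, of k] that x by (simp add: h_def)
  then have "DY k h ?z = 0" by (rule fibre_zero_DY[OF smh x _ y])
  moreover have "DY k h ?z = (\<Sum>i\<in>UNIV. \<Sum>j\<in>UNIV. DY k (gi i j) ?z * DY k (g i j) ?z + gi i j ?z * DY k (DY k (g i j)) ?z)"
    unfolding h_def DY_def[of k]
    by (subst pd_sum; (intro d smooth_on_sum smooth_on_mult open_Om sm_gi sm_DY[unfolded DY_def] sm_g)?)+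
       (simp add: pd_mult d sm_gi sm_DY[unfolded DY_def] sm_g)
  ultimately have "lap_g k ?z = - (\<Sum>i\<in>UNIV. \<Sum>j\<in>UNIV. DY k (gi i j) ?z * DY k (g i j) ?z)"
    unfolding Q1 by (simp add: sum.distrib)
  also have "\<dots> = (\<Sum>i\<in>UNIV. \<Sum>j\<in>UNIV. \<Sum>a\<in>UNIV. \<Sum>b\<in>UNIV. gi i a ?z * DY k (g a b) ?z * gi b j ?z * DY k (g j i) ?z)"
    unfolding DY_gi[OF z] using g_total_sym'[OF z, of k]
    by (simp add: sum_negf sum_distrib_right)
  also have "\<dots> = trace (ginv F c ?z ** dg_mat k ?z ** (ginv F c ?z ** dg_mat k ?z))"
  proof -
    have "(\<Sum>j\<in>UNIV. \<Sum>a\<in>UNIV. \<Sum>b\<in>UNIV. gi i a ?z * DY k (g a b) ?z * gi b j ?z * DY k (g j i) ?z)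
      = (\<Sum>b\<in>UNIV. (\<Sum>a\<in>UNIV. gi i a ?z * DY k (g a b) ?z) * (\<Sum>j\<in>UNIV. gi b j ?z * DY k (g j i) ?z))" for i
    proof -
      have "(\<Sum>j\<in>UNIV. \<Sum>a\<in>UNIV. \<Sum>b\<in>UNIV. gi i a ?z * DY k (g a b) ?z * gi b j ?z * DY k (g j i) ?z)
        = (\<Sum>j\<in>UNIV. \<Sum>b\<in>UNIV. \<Sum>a\<in>UNIV. gi i a ?z * DY k (g a b) ?z * gi b j ?z * DY k (g j i) ?z)"
        by (intro sum.cong refl sum.swap)
      also have "\<dots> = (\<Sum>b\<in>UNIV. \<Sum>j\<in>UNIV. \<Sum>a\<in>UNIV. gi i a ?z * DY k (g a b) ?z * gi b j ?z * DY k (g j i) ?z)" by (rule sum.swap)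
      finally show ?thesis by (simp add: sum_distrib_left sum_distrib_right mult.assoc)
    qed
    then show ?thesis by (simp add: trace_def matrix_matrix_mult_def dg_mat_def)
  qed
  finally show ?thesis .
qed

lemma ginv_posdef: assumes z: "z \<in> Om"
  shows "transpose (ginv F c z) = ginv F c z" "v \<noteq> 0 \<Longrightarrow> v \<bullet> (ginv F c z *v v) > 0"
proof -
  show "transpose (ginv F c z) = ginv F c z" by (simp add: transpose_def vec_eq_iff gi_sym[OF z])
  assume v: "v \<noteq> 0"
  have "v \<bullet> (ginv F c z *v v) = ip (\<lambda>i. v $ i) (\<lambda>i. v $ i) z"
    by (simp add: inner_vec_def matrix_vector_mult_def ip_def sum_distrib_left mult_ac)
  moreover have "ip (\<lambda>i. v $ i) (\<lambda>i. v $ i) z \<noteq> 0"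
  proof
    assume "ip (\<lambda>i. v $ i) (\<lambda>i. v $ i) z = 0"
    then have "v $ i = 0" for i by (rule ip_eq_0[OF z])
    then show False using v by (simp add: vec_eq_iff)
  qed
  ultimately show "v \<bullet> (ginv F c z *v v) > 0" using ip_nonneg[OF z, of "\<lambda>i. v $ i"] by simp
qed

lemma cutoff_fibre_derivative:
  assumes h: "sm h" and x: "x \<in> U"
  shows "((\<lambda>y. bump (L (x, y)) * h (x, y)) has_derivative
    (\<lambda>v. bump' (L (x, y)) * pd (0, v) L (x, y) * h (x, y) + bump (L (x, y)) * pd (0, v) h (x, y))) (at y)"
proof (cases "y = 0")
  case True
  obtain W where W: "open W" "(x, 0) \<in> W" "\<And>z. z \<in> W \<Longrightarrow> L z < 1" using cutoff_vanishes[OF x] by metis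
  have L0: "L (x, 0) = 0" using F_zero[OF x] by (simp add: Lsq_def)
  have o: "open ((\<lambda>y. (x, y)) -` W)" by (intro continuous_open_vimage W) (auto intro!: continuous_intros)
  have "((\<lambda>y. 0) has_derivative (\<lambda>v. 0)) (at y)" by simp
  then have "((\<lambda>y. bump (L (x, y)) * h (x, y)) has_derivative (\<lambda>v. 0)) (at y)"
  proof (rule has_derivative_transform_within_open[OF _ o])
    fix y' assume "y' \<in> (\<lambda>y. (x, y)) -` W"
    then have "L (x, y') < 1" using W by simp
    then show "0 = bump (L (x, y')) * h (x, y')" using bump_zero[of "L (x, y')"] by simp
  qed (use True W in auto)
  then show ?thesis using True L0 by (simp add: bump_zero)
next
  case False
  show ?thesis
    by (rule has_derivative_eq_rhs[OF has_derivative_mult[OF has_derivative_compose[OF fibre_has_derivative[OF sm_L x False] bump_deriv[unfolded has_field_derivative_def]] fibre_has_derivative[OF h x False]]])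
       (simp add: fun_eq_iff)
qed

text \<open>The divergence of \<open>bump (L) grad_g\<close> along the fibre integrates to \<open>0\<close>. It equals \<open>bump (L) lap_g\<close>, because
  \<open>grad_g\<close> is tangent to the level sets of \<open>L\<close>, and \<open>lap_g\<close> is a squared norm of the torsion.\<close>

lemma deicke_torsion:
  assumes x: "x \<in> U" and I0: "\<And>y k. y \<noteq> 0 \<Longrightarrow> DY k tau0 (x, y) = 0" and y: "y \<noteq> 0"
  shows "DY k (g i j) (x, y) = 0"
proof -
  obtain r a b where r: "r > 0" "a > 0" and a: "\<And>x' y. x' \<in> cball x r \<Longrightarrow> a * norm y \<le> Floc F c (x', y)"
    using F_bounds[OF x] by metis
  define R where "R = 2 / a"
  have supp: "bump (L (x, y)) = 0" if "norm y > R" for y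
  proof -
    have "Floc F c (x, y) \<ge> 2" using a[of x y] that r by (auto simp: R_def field_simps)
    then have "L (x, y) \<ge> 2\<^sup>2" unfolding Lsq_def by (intro power_mono) auto
    then show ?thesis using bump_zero by simp
  qed
  obtain p q where box: "cball 0 (R + 1) \<subseteq> cbox p (q::real^'n)"
    using bounded_subset_cbox_symmetric[of "cball 0 (R + 1)"] by (metis bounded_cball)
  have fib: "continuous_on UNIV (\<lambda>y. f (x, y))" if "continuous_on (U \<times> UNIV) f" for f :: "_ \<Rightarrow> real"
    by (rule continuous_on_compose2[OF that]) (use x in \<open>auto intro!: continuous_intros\<close>)
  have cc: "continuous_on UNIV (\<lambda>y. \<rho> (L (x, y)) * h (x, y))" if "sm h" "\<rho> = bump \<or> \<rho> = bump'" for \<rho> h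
    using that by (intro fib cutoff_continuous smooth_on_imp_continuous[OF that(1) open_Om]) (auto intro: bump_cont simp: bump_zero)
  have "((\<lambda>y. bump' (L (x, y)) * (DY m L (x, y) * grad_g k m (x, y)) + bump (L (x, y)) * DY m (grad_g k m) (x, y)) has_integral 0) (cbox p q)" for m
  proof (rule integral_directional_derivative_zero[OF cutoff_fibre_derivative[OF sm_grad_g[of k m] x], where e="axis m 1" and R=R])
    show "continuous_on UNIV (\<lambda>y. bump' (L (x, y)) * (DY m L (x, y) * grad_g k m (x, y)) + bump (L (x, y)) * DY m (grad_g k m) (x, y))"
    proof -
      have s1: "sm (\<lambda>z. DY m L z * grad_g k m z)" by (intro smooth_on_mult open_Om sm_DY sm_L sm_grad_g)
      have s2: "sm (DY m (grad_g k m))" by (intro sm_DY sm_grad_g)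
      show ?thesis using continuous_on_add[OF cc[OF s1, of bump'] cc[OF s2, of bump]] by simp
    qed
  qed (use supp box in \<open>auto simp: DY_def\<close>)
  then have "((\<lambda>y. \<Sum>m\<in>UNIV. bump' (L (x, y)) * (DY m L (x, y) * grad_g k m (x, y)) + bump (L (x, y)) * DY m (grad_g k m) (x, y)) has_integral (\<Sum>m::'n\<in>UNIV. 0)) (cbox p q)"
    by (intro has_integral_sum) auto
  moreover have "(\<Sum>m\<in>UNIV. bump' (L (x, y)) * (DY m L (x, y) * grad_g k m (x, y)) + bump (L (x, y)) * DY m (grad_g k m) (x, y)) = bump (L (x, y)) * lap_g k (x, y)" for y
  proof (cases "y = 0")
    case True
    then show ?thesis using F_zero[OF x] by (simp add: Lsq_def bump_zero)
  next
    case False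
    then have z: "(x, y) \<in> Om" using x by auto
    have "(\<Sum>m\<in>UNIV. DY m L (x, y) * grad_g k m (x, y)) = (\<Sum>m\<in>UNIV. \<Sum>j\<in>UNIV. (DY m L (x, y) * gi m j (x, y)) * DY j (g k k) (x, y))"
      unfolding grad_g_def by (simp add: sum_distrib_left mult_ac)
    also have "\<dots> = (\<Sum>j\<in>UNIV. (\<Sum>m\<in>UNIV. DY m L (x, y) * gi m j (x, y)) * DY j (g k k) (x, y))"
      by (subst sum.swap) (simp add: sum_distrib_right)
    also have "\<dots> = 2 * (\<Sum>j\<in>UNIV. snd (x, y) $ j * DY j (g k k) (x, y))"
      unfolding L1_gi[OF z] by (simp add: sum_distrib_left mult_ac)
    also have "\<dots> = 0" unfolding euler[OF sm_g hom_g z] by simp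
    finally have "(\<Sum>m\<in>UNIV. DY m L (x, y) * grad_g k m (x, y)) = 0" .
    then show ?thesis unfolding lap_g_def by (simp add: sum.distrib flip: sum_distrib_left)
  qed
  ultimately have int0: "((\<lambda>y. bump (L (x, y)) * lap_g k (x, y)) has_integral 0) (cbox p q)" by simp
  have A_sym: "transpose (dg_mat k z) = dg_mat k z" if "z \<in> Om" for z
    using g_total_sym'[OF that] by (simp add: transpose_def dg_mat_def vec_eq_iff)
  have Qtr: "lap_g k (x, y) = trace (ginv F c (x, y) ** dg_mat k (x, y) ** (ginv F c (x, y) ** dg_mat k (x, y)))" if "y \<noteq> 0" for y
    by (rule lap_g_trace[OF x]) (use I0 that in auto)
  have lap_g_nonneg: "lap_g k (x, y) \<ge> 0" if "y \<noteq> 0" for y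
    unfolding Qtr[OF that] by (rule trace_sq_posdef) (use ginv_posdef A_sym x that in auto)
  have nonneg: "bump (L (x, y)) * lap_g k (x, y) \<ge> 0" for y
    using lap_g_nonneg[of y] bump_nonneg[of "L (x, y)"] F_zero[OF x] by (cases "y = 0") (auto simp: Lsq_def bump_zero)
  \<comment> \<open>The vanishing integral says something only where \<open>bump\<close> is
    positive, so \<open>y\<close> is scaled to \<open>L = 9/4\<close>. The torsion is homogeneous of
    degree -1, which brings the result back to \<open>y\<close>.\<close>
  define t where "t = 3/2 / Floc F c (x, y)"
  have Fp: "Floc F c (x, y) > 0" using F_pos[of "(x,y)"] x y by auto
  have t: "t > 0" using Fp by (simp add: t_def)
  have "Floc F c (x, t *\<^sub>R y) = 3/2" using F_hom[OF x t] Fp by (simp add: t_def)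
  then have "L (x, t *\<^sub>R y) = 9/4" unfolding Lsq_def by (simp only:) (simp add: power2_eq_square)
  then have bp: "bump (L (x, t *\<^sub>R y)) > 0" using bump_pos by simp
  have ty0: "t *\<^sub>R y \<noteq> 0" using t y by simp
  have "norm (t *\<^sub>R y) \<le> R" using supp[of "t *\<^sub>R y"] bp by force
  then have ty: "t *\<^sub>R y \<in> cbox p q" using box by (auto simp: subset_iff)
  have "box p q \<noteq> {}"
  proof -
    have "ball 0 (R + 1) \<subseteq> interior (cbox p q)" using box by (meson ball_subset_cball interior_maximal open_ball order_trans)
    moreover have "R + 1 > 0" using r by (simp add: R_def add_pos_pos)
    ultimately show ?thesis by (auto simp: interior_cbox)
  qed
  then have "bump (L (x, t *\<^sub>R y)) * lap_g k (x, t *\<^sub>R y) = 0"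
    by (intro has_integral_0_cbox_imp_0[OF _ _ int0 _ ty] continuous_on_subset[OF cc[OF sm_lap_g]])
       (use nonneg in auto)
  then have "lap_g k (x, t *\<^sub>R y) = 0" using bp by simp
  then have "trace (ginv F c (x, t *\<^sub>R y) ** dg_mat k (x, t *\<^sub>R y) ** (ginv F c (x, t *\<^sub>R y) ** dg_mat k (x, t *\<^sub>R y))) = 0"
    using Qtr[OF ty0] by simp
  moreover have zt: "(x, t *\<^sub>R y) \<in> Om" using x ty0 by auto
  ultimately have "dg_mat k (x, t *\<^sub>R y) = 0"
    using trace_sq_posdef(2)[OF ginv_posdef[OF zt] A_sym[OF zt]] by blast
  then have "DY k (g i j) (x, t *\<^sub>R y) = 0" by (simp add: dg_mat_def vec_eq_iff)
  then show ?thesis using homD[OF hom_DY[OF sm_g hom_g] x y t, of k i j] t by simp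
qed

text \<open>A punctured fibre is connected as soon as its dimension is at least 2.\<close>

lemma fibre_constant:
  assumes h: "sm h" and x: "x \<in> U" and n: "CARD('n) \<ge> 2"
    and D0: "\<And>y k. y \<noteq> 0 \<Longrightarrow> DY k h (x, y) = 0" and y: "y \<noteq> 0" "y' \<noteq> 0"
  shows "h (x, y) = h (x, y')"
proof -
  have "(\<lambda>y. h (x, y)) constant_on (UNIV - {0})"
  proof (rule has_derivative_zero_connected_constant_on[where K="{}"])
    show "connected (UNIV - {0::real^'n})"
      using connected_punctured_universe[of "0::real^'n"] n by (simp add: Compl_eq_Diff_UNIV)
    have D: "((\<lambda>y. h (x, y)) has_derivative (\<lambda>v. 0)) (at y)" if "y \<noteq> 0" for y
    proof (rule has_derivative_eq_rhs[OF fibre_has_derivative[OF h x that]])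
      show "(\<lambda>v. pd (0, v) h (x, y)) = (\<lambda>v. 0)"
        using pd_pair[OF sm_diff[OF h, of "(x, y)"], of 0] x that D0[OF that] by auto
    qed
    then show "\<forall>y\<in>UNIV - {0} - {}. ((\<lambda>y. h (x, y)) has_derivative (\<lambda>h. 0)) (at y within UNIV - {0})"
      by (auto intro: has_derivative_at_withinI)
    show "continuous_on (UNIV - {0}) (\<lambda>y. h (x, y))"
      using D by (intro continuous_at_imp_continuous_on ballI) (auto intro: has_derivative_continuous)
  qed auto
  then show ?thesis using y unfolding constant_on_def by auto
qed

theorem deicke:
  assumes "x \<in> U" "\<And>y k. y \<noteq> 0 \<Longrightarrow> DY k tau0 (x, y) = 0" "CARD('n) \<ge> 2" "y \<noteq> 0" "y' \<noteq> 0"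
  shows "g i j (x, y) = g i j (x, y')"
  using fibre_constant[OF sm_g assms(1,3) deicke_torsion[OF assms(1,2)] assms(4,5)] by blast

end

section \<open>Invariance under isometries\<close>

lemma has_derivative_vecI:
  fixes f :: "'a::real_normed_vector \<Rightarrow> real^'n"
  assumes "\<And>k. ((\<lambda>x. f x $ k) has_derivative (\<lambda>h. f' h $ k)) (at x)"
  shows "(f has_derivative f') (at x)"
proof (subst has_derivative_componentwise_within, intro ballI)
  fix b :: "real^'n" assume "b \<in> Basis"
  then obtain k where "b = axis k 1" by (auto simp: Basis_vec_def)
  then show "((\<lambda>x. f x \<bullet> b) has_derivative (\<lambda>x. f' x \<bullet> b)) (at x)"
    using assms[of k] by (simp add: inner_axis)
qed

lemma smooth_map_on_nth: "smooth_map_on S f \<Longrightarrow> smooth_on S (\<lambda>x. (f x :: real^'n) $ k)"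
  unfolding smooth_map_on_def using axis_in_Basis_iff[of k "1::real"] by (auto simp: inner_axis dest!: bspec[of _ _ "axis k 1"])

lemma pd_vec:
  assumes "f differentiable (at x)"
  shows "pd v f x = (\<Sum>k\<in>UNIV. v $ k * pd (axis k 1) f (x::real^'n))"
proof -
  note lin = pd_linear[OF assms]
  have "pd v f x = pd (\<Sum>k\<in>UNIV. v $ k *\<^sub>R axis k 1) f x" using vec_eq_sum_axis[of v] by simp
  then show ?thesis by (simp add: linear_sum[OF lin] linear_cmul[OF lin])
qed

text \<open>The library states this only for well-ordered index types; the determinant of a shear is
  here computed by a row operation instead of triangularity.\<close>

lemma measure_linear_image_finite:
  fixes f :: "real^'n \<Rightarrow> real^'n"
  assumes "linear f" "S \<in> lmeasurable"
  shows "measure lebesgue (f ` S) = \<bar>det (matrix f)\<bar> * measure lebesgue S"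
proof -
  define P where "P f \<longleftrightarrow> (\<forall>S\<in>lmeasurable. f ` S \<in> lmeasurable \<and> measure lebesgue (f ` S) = \<bar>det (matrix f)\<bar> * measure lebesgue S)"
    for f :: "real^'n \<Rightarrow> real^'n"
  have P_box: "P f" if "linear f" "\<bar>det (matrix f)\<bar> = 1" "\<And>a b. measure lebesgue (f ` cbox a b) = measure lebesgue (cbox a b)" for f
    unfolding P_def
  proof (intro ballI)
    fix S :: "(real^'n) set" assume "S \<in> lmeasurable"
    from measure_linear_sufficient[OF that(1) this, of 1]
    show "f ` S \<in> lmeasurable \<and> measure lebesgue (f ` S) = \<bar>det (matrix f)\<bar> * measure lebesgue S"
      unfolding that(2) that(3) mult_1 by simp
  qed
  have "P f"
  proof (rule induct_linear_elementary[OF assms(1)])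
    fix f g :: "real^'n \<Rightarrow> real^'n" assume fg: "linear f" "linear g" "P f" "P g"
    show "P (f \<circ> g)"
      unfolding P_def
    proof (intro ballI)
      fix S :: "(real^'n) set" assume S: "S \<in> lmeasurable"
      then have gS: "g ` S \<in> lmeasurable" "measure lebesgue (g ` S) = \<bar>det (matrix g)\<bar> * measure lebesgue S"
        using fg(4) by (auto simp: P_def)
      then have "f ` g ` S \<in> lmeasurable" "measure lebesgue (f ` g ` S) = \<bar>det (matrix f)\<bar> * (\<bar>det (matrix g)\<bar> * measure lebesgue S)"
        using fg(3) by (auto simp: P_def)
      then show "(f \<circ> g) ` S \<in> lmeasurable \<and> measure lebesgue ((f \<circ> g) ` S) = \<bar>det (matrix (f \<circ> g))\<bar> * measure lebesgue S"
        unfolding matrix_compose[OF fg(2,1)] image_comp[symmetric] by (simp add: abs_mult det_mul)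
    qed
  next
    fix f :: "real^'n \<Rightarrow> real^'n" and i assume f: "linear f" "\<And>x. f x $ i = 0"
    have "\<not> surj f" using f(2) by (metis one_neq_zero surjD vec_component)
    then have ni: "\<not> inj f" using linear_injective_imp_surjective[OF f(1)] by blast
    then have "negligible (f ` S)" for S using negligible_linear_singular_image[OF f(1)] by blast
    moreover have "det (matrix f) = 0" using ni det_nz_iff_inj[OF f(1)] by blast
    ultimately show "P f" unfolding P_def by (simp add: negligible_iff_measure)
  next
    fix k :: "'n \<Rightarrow> real"
    have "det (matrix (\<lambda>x::real^'n. \<chi> i. k i * x $ i)) = prod k UNIV"
      by (subst det_diagonal) (auto simp: matrix_def axis_def)
    then show "P (\<lambda>x. \<chi> i. k i * x $ i)" unfolding P_def by (simp add: measurable_stretch measure_stretch)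
  next
    fix m n :: 'n assume "m \<noteq> n"
    let ?\<pi> = "Transposition.transpose m n"
    let ?h = "\<lambda>x::real^'n. \<chi> i. x $ ?\<pi> i"
    have perm: "?\<pi> permutes UNIV" by (rule permutes_swap_id) auto
    show "P ?h"
    proof (rule P_box)
      show "linear ?h" by (rule linearI) (auto simp: vec_eq_iff)
      have "matrix ?h = (\<chi> i. mat 1 $ ?\<pi> i)" by (simp add: matrix_def axis_def mat_def vec_eq_iff)
      then show "\<bar>det (matrix ?h)\<bar> = 1"
        using det_permute_rows[OF perm, of "mat 1 :: real^'n^'n"] by (simp add: sign_def)
      fix a b :: "real^'n"
      have im: "?h ` cbox a b = cbox (?h a) (?h b)"
      proof (intro set_eqI iffI)
        fix y assume "y \<in> cbox (?h a) (?h b)"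
        then have y: "a $ ?\<pi> i \<le> y $ i" "y $ i \<le> b $ ?\<pi> i" for i by (auto simp: mem_box_cart)
        have "?h y \<in> cbox a b" using y[of "?\<pi> i" for i] by (simp add: mem_box_cart)
        moreover have "y = ?h (?h y)" by (simp add: vec_eq_iff)
        ultimately show "y \<in> ?h ` cbox a b" by blast
      qed (auto simp: mem_box_cart)
      show "measure lebesgue (?h ` cbox a b) = measure lebesgue (cbox a b)"
      proof (cases "cbox a b = {}")
        case False
        then have "cbox (?h a) (?h b) \<noteq> {}" using im by auto
        then show ?thesis unfolding im
          using prod.permute[OF perm, of "\<lambda>i. b $ i - a $ i"] False by (simp add: content_cbox_cart o_def)
      qed simp
    qed
  next
    fix m n :: 'n assume mn: "m \<noteq> n"
    let ?h = "\<lambda>x::real^'n. \<chi> i. if i = m then x $ m + x $ n else x $ i"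
    show "P ?h"
    proof (rule P_box)
      show lin: "linear ?h" by (rule linearI) (auto simp: vec_eq_iff algebra_simps)
      have "matrix ?h = (\<chi> k. if k = m then row m (mat 1) + 1 *s row n (mat 1) else row k (mat 1))"
        by (auto simp: matrix_def axis_def mat_def row_def vec_eq_iff)
      then show "\<bar>det (matrix ?h)\<bar> = 1" by (simp only: det_row_operation[OF mn]) simp
      fix a b :: "real^'n"
      show "measure lebesgue (?h ` cbox a b) = measure lebesgue (cbox a b)"
      proof (cases "cbox a b = {}")
        case False
        \<comment> \<open>\<open>measure_shear_interval\<close> asks for a nonnegative
          \<open>n\<close>-th coordinate of the lower corner; translation by \<open>?v\<close> makes
          it 0.\<close>
        let ?v = "axis n (- a $ n) :: real^'n"
        have ne: "cbox (?v + a) (?v + b) \<noteq> {}" using False by (simp add: cbox_translation)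
        have "?h ` cbox (?v + a) (?v + b) = (+) (?h ?v) ` ?h ` cbox a b"
          unfolding cbox_translation image_image by (simp add: linear_add[OF lin])
        then have "measure lebesgue (?h ` cbox a b) = measure lebesgue (?h ` cbox (?v + a) (?v + b))"
          by (simp only: measure_translation)
        also have "\<dots> = measure lebesgue (cbox (?v + a) (?v + b))"
          by (rule measure_shear_interval[OF mn ne]) (simp add: axis_def)
        also have "\<dots> = measure lebesgue (cbox a b)" by (simp only: cbox_translation measure_translation)
        finally show ?thesis .
      qed simp
    qed
  qed
  then show ?thesis using assms(2) unfolding P_def by blast
qed

context finsler_chart
begin

text \<open>The counterpart of \<open>phi\<close> without a density: vertical derivatives do not see
  the density, so the two agree. Its invariance can be stated before \<open>S = 0\<close> is
  known.\<close>

definition phi0 :: "(real^'n) \<times> (real^'n) \<Rightarrow> real" where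
  "phi0 z = L z * ip (\<lambda>i. DY i tau0 z) (\<lambda>i. DY i tau0 z) z"

lemma sm_phi0: "sm phi0"
  unfolding phi0_def[abs_def] by (intro smooth_on_mult open_Om sm_L sm_ip sm_DY sm_tau0)

text \<open>The distortion up to an additive constant: \<open>ln (vol x)\<close> is the constant \<open>ln Vol(B)\<close> minus \<open>ln \<sigma>\<close>.\<close>

definition tauB :: "(real^'n) \<times> (real^'n) \<Rightarrow> real" where
  "tauB z = tau0 z + ln (vol (fst z))"

lemma GG_Scurv:
  assumes z: "z \<in> Om"
  shows "tauB differentiable (at z)" "GG tauB z = Scurv F c z"
proof -
  have x: "fst z \<in> U" using z by auto
  have dl: "(\<lambda>x. ln (vol x)) differentiable (at (fst z))"
    using has_derivative_ln[OF vol_pos[OF x] pd_has_derivative[OF vol_differentiable[OF x]]]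
    unfolding differentiable_def by blast
  have dz: "(\<lambda>z. ln (vol (fst z))) differentiable (at z)"
    using has_derivative_compose[OF has_derivative_fst[OF has_derivative_ident] pd_has_derivative[OF dl]]
    unfolding differentiable_def by blast
  show dt: "tauB differentiable (at z)"
    unfolding tauB_def[abs_def] by (intro differentiable_add sm_diff[OF sm_tau0 z] dz)
  have fst: "(fst has_derivative fst) (at z)" by (auto intro!: derivative_eq_intros)
  have b: "measure lebesgue (ball (0::real^'n) 1) > 0" by (simp add: content_ball_pos)
  have sig: "pd v (\<lambda>x. ln (sigmaBH F c x)) (fst z) = - pd v (\<lambda>x. ln (vol x)) (fst z)" for v
  proof -
    have "pd v (\<lambda>x. ln (sigmaBH F c x)) (fst z) = pd v (\<lambda>x. ln (measure lebesgue (ball (0::real^'n) 1)) - ln (vol x)) (fst z)"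
    proof (rule pd_cong_open[OF open_U x])
      fix x assume "x \<in> U"
      then show "ln (sigmaBH F c x) = ln (measure lebesgue (ball (0::real^'n) 1)) - ln (vol x)"
        using vol_pos[of x] b by (simp add: sigmaBH_def ln_div flip: vol_def)
    qed
    then show ?thesis using pd_diff[OF _ dl] by simp
  qed
  have "GG tauB z = GG tau0 z + pd (snd z) (\<lambda>x. ln (vol x)) (fst z)"
    unfolding GG_pd[OF dt] GG_pd[OF sm_diff[OF sm_tau0 z]]
    unfolding tauB_def[abs_def] using pd_add[OF sm_diff[OF sm_tau0 z] dz] pd_chain[OF fst dl] by simp
  also have "\<dots> = Scurv F c z"
    unfolding GG_tau0[OF z] Scurv_def sig pd_vec[OF dl, of "snd z"] by (simp add: sum_negf)
  finally show "GG tauB z = Scurv F c z" .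
qed

end

section \<open>Isometries in coordinates and the naturality of the spray, the distortion and the
  torsion\<close>

locale finsler_isometry = finsler_chart F c + D: finsler_chart F d
  for F :: "('m, 'n::finite) tbfun" and c d :: "('m, 'n) chart" +
  fixes \<Phi> :: "real^'n \<Rightarrow> real^'n" and W :: "(real^'n) set"
  assumes W: "open W" "W \<subseteq> snd c ` fst c" and \<Phi>_smooth: "smooth_map_on W \<Phi>"
    and \<Phi>_U: "x \<in> W \<Longrightarrow> \<Phi> x \<in> snd d ` fst d"
    and iso: "x \<in> W \<Longrightarrow> Floc F d (\<Phi> x, frechet_derivative \<Phi> (at x) y) = Floc F c (x, y)"
begin

definition jac :: "real^'n \<Rightarrow> real^'n^'n" where "jac x = (\<chi> k i. pd (axis i 1) (\<lambda>x. \<Phi> x $ k) x)"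

definition T :: "(real^'n) \<times> (real^'n) \<Rightarrow> (real^'n) \<times> (real^'n)" where
  "T z = (\<Phi> (fst z), jac (fst z) *v snd z)"

abbreviation "OmW \<equiv> W \<times> (UNIV - {0::real^'n})"

lemma open_OmW: "open OmW" by (intro open_Times W open_Diff) auto

lemma OmW_Om: "z \<in> OmW \<Longrightarrow> z \<in> Om" using W by auto

lemma \<Phi>_nth_smooth: "smooth_on W (\<lambda>x. \<Phi> x $ k)" by (rule smooth_map_on_nth[OF \<Phi>_smooth])

lemma jac_smooth: "smooth_on W (\<lambda>x. jac x $ k $ i)"
  unfolding jac_def using smooth_on_pd[OF \<Phi>_nth_smooth, of "axis i 1" k] axis_in_Basis_iff[of i "1::real"] by simp

lemma \<Phi>_deriv: assumes "x \<in> W" shows "(\<Phi> has_derivative (\<lambda>v. jac x *v v)) (at x)"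
proof (rule has_derivative_vecI)
  fix k
  have d: "(\<lambda>x. \<Phi> x $ k) differentiable (at x)" using smooth_on_imp_differentiable[OF \<Phi>_nth_smooth W(1) assms] .
  have "pd h (\<lambda>x. \<Phi> x $ k) x = (jac x *v h) $ k" for h
    by (subst pd_vec[OF d]) (simp add: jac_def matrix_vector_mult_def mult_ac)
  then show "((\<lambda>x. \<Phi> x $ k) has_derivative (\<lambda>h. (jac x *v h) $ k)) (at x)"
    using pd_has_derivative[OF d] by simp
qed

lemma F_iso: assumes "x \<in> W" shows "Floc F d (\<Phi> x, jac x *v y) = Floc F c (x, y)"
  using iso[OF assms, of y] unfolding frechet_derivative_at[OF \<Phi>_deriv[OF assms], symmetric] .

text \<open>An isometry preserves \<open>F\<close>, and \<open>F\<close> vanishes only on the zero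
  vector.\<close>

lemma jac_inj: assumes "x \<in> W" "y \<noteq> 0" shows "jac x *v y \<noteq> 0"
  using F_iso[OF assms(1), of y] D.F_zero[OF \<Phi>_U[OF assms(1)]] F_pos[of "(x, y)"] assms W by auto

lemma jac_invertible: assumes "x \<in> W" shows "invertible (jac x)"
proof -
  have "inj ((*v) (jac x))"
  proof (rule injI)
    fix u v assume "jac x *v u = jac x *v v"
    then have "jac x *v (u - v) = 0" by (simp add: matrix_vector_mult_diff_distrib)
    then show "u = v" using jac_inj[OF assms, of "u - v"] by auto
  qed
  then show ?thesis using matrix_left_invertible_injective invertible_left_inverse by blast
qed

lemma T_Om: "z \<in> OmW \<Longrightarrow> T z \<in> D.Om"
  using \<Phi>_U jac_inj by (auto simp: T_def)

definition hess :: "real^'n \<Rightarrow> real^'n \<Rightarrow> real^'n \<Rightarrow> real^'n" where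
  "hess x a y = (\<chi> k. \<Sum>i\<in>UNIV. pd a (\<lambda>x. jac x $ k $ i) x * y $ i)"

lemma T_deriv: assumes z: "z \<in> OmW"
  shows "(T has_derivative (\<lambda>v. (jac (fst z) *v fst v, hess (fst z) (fst v) (snd z) + jac (fst z) *v snd v))) (at z)"
proof -
  have x: "fst z \<in> W" using z by auto
  have fst: "(fst has_derivative fst) (at z)" by (auto intro!: derivative_eq_intros)
  have 1: "((\<lambda>z. \<Phi> (fst z)) has_derivative (\<lambda>v. jac (fst z) *v fst v)) (at z)"
    by (rule has_derivative_compose[OF fst \<Phi>_deriv[OF x]])
  have 2: "((\<lambda>z. jac (fst z) *v snd z) has_derivative (\<lambda>v. hess (fst z) (fst v) (snd z) + jac (fst z) *v snd v)) (at z)"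
  proof (rule has_derivative_vecI)
    fix k
    have "((\<lambda>z. jac (fst z) $ k $ i) has_derivative (\<lambda>v. pd (fst v) (\<lambda>x. jac x $ k $ i) (fst z))) (at z)" for i
      by (rule has_derivative_compose[OF fst pd_has_derivative[OF smooth_on_imp_differentiable[OF jac_smooth W(1) x]]])
    moreover have "((\<lambda>z. snd z $ i) has_derivative (\<lambda>v. snd v $ i)) (at z)" for i
      by (rule bounded_linear_imp_has_derivative) (rule bounded_linear_compose[OF bounded_linear_vec_nth bounded_linear_snd])
    ultimately have "((\<lambda>z. \<Sum>i\<in>UNIV. jac (fst z) $ k $ i * snd z $ i) has_derivative
      (\<lambda>v. \<Sum>i\<in>UNIV. jac (fst z) $ k $ i * snd v $ i + pd (fst v) (\<lambda>x. jac x $ k $ i) (fst z) * snd z $ i)) (at z)"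
      by (intro has_derivative_sum has_derivative_mult)
    then show "((\<lambda>z. (jac (fst z) *v snd z) $ k) has_derivative (\<lambda>v. (hess (fst z) (fst v) (snd z) + jac (fst z) *v snd v) $ k)) (at z)"
      by (simp add: matrix_vector_mult_def hess_def sum.distrib add.commute)
  qed
  show ?thesis unfolding T_def[abs_def] by (rule has_derivative_Pair[OF 1 2])
qed

lemma pd_T:
  assumes z: "z \<in> OmW" and h: "D.sm h"
  shows "pd (a, b) (\<lambda>z. h (T z)) z = pd (jac (fst z) *v a, hess (fst z) a (snd z) + jac (fst z) *v b) h (T z)"
    and "(\<lambda>z. h (T z)) differentiable (at z)"
proof -
  note d = D.sm_diff[OF h T_Om[OF z]]
  show "pd (a, b) (\<lambda>z. h (T z)) z = pd (jac (fst z) *v a, hess (fst z) a (snd z) + jac (fst z) *v b) h (T z)"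
    using pd_chain[OF T_deriv[OF z] d, of "(a, b)"] by simp
  show "(\<lambda>z. h (T z)) differentiable (at z)"
    using has_derivative_compose[OF T_deriv[OF z] pd_has_derivative[OF d]] unfolding differentiable_def by blast
qed

lemma hess_0: assumes "x \<in> W" shows "hess x 0 y = 0"
proof -
  have "pd 0 (\<lambda>x. jac x $ k $ i) x = 0" for k i
    using linear_0[OF pd_linear[OF smooth_on_imp_differentiable[OF jac_smooth W(1) assms]]] .
  then show ?thesis by (simp add: hess_def vec_eq_iff)
qed

lemma DY_T: assumes z: "z \<in> OmW" and h: "D.sm h"
  shows "DY i (\<lambda>z. h (T z)) z = (\<Sum>k\<in>UNIV. jac (fst z) $ k $ i * DY k h (T z))"
proof -
  have x: "fst z \<in> W" using z by auto
  have "DY i (\<lambda>z. h (T z)) z = pd (0, jac (fst z) *v axis i 1) h (T z)"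
    unfolding DY_def pd_T(1)[OF z h] by (simp add: hess_0[OF x])
  also have "\<dots> = (\<Sum>k\<in>UNIV. (jac (fst z) *v axis i 1) $ k * DY k h (T z))"
    using pd_pair[OF D.sm_diff[OF h T_Om[OF z]], of 0] by simp
  finally show ?thesis by (simp add: matrix_vector_mult_basis column_def)
qed

lemma L_T: "z \<in> OmW \<Longrightarrow> L z = D.L (T z)"
  using F_iso[of "fst z" "snd z"] by (cases z) (auto simp: Lsq_def T_def)

lemma L1_T: assumes z: "z \<in> OmW" shows "DY i L z = (\<Sum>k\<in>UNIV. jac (fst z) $ k $ i * DY k D.L (T z))"
  using pd_cong_open[OF open_OmW z, of L "\<lambda>z. D.L (T z)"] L_T DY_T[OF z D.sm_L] unfolding DY_def by simp

lemma pd_jac_fst: assumes z: "z \<in> OmW"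
  shows "(\<lambda>z. jac (fst z) $ k $ i) differentiable (at z)" "pd v (\<lambda>z. jac (fst z) $ k $ i) z = pd (fst v) (\<lambda>x. jac x $ k $ i) (fst z)"
proof -
  have x: "fst z \<in> W" using z by auto
  have fst: "(fst has_derivative fst) (at z)" by (auto intro!: derivative_eq_intros)
  note d = smooth_on_imp_differentiable[OF jac_smooth W(1) x]
  show "(\<lambda>z. jac (fst z) $ k $ i) differentiable (at z)"
    using has_derivative_compose[OF fst pd_has_derivative[OF d]] unfolding differentiable_def by blast
  show "pd v (\<lambda>z. jac (fst z) $ k $ i) z = pd (fst v) (\<lambda>x. jac x $ k $ i) (fst z)"
    by (rule pd_chain[OF fst d])
qed

lemma pd_L1_T: assumes z: "z \<in> OmW"
  shows "pd v (DY i L) z = (\<Sum>k\<in>UNIV. pd (fst v) (\<lambda>x. jac x $ k $ i) (fst z) * DY k D.L (T z)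
     + jac (fst z) $ k $ i * pd v (\<lambda>z. DY k D.L (T z)) z)"
proof -
  have d: "(\<lambda>z. DY k D.L (T z)) differentiable (at z)" for k by (rule pd_T(2)[OF z D.sm_DY[OF D.sm_L]])
  have "pd v (DY i L) z = pd v (\<lambda>z. \<Sum>k\<in>UNIV. jac (fst z) $ k $ i * DY k D.L (T z)) z"
    by (rule pd_cong_open[OF open_OmW z]) (rule L1_T)
  also have "\<dots> = (\<Sum>k\<in>UNIV. pd v (\<lambda>z. jac (fst z) $ k $ i * DY k D.L (T z)) z)"
    by (rule pd_sum) (intro differentiable_mult d pd_jac_fst z)
  finally show ?thesis by (simp add: pd_mult[OF pd_jac_fst(1)[OF z] d] pd_jac_fst(2)[OF z])
qed

lemma g_T: assumes z: "z \<in> OmW"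
  shows "g j i z = (\<Sum>k\<in>UNIV. \<Sum>l\<in>UNIV. jac (fst z) $ k $ i * jac (fst z) $ l $ j * D.g l k (T z))"
proof -
  have x: "fst z \<in> W" using z by auto
  have 0: "pd 0 (\<lambda>x. jac x $ k $ i) (fst z) = 0" for k
    using linear_0[OF pd_linear[OF smooth_on_imp_differentiable[OF jac_smooth W(1) x]]] .
  have "DY j (DY i L) z = (\<Sum>k\<in>UNIV. jac (fst z) $ k $ i * DY j (\<lambda>z. DY k D.L (T z)) z)"
    unfolding DY_def[of j] pd_L1_T[OF z] by (simp add: 0)
  then show ?thesis unfolding gten_def DY_T[OF z D.sm_DY[OF D.sm_L]] by (simp add: sum_distrib_left mult_ac)
qed

lemma gm_T: assumes z: "z \<in> OmW" shows "gm z = transpose (jac (fst z)) ** D.gm (T z) ** jac (fst z)"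
  unfolding vec_eq_iff
proof (intro allI)
  fix j i
  have "(transpose (jac (fst z)) ** D.gm (T z) ** jac (fst z)) $ j $ i
     = (\<Sum>k\<in>UNIV. \<Sum>l\<in>UNIV. jac (fst z) $ l $ j * D.g l k (T z) * jac (fst z) $ k $ i)"
    by (simp add: matrix_matrix_mult_def transpose_def sum_distrib_right)
  then show "gm z $ j $ i = (transpose (jac (fst z)) ** D.gm (T z) ** jac (fst z)) $ j $ i"
    unfolding gm_nth g_T[OF z] by (simp add: mult_ac)
qed

lemma jac_hess_sym: assumes "x \<in> W" shows "pd (axis j 1) (\<lambda>x. jac x $ k $ i) x = pd (axis i 1) (\<lambda>x. jac x $ k $ j) x"
  unfolding jac_def using pd_commute[OF W(1) \<Phi>_nth_smooth assms, of "axis j 1" "axis i 1" k]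
  by (simp add: axis_in_Basis_iff)

text \<open>Both sides are the vertical part of a vector over \<open>T z\<close> that satisfies the
  Euler-Lagrange equation of the target metric; nondegeneracy of \<open>D.gm\<close> makes that part
  unique. The left side is the image of the source spray under the derivative of the tangent map
  \<open>T\<close>.\<close>

lemma spray_T: assumes z: "z \<in> OmW"
  shows "hess (fst z) (snd z) (snd z) + jac (fst z) *v (\<chi> k. -2 * G k z) = (\<chi> k. -2 * D.G k (T z))" (is "?m = ?m'")
proof -
  have x: "fst z \<in> W" and zO: "z \<in> Om" using z OmW_Om by auto
  let ?w = "(snd z, \<chi> k. -2 * G k z)"
  let ?P = "\<lambda>k. DY k D.L"
  have TO: "T z \<in> D.Om" by (rule T_Om[OF z])
  have snd_T: "snd (T z) = jac (fst z) *v snd z" by (simp add: T_def)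
  have smP: "D.sm (?P k)" for k by (intro D.sm_DY D.sm_L)
  have key: "(\<Sum>k\<in>UNIV. jac (fst z) $ k $ l * (pd (snd (T z), ?m) (?P k) (T z) - DX k D.L (T z))) = 0" for l
  proof -
    have "pd ?w (DY l L) z = DX l L z" using euler_lagrange[OF zO, of l] GG_pd[OF sm_diff[OF sm_DY[OF sm_L] zO]] by simp
    moreover have "pd ?w (DY l L) z = (\<Sum>k\<in>UNIV. pd (snd z) (\<lambda>x. jac x $ k $ l) (fst z) * ?P k (T z)
     + jac (fst z) $ k $ l * pd (snd (T z), ?m) (?P k) (T z))"
      unfolding pd_L1_T[OF z] pd_T(1)[OF z smP] snd_T by simp
    moreover have "DX l L z = (\<Sum>k\<in>UNIV. jac (fst z) $ k $ l * DX k D.L (T z)) + (\<Sum>k\<in>UNIV. hess (fst z) (axis l 1) (snd z) $ k * ?P k (T z))"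
    proof -
      have "DX l L z = pd (axis l 1, 0) (\<lambda>z. D.L (T z)) z"
        unfolding DX_def by (rule pd_cong_open[OF open_OmW z]) (rule L_T)
      also have "\<dots> = pd (jac (fst z) *v axis l 1, hess (fst z) (axis l 1) (snd z)) D.L (T z)"
        unfolding pd_T(1)[OF z D.sm_L] by simp
      finally show ?thesis
        using pd_pair[OF D.sm_diff[OF D.sm_L TO]] by (simp add: matrix_vector_mult_basis column_def)
    qed
    moreover have "hess (fst z) (axis l 1) (snd z) $ k = pd (snd z) (\<lambda>x. jac x $ k $ l) (fst z)" for k
      unfolding hess_def pd_vec[OF smooth_on_imp_differentiable[OF jac_smooth W(1) x], of "snd z"]
      using jac_hess_sym[OF x, of l k] by (simp add: mult_ac)
    ultimately show ?thesis by (simp add: right_diff_distrib sum_subtractf sum.distrib)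
  qed
  define q where "q = (\<chi> k. pd (snd (T z), ?m) (?P k) (T z) - DX k D.L (T z))"
  have "transpose (jac (fst z)) *v q = 0"
    using key by (simp add: vec_eq_iff matrix_vector_mult_def transpose_def q_def)
  then have "matrix_inv (transpose (jac (fst z))) *v (transpose (jac (fst z)) *v q) = 0" by simp
  then have "q = 0"
    by (simp only: matrix_vector_mul_assoc matrix_inv_left[OF transpose_invertible[OF jac_invertible[OF x]]] matrix_vector_mul_lid)
  then have 1: "pd (snd (T z), ?m) (?P k) (T z) = DX k D.L (T z)" for k by (simp add: q_def vec_eq_iff)
  have 2: "pd (snd (T z), ?m') (?P k) (T z) = DX k D.L (T z)" for k
    using D.euler_lagrange[OF TO, of k] D.GG_pd[OF D.sm_diff[OF smP TO]] by simp
  have "(D.gm (T z) *v (?m - ?m')) $ k = 0" for k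
  proof -
    have "pd (snd (T z), ?m) (?P k) (T z) - pd (snd (T z), ?m') (?P k) (T z) = (\<Sum>j\<in>UNIV. (?m - ?m') $ j * DY j (?P k) (T z))"
      unfolding pd_pair[OF D.sm_diff[OF smP TO]] vector_minus_component left_diff_distrib sum_subtractf by simp
    also have "\<dots> = 2 * (D.gm (T z) *v (?m - ?m')) $ k"
      using D.DYY[OF D.sm_L TO, of k] by (simp add: matrix_vector_mult_def D.gm_def gten_def sum_distrib_left mult_ac)
    finally show ?thesis using 1 2 by simp
  qed
  then have "D.gm (T z) *v (?m - ?m') = 0" by (simp add: vec_eq_iff)
  then have "matrix_inv (D.gm (T z)) *v (D.gm (T z) *v (?m - ?m')) = 0" by simp
  then have "?m - ?m' = 0"
    using matrix_inv_left[OF D.gm_invertible[OF TO]] by (simp only: matrix_vector_mul_assoc) simp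
  then show ?thesis by simp
qed

lemma GG_T: assumes z: "z \<in> OmW" and h: "D.sm h" shows "GG (\<lambda>z. h (T z)) z = D.GG h (T z)"
  unfolding GG_pd[OF pd_T(2)[OF z h]] pd_T(1)[OF z h] spray_T[OF z] D.GG_pd[OF D.sm_diff[OF h T_Om[OF z]]]
  by (simp add: T_def)

lemma det_jac: "x \<in> W \<Longrightarrow> det (jac x) \<noteq> 0"
  using jac_invertible invertible_det_nz by blast

lemma tau0_T: assumes z: "z \<in> OmW" shows "tau0 z = D.tau0 (T z) + ln \<bar>det (jac (fst z))\<bar>"
proof -
  have x: "fst z \<in> W" using z by auto
  define a where "a = det (jac (fst z))"
  define b where "b = det (D.gm (T z))"
  have nz: "a \<noteq> 0" "b \<noteq> 0" using det_jac[OF x] D.det_nz[OF T_Om[OF z]] by (auto simp: a_def b_def)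
  have "det (gm z) = a * b * a" unfolding gm_T[OF z] a_def b_def by (simp add: det_mul det_transpose)
  then have "(det (gm z))\<^sup>2 = b\<^sup>2 * \<bar>a\<bar> ^ 4" by (simp add: power2_eq_square power4_eq_xxxx)
  then have "ln ((det (gm z))\<^sup>2) = ln (b\<^sup>2) + ln (\<bar>a\<bar> ^ 4)" using nz by (simp only: ln_mult) (simp add: ln_mult)
  also have "ln (\<bar>a\<bar> ^ 4) = 4 * ln \<bar>a\<bar>" using nz by (subst ln_realpow) auto
  finally have "ln ((det (gm z))\<^sup>2) = ln (b\<^sup>2) + 4 * ln \<bar>a\<bar>" .
  then show ?thesis unfolding tau0_def D.tau0_def a_def b_def by simp
qed

lemma vol_T: assumes x: "x \<in> W" shows "D.vol (\<Phi> x) = \<bar>det (jac x)\<bar> * vol x"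
proof -
  have xU: "x \<in> U" using x W by auto
  have "{y. Floc F d (\<Phi> x, y) < 1} = (\<lambda>y. jac x *v y) ` {y. Floc F c (x, y) < 1}"
  proof (intro set_eqI iffI)
    fix y assume y: "y \<in> {y. Floc F d (\<Phi> x, y) < 1}"
    have "jac x *v (matrix_inv (jac x) *v y) = y"
      using matrix_inv_right[OF jac_invertible[OF x]] by (simp add: matrix_vector_mul_assoc)
    then show "y \<in> (\<lambda>y. jac x *v y) ` {y. Floc F c (x, y) < 1}"
      using y F_iso[OF x, of "matrix_inv (jac x) *v y"] by (intro image_eqI[of _ _ "matrix_inv (jac x) *v y"]) auto
  qed (use F_iso[OF x] in auto)
  then show ?thesis unfolding vol_def D.vol_def
    using measure_linear_image_finite[OF matrix_vector_mul_linear[of "jac x"] ball_lmeasurable[OF xU, of 1]] by simp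
qed

text \<open>The determinant of the metric and the volume of the unit ball both change by the
  Jacobian, and the two shifts by \<open>ln \<bar>det (jac x)\<bar>\<close> cancel. The distortion
  is thus a scalar although neither summand is.\<close>

lemma tauB_T: assumes z: "z \<in> OmW" shows "tauB z = D.tauB (T z)"
proof -
  have x: "fst z \<in> W" using z by auto
  have "fst z \<in> U" using x W by auto
  then show ?thesis
    unfolding tauB_def D.tauB_def tau0_T[OF z] using vol_T[OF x] vol_pos[of "fst z"] det_jac[OF x] by (simp add: T_def ln_mult)
qed

lemma DY_tau0_T: assumes z: "z \<in> OmW"
  shows "DY i tau0 z = (\<Sum>k\<in>UNIV. jac (fst z) $ k $ i * DY k D.tau0 (T z))"
proof -
  obtain x y where xy: "z = (x, y)" "x \<in> W" "y \<noteq> 0" using z by auto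
  have xU: "x \<in> U" using xy W by auto
  have TO: "(\<Phi> x, jac x *v y) \<in> D.Om" using T_Om[OF z] by (simp add: T_def xy)
  have "((\<lambda>y. jac x *v y) has_derivative (\<lambda>v. jac x *v v)) (at y)"
    by (intro linear_imp_has_derivative matrix_vector_mul_linear)
  from has_derivative_compose[OF this D.fibre_has_derivative[OF D.sm_tau0, of "\<Phi> x" "jac x *v y"]] TO
  have "((\<lambda>y. D.tau0 (\<Phi> x, jac x *v y)) has_derivative (\<lambda>v. pd (0, jac x *v v) D.tau0 (\<Phi> x, jac x *v y))) (at y)" by auto
  then have "((\<lambda>y. D.tau0 (\<Phi> x, jac x *v y) + ln \<bar>det (jac x)\<bar>) has_derivative (\<lambda>v. pd (0, jac x *v v) D.tau0 (\<Phi> x, jac x *v y))) (at y)"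
    by (auto intro!: derivative_eq_intros)
  then have "((\<lambda>y. tau0 (x, y)) has_derivative (\<lambda>v. pd (0, jac x *v v) D.tau0 (\<Phi> x, jac x *v y))) (at y)"
    by (rule has_derivative_transform_within_open[of _ _ _ _ "UNIV - {0}"]) (use xy tau0_T in \<open>auto simp: T_def\<close>)
  with fibre_has_derivative[OF sm_tau0 xU xy(3)]
  have "(\<lambda>v. pd (0, v) tau0 (x, y)) = (\<lambda>v. pd (0, jac x *v v) D.tau0 (\<Phi> x, jac x *v y))"
    by (rule has_derivative_unique)
  from fun_cong[OF this, of "axis i 1"]
  have "DY i tau0 z = pd (0, jac x *v axis i 1) D.tau0 (\<Phi> x, jac x *v y)" by (simp add: DY_def xy)
  also have "\<dots> = (\<Sum>k\<in>UNIV. (jac x *v axis i 1) $ k * DY k D.tau0 (\<Phi> x, jac x *v y))"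
    using pd_pair[OF D.sm_diff[OF D.sm_tau0 TO], of 0] by simp
  finally show ?thesis by (simp add: matrix_vector_mult_basis column_def xy T_def)
qed

text \<open>The torsion and the metric both pull back through \<open>B\<close>; hence raising the
  index commutes with the Jacobian (\<open>B *v uc = ud\<close>), and the pairing of the covector
  with its raised vector is unchanged.\<close>

lemma phi0_T: assumes z: "z \<in> OmW" shows "phi0 z = D.phi0 (T z)"
proof -
  have x: "fst z \<in> W" and zO: "z \<in> Om" using z OmW_Om by auto
  define B where "B = jac (fst z)"
  define Ic where "Ic = (\<chi> i. DY i tau0 z)"
  define Id where "Id = (\<chi> i. DY i D.tau0 (T z))"
  define uc where "uc = raise (\<lambda>i. DY i tau0 z) z"
  define ud where "ud = D.raise (\<lambda>i. DY i D.tau0 (T z)) (T z)"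
  have TO: "T z \<in> D.Om" by (rule T_Om[OF z])
  have Icd: "Ic = transpose B *v Id"
    unfolding Ic_def Id_def B_def using DY_tau0_T[OF z] by (simp add: vec_eq_iff matrix_vector_mult_def transpose_def)
  have c: "gm z *v uc = Ic"
    using lower_raise[OF zO, of _ "\<lambda>i. DY i tau0 z"] by (simp add: vec_eq_iff matrix_vector_mult_def Ic_def uc_def)
  have d: "D.gm (T z) *v ud = Id"
    using D.lower_raise[OF TO, of _ "\<lambda>i. DY i D.tau0 (T z)"] by (simp add: vec_eq_iff matrix_vector_mult_def Id_def ud_def)
  have "transpose B *v (D.gm (T z) *v (B *v uc)) = transpose B *v (D.gm (T z) *v ud)"
    using c unfolding d Icd gm_T[OF z] B_def[symmetric] by (simp only: matrix_vector_mul_assoc matrix_mul_assoc)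
  then have "matrix_inv (D.gm (T z)) *v (matrix_inv (transpose B) *v (transpose B *v (D.gm (T z) *v (B *v uc))))
      = matrix_inv (D.gm (T z)) *v (matrix_inv (transpose B) *v (transpose B *v (D.gm (T z) *v ud)))" by simp
  moreover have "matrix_inv (transpose B) *v (transpose B *v v) = v" for v
    unfolding B_def by (simp only: matrix_vector_mul_assoc matrix_inv_left[OF transpose_invertible[OF jac_invertible[OF x]]] matrix_vector_mul_lid)
  moreover have "matrix_inv (D.gm (T z)) *v (D.gm (T z) *v v) = v" for v
    using matrix_inv_left[OF D.gm_invertible[OF TO]] by (simp add: matrix_vector_mul_assoc)
  ultimately have Bu: "B *v uc = ud" by simp
  have "ip (\<lambda>i. DY i tau0 z) (\<lambda>i. DY i tau0 z) z = Ic \<bullet> uc"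
    unfolding ip_raise by (simp add: inner_vec_def Ic_def uc_def)
  also have "\<dots> = Id \<bullet> (B *v uc)" unfolding Icd by (simp add: dot_lmul_matrix flip: vector_transpose_matrix)
  also have "\<dots> = D.ip (\<lambda>i. DY i D.tau0 (T z)) (\<lambda>i. DY i D.tau0 (T z)) (T z)"
    unfolding D.ip_raise Bu by (simp add: inner_vec_def Id_def ud_def)
  finally show ?thesis unfolding phi0_def D.phi0_def L_T[OF z] by simp
qed

lemma GG_phi0_T: assumes z: "z \<in> OmW" shows "GG phi0 z = D.GG D.phi0 (T z)"
proof -
  have "GG phi0 z = GG (\<lambda>z. D.phi0 (T z)) z"
    unfolding GG_def DX_def DY_def using pd_cong_open[OF open_OmW z, of phi0 "\<lambda>z. D.phi0 (T z)"] phi0_T by simp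
  then show ?thesis using GG_T[OF z D.sm_phi0] by simp
qed

end

section \<open>Homogeneous spaces\<close>

text \<open>The form in which homogeneity enters the maximum arguments: the same values occur over
  every base point. They have to be attained jointly at one \<open>y0\<close>, because
  \<open>GG phi / F + e * phi\<close> combines several of them.\<close>

locale finsler_trans = finsler_chart +
  assumes trans: "x1 \<in> snd c ` fst c \<Longrightarrow> x0 \<in> snd c ` fst c \<Longrightarrow> y1 \<noteq> 0 \<Longrightarrow>
    \<exists>y0. y0 \<noteq> 0 \<and> Floc F c (x0, y0) = Floc F c (x1, y1) \<and> tauB (x0, y0) = tauB (x1, y1)
      \<and> phi0 (x0, y0) = phi0 (x1, y1) \<and> GG phi0 (x0, y0) = GG phi0 (x1, y1)"
begin

text \<open>Degree 0 reduces the fibre to a compact sphere, and invariance makes the fibrewise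
  maximum a maximum over the open set \<open>Om\<close>. The whole differential vanishes there, in
  particular its value on the spray.\<close>

lemma fibre_max:
  assumes d: "\<And>z. z \<in> Om \<Longrightarrow> h differentiable (at z)" and hom: "hom 0 h"
    and inv: "\<And>x1 x0 y1. x1 \<in> U \<Longrightarrow> x0 \<in> U \<Longrightarrow> y1 \<noteq> 0 \<Longrightarrow> \<exists>y0. y0 \<noteq> 0 \<and> h (x0, y0) = h (x1, y1)"
    and x0: "x0 \<in> U"
  obtains y0 where "y0 \<noteq> 0" "\<And>z. z \<in> Om \<Longrightarrow> h z \<le> h (x0, y0)" "GG h (x0, y0) = 0"
proof -
  let ?S = "sphere (0::real^'b) 1"
  have cont: "continuous_on Om h"
    using d by (intro continuous_at_imp_continuous_on ballI) (simp add: differentiable_imp_continuous_within)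
  have "continuous_on ?S (\<lambda>y. h (x0, y))"
    by (rule continuous_on_compose2[OF cont]) (use x0 in \<open>auto intro!: continuous_intros\<close>)
  moreover have "?S \<noteq> {}" using vector_choose_size[of 1] by (auto simp: dist_norm)
  ultimately obtain y0 where y0: "y0 \<in> ?S" "\<And>y. y \<in> ?S \<Longrightarrow> h (x0, y) \<le> h (x0, y0)"
    using continuous_attains_sup[of ?S "\<lambda>y. h (x0, y)"] by auto
  have y0n: "y0 \<noteq> 0" using y0(1) by auto
  have fib: "h (x0, y) \<le> h (x0, y0)" if y: "y \<noteq> 0" for y
  proof -
    have "h (x0, inverse (norm y) *\<^sub>R y) = h (x0, y)" using homD[OF hom x0 y, of "inverse (norm y)"] y by simp
    moreover have "inverse (norm y) *\<^sub>R y \<in> ?S" using y by simp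
    ultimately show ?thesis using y0(2) by metis
  qed
  have max: "h z \<le> h (x0, y0)" if z: "z \<in> Om" for z
  proof -
    obtain x1 y1 where "z = (x1, y1)" "x1 \<in> U" "y1 \<noteq> 0" using z by auto
    then show ?thesis using inv[of x1 x0 y1] fib x0 by metis
  qed
  have z0: "(x0, y0) \<in> Om" using x0 y0n by auto
  have "(\<lambda>v. pd v h (x0, y0)) = (\<lambda>v. 0)"
    by (rule differential_zero_maxmin[OF z0 open_Om pd_has_derivative[OF d[OF z0]]]) (use max in auto)
  then have "GG h (x0, y0) = 0" unfolding GG_pd[OF d[OF z0]] by metis
  then show ?thesis using that y0n max by blast
qed

lemma hom_tauB: "hom 0 tauB"
  using hom_tau0 unfolding hom_def tauB_def by auto

text \<open>Isotropy lets a single direction decide: \<open>S\<close> vanishes at the maximum of the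
  distortion over \<open>x\<close>, and \<open>F > 0\<close> there forces
  \<open>k x = 0\<close>.\<close>

lemma S_zero:
  assumes S: "\<And>x y. x \<in> U \<Longrightarrow> y \<noteq> 0 \<Longrightarrow> Scurv F c (x, y) = k x * Floc F c (x, y)"
    and x: "x \<in> U" and y: "y \<noteq> 0"
  shows "Scurv F c (x, y) = 0"
proof -
  obtain y0 where y0: "y0 \<noteq> 0" "GG tauB (x, y0) = 0"
  proof (rule fibre_max[OF GG_Scurv(1) hom_tauB _ x])
    show "\<exists>y0. y0 \<noteq> 0 \<and> tauB (x0, y0) = tauB (x1, y1)" if "x1 \<in> U" "x0 \<in> U" "y1 \<noteq> 0" for x1 x0 y1
      using trans[OF that] by blast
  qed auto
  have z: "(x, y0) \<in> Om" using x y0 by auto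
  have "k x * Floc F c (x, y0) = 0" using GG_Scurv(2)[OF z] y0 S[OF x y0(1)] by simp
  then have "k x = 0" using F_pos[OF z] by simp
  then show ?thesis using S[OF x y] by simp
qed

end

section \<open>Smoothness of the density from the vanishing of the S-curvature\<close>

lemma smooth_on_from_pd:
  assumes S: "open S" and d: "\<And>x. x \<in> S \<Longrightarrow> f differentiable (at x)"
    and p: "\<And>b. b \<in> Basis \<Longrightarrow> smooth_on S (pd b f)"
  shows "smooth_on S f"
proof (rule smooth_coinduct[OF S, where P="\<lambda>h. h = f \<or> smooth_on S h"])
  show "h differentiable (at x)" if "h = f \<or> smooth_on S h" "x \<in> S" for h x
    using that d smooth_on_imp_differentiable[OF _ S] by blast
  show "\<exists>g. (g = f \<or> smooth_on S g) \<and> (\<forall>x\<in>S. pd b h x = g x)" if "h = f \<or> smooth_on S h" "b \<in> Basis" for h b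
    using that p smooth_on_pd by blast
qed simp

context finsler_chart
begin

lemma smooth_map_const_snd: "smooth_map_on U (\<lambda>x. (x, y :: real^'n))"
  unfolding smooth_map_on_def
proof
  fix b :: "(real^'n) \<times> (real^'n)"
  have "(\<lambda>x. (x, y) \<bullet> b) = (\<lambda>x. x \<bullet> fst b + y \<bullet> snd b)" by (cases b) auto
  moreover have "smooth_on U (\<lambda>x. x \<bullet> fst b + y \<bullet> snd b)"
    by (intro smooth_on_add smooth_on_const open_U smooth_on_bounded_linear bounded_linear_inner_left)
  ultimately show "smooth_on U (\<lambda>x. (x, y) \<bullet> b)" by simp
qed

text \<open>A regularity bootstrap. The density is so far only differentiable, but
  \<open>S = 0\<close> at the constant vector \<open>axis i 1\<close> equates its
  \<open>i\<close>-th logarithmic derivative with the trace of \<open>N\<close> at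
  \<open>(x, axis i 1)\<close>, a smooth function of \<open>x\<close>.\<close>

lemma finsler_S0I:
  assumes S: "\<And>x y. x \<in> U \<Longrightarrow> y \<noteq> 0 \<Longrightarrow> Scurv F c (x, y) = 0"
  shows "finsler_S0 F c (\<lambda>x. ln (sigmaBH F c x))"
proof unfold_locales
  let ?ls = "\<lambda>x. ln (sigmaBH F c x)"
  show eq: "(\<Sum>i\<in>UNIV. DY i (spray F c i) (x, y)) = (\<Sum>i\<in>UNIV. y $ i * pd (axis i 1) ?ls x)" if "x \<in> U" "y \<noteq> 0" for x y
    using S[OF that] unfolding Scurv_def by simp
  show "smooth_on U ?ls"
  proof (rule smooth_on_from_pd[OF open_U ln_sigma_differentiable])
    fix b :: "real^'n" assume "b \<in> Basis"
    then obtain i where b: "b = axis i 1" by (auto simp: Basis_vec_def)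
    have ax: "axis i (1::real) \<noteq> (0::real^'n)" by (simp add: axis_eq_0_iff)
    have "sm (\<lambda>z. \<Sum>k\<in>UNIV. N k k z)" by (intro smooth_on_sum open_Om sm_DY sm_G)
    from smooth_on_compose[OF open_U open_Om smooth_map_const_snd _ this, of "axis i 1"] ax
    have "smooth_on U (\<lambda>x. \<Sum>k\<in>UNIV. N k k (x, axis i 1))" by simp
    moreover have "(\<Sum>k\<in>UNIV. N k k (x, axis i 1)) = pd b ?ls x" if "x \<in> U" for x
    proof -
      have "(\<Sum>k\<in>UNIV. axis i 1 $ k * pd (axis k 1) ?ls x) = (\<Sum>k\<in>UNIV. (if k = i then 1 else 0) * pd (axis k 1) ?ls x)"
        by (intro sum.cong refl) (simp add: axis_def)
      then show ?thesis using eq[OF that ax] unfolding b if_sum_left by simp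
    qed
    ultimately show "smooth_on U (pd b ?ls)" by (rule smooth_on_cong[OF open_U])
  qed
qed

end

section \<open>The maximum principle along the spray\<close>

locale finsler_core = finsler_S0 + finsler_trans +
  assumes K: "x \<in> snd c ` fst c \<Longrightarrow> y \<noteq> 0 \<Longrightarrow> u \<notin> span {y} \<Longrightarrow> flag_curv F c x y u \<le> 0"
begin

lemma phi_phi0: "z \<in> Om \<Longrightarrow> phi z = phi0 z"
  by (simp add: phi_def phi0_def DY_tau)

lemma GG_phi_phi0: "z \<in> Om \<Longrightarrow> GG phi z = GG phi0 z"
  by (rule GG_cong) (use phi_phi0 in auto)

lemma ip_I_RI_nonpos: assumes z: "z \<in> Om" shows "ip (\<lambda>i. I i z) (\<lambda>i. RI i z) z \<le> 0"
proof (rule ip_I_RI_le[OF z])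
  show "flag_curv F c (fst z) (snd z) u \<le> 0" if "u \<notin> span {snd z}" for u
    by (rule K[OF _ _ that]) (use z in auto)
qed

lemma GG_GG_phi_nonneg: assumes z: "z \<in> Om" shows "GG (GG phi) z \<ge> 0"
proof -
  have "ip (\<lambda>i. I i z) (\<lambda>i. RI i z) z \<le> 0" by (rule ip_I_RI_nonpos[OF z])
  then have "0 \<le> ip (\<lambda>i. J i z) (\<lambda>i. J i z) z - ip (\<lambda>i. I i z) (\<lambda>i. RI i z) z"
    using ip_nonneg[OF z, of "\<lambda>i. J i z"] by linarith
  then show ?thesis unfolding GG_GG_phi[OF z] using L_pos[OF z] by simp
qed

lemma GG_F: assumes z: "z \<in> Om" shows "GG (Floc F c) z = 0"
proof -
  have "GG L z = GG (\<lambda>z. Floc F c z * Floc F c z) z" by (rule GG_cong) (use z in \<open>auto simp: Lsq_def power2_eq_square\<close>)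
  then show ?thesis using GG_mult[OF F_smooth F_smooth z] GG_L[OF z] F_pos[OF z] by simp
qed

lemma sm_invF: "sm (\<lambda>z. inverse (Floc F c z))"
  by (intro smooth_on_inverse open_Om F_smooth) (use F_pos in \<open>force+\<close>)

lemma GG_invF: assumes z: "z \<in> Om" shows "GG (\<lambda>z. inverse (Floc F c z)) z = 0"
  using GG_F[OF z] pd_inverse[OF sm_diff[OF F_smooth z]] F_pos[OF z]
  by (simp add: GG_pd sm_diff[OF F_smooth z] sm_diff[OF sm_invF z])

text \<open>At a maximum of \<open>s (GG phi) / F + e phi\<close> its derivative along the spray vanishes, and there the
  convexity \<open>GG (GG phi) \<ge> 0\<close> forces \<open>s (GG phi) \<le> 0\<close>; now let \<open>e\<close> tend to \<open>0\<close>.\<close>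

lemma GG_phi_bound:
  assumes s: "s = 1 \<or> s = (-1::real)" and M: "\<And>z. z \<in> Om \<Longrightarrow> phi z \<le> M" and e: "e > 0" and z: "z \<in> Om"
  shows "s * GG phi z * inverse (Floc F c z) \<le> e * M"
proof -
  define h where "h z = s * (GG phi z * inverse (Floc F c z)) + e * phi z" for z
  have smh: "sm h" unfolding h_def[abs_def]
    by (intro smooth_on_add smooth_on_cmult smooth_on_mult open_Om sm_GG sm_phi sm_invF)
  have homiF: "hom (-1) (\<lambda>z. inverse (Floc F c z))"
    unfolding hom_def using F_hom by (auto simp: powr_minus)
  have "hom 0 (\<lambda>z. GG phi z * inverse (Floc F c z))" using hom_mult[OF hom_GG[OF sm_phi hom_phi] homiF] by simp
  then have homh: "hom 0 h" unfolding h_def using hom_phi unfolding hom_def by simp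
  have x: "fst z \<in> U" using z by auto
  obtain y0 where y0: "y0 \<noteq> 0" "\<And>w. w \<in> Om \<Longrightarrow> h w \<le> h (fst z, y0)" "GG h (fst z, y0) = 0"
  proof (rule fibre_max[OF sm_diff[OF smh] homh _ x])
    fix x1 x0 y1 assume a: "x1 \<in> U" "x0 \<in> U" "y1 \<noteq> (0::real^'b)"
    then obtain y0 where "y0 \<noteq> 0" "Floc F c (x0, y0) = Floc F c (x1, y1)"
      "phi0 (x0, y0) = phi0 (x1, y1)" "GG phi0 (x0, y0) = GG phi0 (x1, y1)" using trans by metis
    then show "\<exists>y0. y0 \<noteq> 0 \<and> h (x0, y0) = h (x1, y1)"
      using a unfolding h_def by (intro exI[of _ y0]) (auto simp: phi_phi0 GG_phi_phi0)
  qed auto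
  let ?z = "(fst z, y0)"
  have z0: "?z \<in> Om" using x y0(1) by auto
  have "GG h ?z = s * (GG (GG phi) ?z * inverse (Floc F c ?z)) + e * GG phi ?z"
  proof -
    have "GG h ?z = GG (\<lambda>z. s * (GG phi z * inverse (Floc F c z))) ?z + GG (\<lambda>z. e * phi z) ?z"
      unfolding h_def[abs_def]
      by (subst (1 2 3) GG_pd; (intro sm_diff[OF _ z0] smooth_on_add smooth_on_cmult smooth_on_mult open_Om sm_GG sm_phi sm_invF)?)
         (intro pd_add sm_diff[OF _ z0] smooth_on_cmult smooth_on_mult open_Om sm_GG sm_phi sm_invF)
    also have "GG (\<lambda>z. s * (GG phi z * inverse (Floc F c z))) ?z = s * GG (\<lambda>z. GG phi z * inverse (Floc F c z)) ?z"
      by (rule GG_cmult[OF _ z0]) (intro smooth_on_mult open_Om sm_GG sm_phi sm_invF)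
    also have "GG (\<lambda>z. GG phi z * inverse (Floc F c z)) ?z = GG (GG phi) ?z * inverse (Floc F c ?z)"
      using GG_mult[OF sm_GG[OF sm_phi] sm_invF z0] GG_invF[OF z0] by simp
    also have "GG (\<lambda>z. e * phi z) ?z = e * GG phi ?z" by (rule GG_cmult[OF sm_phi z0])
    finally show ?thesis .
  qed
  then have eq: "s * (GG (GG phi) ?z * inverse (Floc F c ?z)) + e * GG phi ?z = 0" using y0(3) by simp
  have nn: "GG (GG phi) ?z * inverse (Floc F c ?z) \<ge> 0"
    using GG_GG_phi_nonneg[OF z0] F_pos[OF z0] by simp
  \<comment> \<open>The critical point equation multiplied by \<open>s\<close>, with
    \<open>s * s = 1\<close>.\<close>
  have "e * (s * GG phi ?z) = - (GG (GG phi) ?z * inverse (Floc F c ?z))"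
    using eq s by auto
  then have "e * (s * GG phi ?z) \<le> 0" using nn by simp
  then have "s * GG phi ?z \<le> 0" using e by (simp add: mult_le_0_iff)
  then have "(s * GG phi ?z) * inverse (Floc F c ?z) \<le> 0" using F_pos[OF z0] mult_nonpos_nonneg[of "s * GG phi ?z" "inverse (Floc F c ?z)"] by simp
  then have hz: "h ?z \<le> e * M" using M[OF z0] e unfolding h_def by (smt (verit) mult.assoc mult_left_mono)
  have "phi z \<ge> 0" unfolding phi_def using L_pos[OF z] ip_nonneg[OF z] by (simp add: less_imp_le)
  then have "s * GG phi z * inverse (Floc F c z) \<le> h z" unfolding h_def using e by simp
  also have "\<dots> \<le> h ?z" using y0(2) z by blast
  finally show ?thesis using hz by linarith
qed

lemma GG_phi_zero: assumes z: "z \<in> Om" shows "GG phi z = 0"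
proof -
  have x: "fst z \<in> U" using z by auto
  obtain y0 where y0: "\<And>z'. z' \<in> Om \<Longrightarrow> phi z' \<le> phi (fst z, y0)"
  proof (rule fibre_max[OF sm_diff[OF sm_phi] hom_phi _ x])
    fix x1 x0 y1 assume a: "x1 \<in> U" "x0 \<in> U" "y1 \<noteq> (0::real^'b)"
    then obtain y0 where "y0 \<noteq> 0" "phi0 (x0, y0) = phi0 (x1, y1)" using trans by metis
    then show "\<exists>y0. y0 \<noteq> 0 \<and> phi (x0, y0) = phi (x1, y1)"
      using a by (intro exI[of _ y0]) (auto simp: phi_phi0)
  qed auto
  define M where "M = phi (fst z, y0)"
  have "s * GG phi z * inverse (Floc F c z) \<le> 0" if s: "s = 1 \<or> s = (-1::real)" for s
  proof (rule field_le_epsilon)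
    fix e :: real assume e: "e > 0"
    have "s * GG phi z * inverse (Floc F c z) \<le> e / (\<bar>M\<bar> + 1) * M"
      by (rule GG_phi_bound[OF s _ _ z]) (use y0 e in \<open>auto simp: M_def add_nonneg_pos\<close>)
    also have "\<dots> \<le> e / (\<bar>M\<bar> + 1) * (\<bar>M\<bar> + 1)" using e by (intro mult_left_mono) auto
    also have "\<dots> = 0 + e" by (simp add: add_nonneg_eq_0_iff)
    finally show "s * GG phi z * inverse (Floc F c z) \<le> 0 + e" .
  qed
  from this[of 1] this[of "-1"] have "GG phi z * inverse (Floc F c z) = 0" by simp
  then show ?thesis using F_pos[OF z] by simp
qed

lemma J_zero: assumes z: "z \<in> Om" shows "J i z = 0" "ip (\<lambda>i. I i z) (\<lambda>i. RI i z) z = 0"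
proof -
  have "GG (GG phi) z = GG (\<lambda>_. 0) z" by (rule GG_cong) (use GG_phi_zero z in auto)
  also have "\<dots> = 0" by (simp add: GG_def DX_def DY_def)
  finally have "ip (\<lambda>i. J i z) (\<lambda>i. J i z) z = ip (\<lambda>i. I i z) (\<lambda>i. RI i z) z"
    unfolding GG_GG_phi[OF z] using L_pos[OF z] by simp
  moreover have "ip (\<lambda>i. I i z) (\<lambda>i. RI i z) z \<le> 0" by (rule ip_I_RI_nonpos[OF z])
  ultimately have "ip (\<lambda>i. J i z) (\<lambda>i. J i z) z = 0" and "ip (\<lambda>i. I i z) (\<lambda>i. RI i z) z = 0"
    using ip_nonneg[OF z, of "\<lambda>i. J i z"] by linarith+
  then show "J i z = 0" "ip (\<lambda>i. I i z) (\<lambda>i. RI i z) z = 0" using ip_eq_0[OF z] by blast+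
qed

lemma DX_tau_N: assumes z: "z \<in> Om" shows "DX i tau z = (\<Sum>j\<in>UNIV. N i j z * I j z)"
  using J_zero(1)[OF z, of i] unfolding J_def by simp

lemma I_zero:
  assumes K': "\<And>x y u. x \<in> U \<Longrightarrow> y \<noteq> 0 \<Longrightarrow> u \<notin> span {y} \<Longrightarrow> flag_curv F c x y u < 0" and z: "z \<in> Om"
  shows "DY k tau0 z = 0"
proof (rule ccontr)
  assume "DY k tau0 z \<noteq> 0"
  then have k: "I k z \<noteq> 0" using DY_tau[OF z] by simp
  have "ip (\<lambda>i. I i z) (\<lambda>i. RI i z) z < 0"
  proof (rule ip_I_RI_lt[OF z _ k])
    show "flag_curv F c (fst z) (snd z) u < 0" if "u \<notin> span {snd z}" for u
      by (rule K'[OF _ _ that]) (use z in auto)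
  qed
  then show False using J_zero(2)[OF z] by simp
qed

end

section \<open>Charts of a homogeneous Finsler space\<close>

lemma chart_cinv:
  assumes "is_chart c" "x \<in> snd c ` fst c"
  shows "cinv c x \<in> fst c" "snd c (cinv c x) = x"
  using assms unfolding cinv_def by (auto intro: inv_into_into f_inv_into_f)

lemma chart_inj: "is_chart c \<Longrightarrow> inj_on (snd c) (fst c)"
  unfolding is_chart_def homeomorphism_def by (metis inj_on_inverseI)

lemma cinv_chart: "is_chart c \<Longrightarrow> p \<in> fst c \<Longrightarrow> cinv c (snd c p) = p"
  using chart_inj[of c] unfolding cinv_def by simp

lemma chart_open_image:
  assumes "is_chart c" "open V" "V \<subseteq> fst c" shows "open (snd c ` V)"
proof -
  have h: "homeomorphism (fst c) (snd c ` fst c) (snd c) (inv_into (fst c) (snd c))" "open (snd c ` fst c)"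
    using assms(1) unfolding is_chart_def by auto
  have "openin (top_of_set (fst c)) V" using assms(2,3) open_subset by blast
  then have "openin (top_of_set (snd c ` fst c)) (snd c ` V)" by (rule homeomorphism_imp_open_map[OF h(1)])
  then show ?thesis using h(2) openin_open_trans by blast
qed

lemma finsler_finsler_chart:
  assumes "finsler A F" "c \<in> A" shows "finsler_chart F c"
proof -
  have c: "is_chart c" using assms unfolding finsler_def smooth_atlas_def by blast
  show ?thesis
  proof
    show "open (snd c ` fst c)" using c unfolding is_chart_def by blast
    show "Floc F c (x, y) \<ge> 0" if "x \<in> snd c ` fst c" for x y
      using assms chart_cinv[OF c that] unfolding finsler_def Floc_def by simp
    show "Floc F c (x, t *\<^sub>R y) = t * Floc F c (x, y)" if "x \<in> snd c ` fst c" "t > 0" for x t y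
      using assms chart_cinv[OF c that(1)] that(2) unfolding finsler_def Floc_def by simp
    show "smooth_on (snd c ` fst c \<times> (UNIV - {0})) (Floc F c)" using assms unfolding finsler_def by blast
    show "gform F c (x, y) v v > 0" if "x \<in> snd c ` fst c" "y \<noteq> 0" "v \<noteq> 0" for x y v
      using assms that unfolding finsler_def by blast
  qed
qed

lemma homogeneous_isometry:
  assumes fin: "finsler A F" and hom: "homogeneous A F" and cd: "c \<in> A" "d \<in> A"
    and x1: "x1 \<in> snd c ` fst c" and x0: "x0 \<in> snd d ` fst d"
  obtains \<Phi> W where "finsler_isometry F c d \<Phi> W" "x1 \<in> W" "\<Phi> x1 = x0"
proof -
  have ch: "is_chart c" "is_chart d" using fin cd unfolding finsler_def smooth_atlas_def by auto
  obtain \<psi> where \<psi>: "isometry A F \<psi>" "\<psi> (cinv c x1) = cinv d x0" using hom unfolding homogeneous_def by blast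
  define \<Phi> where "\<Phi> = snd d \<circ> \<psi> \<circ> cinv c"
  define V where "V = fst c \<inter> \<psi> -` fst d"
  define W where "W = snd c ` V"
  have dif: "diffeo A \<psi>" and iso: "\<And>p y. p \<in> fst c \<Longrightarrow> \<psi> p \<in> fst d \<Longrightarrow>
      F d (\<psi> p) (frechet_derivative \<Phi> (at (snd c p)) y) = F c p y"
    using \<psi>(1) cd unfolding isometry_def \<Phi>_def by auto
  have "open V" unfolding V_def
    using dif ch unfolding diffeo_def is_chart_def by (intro open_Int open_vimage) auto
  then have oW: "open W" unfolding W_def using chart_open_image[OF ch(1)] by (auto simp: V_def)
  have inW: "cinv c x \<in> fst c" "\<psi> (cinv c x) \<in> fst d" "snd c (cinv c x) = x" if "x \<in> W" for x
    using that cinv_chart[OF ch(1)] unfolding W_def V_def by auto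
  interpret C: finsler_chart F c using finsler_finsler_chart[OF fin cd(1)] .
  interpret D: finsler_chart F d using finsler_finsler_chart[OF fin cd(2)] .
  have "finsler_isometry F c d \<Phi> W"
  proof
    show "open W" by (rule oW)
    show "W \<subseteq> snd c ` fst c" by (auto simp: W_def V_def)
    show "smooth_map_on W \<Phi>" using dif cd unfolding diffeo_def W_def V_def \<Phi>_def by blast
    show "\<Phi> x \<in> snd d ` fst d" if "x \<in> W" for x using inW[OF that] by (auto simp: \<Phi>_def)
    show "Floc F d (\<Phi> x, frechet_derivative \<Phi> (at x) y) = Floc F c (x, y)" if "x \<in> W" for x y
      using iso[of "cinv c x" y] inW[OF that] cinv_chart[OF ch(2)] by (simp add: Floc_def \<Phi>_def)
  qed
  moreover have "x1 \<in> W"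
    using chart_cinv[OF ch(1) x1] chart_cinv[OF ch(2) x0] \<psi>(2) unfolding W_def V_def by force
  moreover have "\<Phi> x1 = x0" using \<psi>(2) chart_cinv[OF ch(2) x0] by (simp add: \<Phi>_def)
  ultimately show ?thesis using that by blast
qed

lemma homogeneous_finsler_trans:
  assumes fin: "finsler A F" and hom: "homogeneous A F" and c: "c \<in> A"
  shows "finsler_trans F c"
proof -
  interpret C: finsler_chart F c using finsler_finsler_chart[OF fin c] .
  show ?thesis
  proof
    fix x1 x0 y1 assume a: "x1 \<in> snd c ` fst c" "x0 \<in> snd c ` fst c" "y1 \<noteq> (0::real^'b)"
    obtain \<Phi> W where iso: "finsler_isometry F c c \<Phi> W" "x1 \<in> W" "\<Phi> x1 = x0"
      using homogeneous_isometry[OF fin hom c c a(1,2)] .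
    interpret T: finsler_isometry F c c \<Phi> W by (rule iso(1))
    have z: "(x1, y1) \<in> T.OmW" using iso a by auto
    have T: "T.T (x1, y1) = (x0, T.jac x1 *v y1)" using iso(3) by (simp add: T.T_def)
    show "\<exists>y0. y0 \<noteq> 0 \<and> Floc F c (x0, y0) = Floc F c (x1, y1) \<and> C.tauB (x0, y0) = C.tauB (x1, y1)
      \<and> C.phi0 (x0, y0) = C.phi0 (x1, y1) \<and> C.GG C.phi0 (x0, y0) = C.GG C.phi0 (x1, y1)"
      using T.jac_inj[OF iso(2) a(3)] T.F_iso[OF iso(2), of y1] T.tauB_T[OF z] T.phi0_T[OF z] T.GG_phi0_T[OF z] iso(3)
      unfolding T by (intro exI[of _ "T.jac x1 *v y1"]) simp
  qed
qed

section \<open>Surfaces\<close>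

text \<open>The covector \<open>t\<close> is \<open>y\<close> rotated by a right angle and spans the
  annihilator of \<open>y\<close>, and \<open>r\<close> is the inverse of the squared length of
  \<open>y\<close>. For the last claim: a vector killed by \<open>t\<close> is a multiple of
  \<open>y\<close>, so a second covector that does not vanish on \<open>y\<close> can kill it only
  if it is 0.\<close>

lemma two_dim_annihilator:
  fixes y :: "real^'n"
  assumes "CARD('n) = 2" "y \<noteq> 0"
  obtains t :: "'n \<Rightarrow> real" and r :: real where "r \<noteq> 0" "\<exists>i. t i \<noteq> 0" "(\<Sum>i\<in>UNIV. t i * y $ i) = 0"
    "\<And>w i. (\<Sum>i\<in>UNIV. w i * y $ i) = 0 \<Longrightarrow> w i = r * t i * (\<Sum>j\<in>UNIV. t j * w j)"
    "\<And>b l i. (\<Sum>i\<in>UNIV. b i * t i) = 0 \<Longrightarrow> (\<Sum>i\<in>UNIV. b i * l i) = 0 \<Longrightarrow> (\<Sum>i\<in>UNIV. l i * y $ i) \<noteq> 0 \<Longrightarrow> b i = 0"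
proof -
  obtain p q :: 'n where pq: "UNIV = {p, q}" "p \<noteq> q" using assms(1) by (auto simp: card_2_iff)
  have S: "(\<Sum>i\<in>UNIV. f i) = f p + f q" for f :: "'n \<Rightarrow> real" using pq(2) by (subst pq(1)) simp
  have cases: "i = p \<or> i = q" for i using pq(1) by blast
  define t where "t i = (if i = p then y $ q else - y $ p)" for i
  define s where "s = y $ p * y $ p + y $ q * y $ q"
  have yn: "y $ p \<noteq> 0 \<or> y $ q \<noteq> 0"
  proof (rule ccontr)
    assume "\<not> ?thesis"
    then have "y $ i = 0" for i using cases[of i] by auto
    then show False using assms(2) by (simp add: vec_eq_iff)
  qed
  then have s: "s \<noteq> 0" unfolding s_def by (simp add: sum_squares_eq_zero_iff)
  have "t p \<noteq> 0 \<or> t q \<noteq> 0" using yn pq(2) by (auto simp: t_def)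
  then have s2: "\<exists>i. t i \<noteq> 0" by blast
  show ?thesis
  proof (rule that[of "inverse s" t])
    show "w i = inverse s * t i * (\<Sum>j\<in>UNIV. t j * w j)" if "(\<Sum>i\<in>UNIV. w i * y $ i) = 0" for w i
    proof -
      have w: "w p * y $ p = - (w q * y $ q)" using that unfolding S by simp
      have "s * w i = t i * (\<Sum>j\<in>UNIV. t j * w j)"
      proof (cases "i = p")
        case True
        have "s * w p = (w p * y $ p) * y $ p + w p * y $ q * y $ q" by (simp add: s_def algebra_simps)
        also have "\<dots> = y $ q * (y $ q * w p + - y $ p * w q)" unfolding w by (simp add: algebra_simps)
        finally show ?thesis using True pq(2) unfolding S t_def by simp
      next
        case False
        then have "i = q" using cases by blast
        have "s * w q = (w q * y $ q) * y $ q + w q * y $ p * y $ p" by (simp add: s_def algebra_simps)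
        also have "\<dots> = - (w p * y $ p) * y $ q + w q * y $ p * y $ p" unfolding w by simp
        also have "\<dots> = - y $ p * (y $ q * w p + - y $ p * w q)" by (simp add: algebra_simps)
        finally show ?thesis using \<open>i = q\<close> pq(2) unfolding S t_def by simp
      qed
      then show ?thesis using s by (simp add: field_simps)
    qed
  next
    fix b l :: "'n \<Rightarrow> real" and i
    assume a: "(\<Sum>i\<in>UNIV. b i * t i) = 0" "(\<Sum>i\<in>UNIV. b i * l i) = 0" "(\<Sum>i\<in>UNIV. l i * y $ i) \<noteq> 0"
    have 1: "b p * y $ q = b q * y $ p" using a(1) pq(2) unfolding S t_def by simp
    have 2: "b p * l p + b q * l q = 0" and 3: "l p * y $ p + l q * y $ q \<noteq> 0" using a(2,3) unfolding S by auto
    have "(l p * y $ p + l q * y $ q) * b p = y $ p * (b p * l p) + l q * (b p * y $ q)" by (simp add: algebra_simps)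
    also have "\<dots> = y $ p * (b p * l p + b q * l q)" unfolding 1 by (simp add: algebra_simps)
    finally have bp: "b p = 0" using 2 3 by simp
    have "(l p * y $ p + l q * y $ q) * b q = l p * (b q * y $ p) + y $ q * (b q * l q)" by (simp add: algebra_simps)
    also have "\<dots> = y $ q * (b p * l p + b q * l q)" unfolding 1[symmetric] by (simp add: algebra_simps)
    finally have bq: "b q = 0" using 2 3 by simp
    show "b i = 0" using bp bq cases[of i] by auto
  next
    show "(\<Sum>i\<in>UNIV. t i * y $ i) = 0" using pq(2) by (simp add: S t_def)
  qed (use s s2 in auto)
qed

section \<open>The Berwald connection of a surface\<close>

context finsler_core
begin

text \<open>Coefficients of the Berwald connection, the lower indices coming first and the upper one
  last.\<close>

definition Gam :: "'b \<Rightarrow> 'b \<Rightarrow> 'b \<Rightarrow> (real^'b) \<times> (real^'b) \<Rightarrow> real" where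
  "Gam l i k = DY i (N l k)"

lemma sm_N: "sm (N l k)" by (intro sm_DY sm_G)

lemma sm_Gam: "sm (Gam l i k)" unfolding Gam_def by (intro sm_DY sm_G)

lemma Gam_sym: "z \<in> Om \<Longrightarrow> Gam l i k z = Gam i l k z"
  unfolding Gam_def by (rule DYY[OF sm_G])

lemma DY_mult: "sm f \<Longrightarrow> sm h \<Longrightarrow> z \<in> Om \<Longrightarrow> DY i (\<lambda>z. f z * h z) z = DY i f z * h z + f z * DY i h z"
  unfolding DY_def by (rule pd_mult) (rule sm_diff; assumption)+

lemma DY_sum: "(\<And>k. k \<in> K \<Longrightarrow> sm (f k)) \<Longrightarrow> z \<in> Om \<Longrightarrow> DY i (\<lambda>z. \<Sum>k\<in>K. f k z) z = (\<Sum>k\<in>K. DY i (f k) z)"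
  unfolding DY_def by (rule pd_sum) (rule sm_diff; assumption?; blast)

text \<open>The vertical derivative of horizontal constancy. It says that the fibre differential of
  such a function is horizontally parallel for \<open>Gam\<close>; \<open>L\<close> and
  \<open>tau\<close> are the cases of interest.\<close>

lemma horizontal_DY:
  assumes h: "sm h" and hor: "\<And>z. z \<in> Om \<Longrightarrow> DX l h z = (\<Sum>k\<in>UNIV. N l k z * DY k h z)" and z: "z \<in> Om"
  shows "DX l (DY i h) z = (\<Sum>k\<in>UNIV. Gam l i k z * DY k h z) + (\<Sum>k\<in>UNIV. N l k z * DY k (DY i h) z)"
proof -
  have "DX l (DY i h) z = DY i (DX l h) z" by (rule DXY[OF h z])
  also have "\<dots> = DY i (\<lambda>z. \<Sum>k\<in>UNIV. N l k z * DY k h z) z" by (rule DY_cong[OF hor z])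
  also have "\<dots> = (\<Sum>k\<in>UNIV. DY i (\<lambda>z. N l k z * DY k h z) z)"
    by (rule DY_sum[OF _ z]) (intro smooth_on_mult open_Om sm_N sm_DY h)
  also have "\<dots> = (\<Sum>k\<in>UNIV. Gam l i k z * DY k h z + N l k z * DY i (DY k h) z)"
    unfolding Gam_def by (intro sum.cong refl DY_mult sm_N sm_DY h z)
  finally show ?thesis unfolding DYY[OF h z, of i] sum.distrib .
qed

text \<open>Two vertical derivatives of \<open>DX_L\<close>. The sum with
  \<open>DY j (Gam l i k)\<close> is, up to a factor, the Landsberg tensor, the obstruction to
  metric compatibility of the Berwald connection.\<close>

lemma DX_g:
  assumes z: "z \<in> Om"
  shows "DX l (g i j) z = 1/2 * (\<Sum>k\<in>UNIV. DY j (Gam l i k) z * DY k L z)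
    + (\<Sum>k\<in>UNIV. Gam l i k z * g k j z) + (\<Sum>k\<in>UNIV. Gam l j k z * g k i z) + (\<Sum>k\<in>UNIV. N l k z * DY k (g i j) z)"
proof -
  have gij: "g i j w = 1/2 * DY j (DY i L) w" if "w \<in> Om" for i j w unfolding gten_def using DYY[OF sm_L that, of i j] by simp
  have pdg: "pd v (g i j) z = 1/2 * pd v (DY j (DY i L)) z" for v i j
  proof -
    have "pd v (g i j) z = pd v (\<lambda>w. 1/2 * DY j (DY i L) w) z" by (rule pd_cong_open[OF open_Om z gij])
    also have "\<dots> = 1/2 * pd v (DY j (DY i L)) z" by (rule pd_cmult) (intro sm_diff[OF _ z] sm_DY sm_L)
    finally show ?thesis .
  qed
  have e1: "2 * g k j z = DY j (DY k L) z" for k using gij[OF z, of k j] by simp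
  have e2: "2 * g k i z = DY k (DY i L) z" for k using gij[OF z, of i k] g_sym[OF z, of i k] by simp
  have e3: "2 * DY k (g i j) z = DY j (DY k (DY i L)) z" for k
    using pdg[of "(0, axis k 1)" i j] DYY[OF sm_DY[OF sm_L] z, of j k i] by (simp add: DY_def[of k])
  have "DX l (DY j (DY i L)) z = DY j (DX l (DY i L)) z" by (rule DXY[OF sm_DY[OF sm_L] z])
  also have "\<dots> = DY j (\<lambda>z. (\<Sum>k\<in>UNIV. Gam l i k z * DY k L z) + (\<Sum>k\<in>UNIV. N l k z * DY k (DY i L) z)) z"
    by (rule DY_cong[OF horizontal_DY[OF sm_L DX_L] z])
  also have "\<dots> = DY j (\<lambda>z. \<Sum>k\<in>UNIV. Gam l i k z * DY k L z) z + DY j (\<lambda>z. \<Sum>k\<in>UNIV. N l k z * DY k (DY i L) z) z"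
    unfolding DY_def[of j] by (rule pd_add) (intro sm_diff[OF _ z] smooth_on_sum smooth_on_mult open_Om sm_Gam sm_N sm_DY sm_L)+
  also have "DY j (\<lambda>z. \<Sum>k\<in>UNIV. Gam l i k z * DY k L z) z = (\<Sum>k\<in>UNIV. DY j (Gam l i k) z * DY k L z + Gam l i k z * DY j (DY k L) z)"
    by (subst DY_sum[OF _ z]) (auto intro!: smooth_on_mult open_Om sm_Gam sm_DY sm_L sum.cong DY_mult z)
  also have "DY j (\<lambda>z. \<Sum>k\<in>UNIV. N l k z * DY k (DY i L) z) z = (\<Sum>k\<in>UNIV. Gam l j k z * DY k (DY i L) z + N l k z * DY j (DY k (DY i L)) z)"
    unfolding Gam_def
    by (subst DY_sum[OF _ z]) (auto intro!: smooth_on_mult open_Om sm_N sm_DY sm_L sum.cong DY_mult z)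
  finally have "DX l (DY j (DY i L)) z = (\<Sum>k\<in>UNIV. DY j (Gam l i k) z * DY k L z) + (\<Sum>k\<in>UNIV. Gam l i k z * (2 * g k j z))
     + (\<Sum>k\<in>UNIV. Gam l j k z * (2 * g k i z)) + (\<Sum>k\<in>UNIV. N l k z * (2 * DY k (g i j) z))"
    unfolding e1 e2 e3 by (simp only: sum.distrib add.assoc)
  then show ?thesis using pdg[of "(axis l 1, 0)" i j] unfolding DX_def by (simp add: sum_distrib_left sum_distrib_right algebra_simps)
qed

text \<open>On each fibre \<open>S0\<close> makes the trace of \<open>N\<close> linear in
  \<open>y\<close>, so its vertical derivative is the constant coefficient.\<close>

lemma trace_Gam:
  assumes z: "z \<in> Om" shows "(\<Sum>k\<in>UNIV. Gam l k k z) = pd (axis l 1) ls (fst z)"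
proof -
  obtain x y where xy: "z = (x, y)" "x \<in> U" "y \<noteq> 0" using z by auto
  define w where "w i = pd (axis i 1) ls x" for i
  have smh: "sm (\<lambda>z. (\<Sum>k\<in>UNIV. N k k z) - (\<Sum>i\<in>UNIV. snd z $ i * w i))"
    by (intro smooth_on_diff smooth_on_sum smooth_on_mult smooth_on_const open_Om sm_N sm_y)
  have "DY l (\<lambda>z. (\<Sum>k\<in>UNIV. N k k z) - (\<Sum>i\<in>UNIV. snd z $ i * w i)) z = 0"
    unfolding xy(1) by (rule fibre_zero_DY[OF smh xy(2) _ xy(3)]) (use S0[OF xy(2)] in \<open>simp add: w_def\<close>)
  moreover have "DY l (\<lambda>z. (\<Sum>k\<in>UNIV. N k k z) - (\<Sum>i\<in>UNIV. snd z $ i * w i)) z = DY l (\<lambda>z. \<Sum>k\<in>UNIV. N k k z) z - DY l (\<lambda>z. \<Sum>i\<in>UNIV. snd z $ i * w i) z"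
    unfolding DY_def[of l] by (rule pd_diff) (intro sm_diff[OF _ z] smooth_on_sum smooth_on_mult smooth_on_const open_Om sm_N sm_y)+
  moreover have "DY l (\<lambda>z. \<Sum>k\<in>UNIV. N k k z) z = (\<Sum>k\<in>UNIV. Gam l k k z)"
    using Gam_sym[OF z] by (subst DY_sum[OF _ z]) (auto intro: sm_N simp: Gam_def)
  moreover have "DY l (\<lambda>z. \<Sum>i\<in>UNIV. snd z $ i * w i) z = (\<Sum>i\<in>UNIV. DY l (\<lambda>z. snd z $ i * w i) z)"
    by (rule DY_sum[OF _ z]) (intro smooth_on_mult smooth_on_const open_Om sm_y)
  moreover have "DY l (\<lambda>z. snd z $ i * w i) z = (if i = l then 1 else 0) * w i" for i
    using DY_mult[OF sm_y smooth_on_const[OF open_Om] z, of l i "w i"] by (simp add: DY_def[of l "\<lambda>_. w i"])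
  ultimately show ?thesis by (simp add: w_def xy)
qed

text \<open>By \<open>trace_Gam\<close> the trace of \<open>Gam\<close> is constant on fibres. This
  is the vanishing of the mean Berwald curvature, the first equation for the vector
  \<open>bk\<close> in \<open>berwald\<close>.\<close>

lemma berwald_trace:
  assumes z: "z \<in> Om" shows "(\<Sum>k\<in>UNIV. DY j (Gam l k k) z) = 0"
proof -
  obtain x y where xy: "z = (x, y)" "x \<in> U" "y \<noteq> 0" using z by auto
  define w where "w = pd (axis l 1) ls x"
  have smh: "sm (\<lambda>z. (\<Sum>k\<in>UNIV. Gam l k k z) - w)"
    by (intro smooth_on_diff smooth_on_sum smooth_on_const open_Om sm_Gam)
  have "DY j (\<lambda>z. (\<Sum>k\<in>UNIV. Gam l k k z) - w) z = 0"
    unfolding xy(1) by (rule fibre_zero_DY[OF smh xy(2) _ xy(3)]) (use trace_Gam xy in \<open>auto simp: w_def\<close>)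
  moreover have "DY j (\<lambda>z. (\<Sum>k\<in>UNIV. Gam l k k z) - w) z = DY j (\<lambda>z. \<Sum>k\<in>UNIV. Gam l k k z) z - DY j (\<lambda>_. w) z"
    unfolding DY_def[of j] by (rule pd_diff) (intro sm_diff[OF _ z] smooth_on_sum smooth_on_const open_Om sm_Gam)+
  moreover have "DY j (\<lambda>z. \<Sum>k\<in>UNIV. Gam l k k z) z = (\<Sum>k\<in>UNIV. DY j (Gam l k k) z)"
    by (rule DY_sum[OF sm_Gam z])
  ultimately show ?thesis by (simp add: DY_def[of j "\<lambda>_. w"])
qed

text \<open>The horizontal derivative of \<open>tau0\<close> is known in two ways, from the metric
  by \<open>DX_g\<close> and from \<open>J = 0\<close>. They differ by the trace of the Landsberg
  tensor, which yields the second equation for \<open>bk\<close>.\<close>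

lemma landsberg_trace:
  assumes z: "z \<in> Om"
  shows "(\<Sum>i\<in>UNIV. \<Sum>j\<in>UNIV. gi i j z * (\<Sum>k\<in>UNIV. DY j (Gam l i k) z * DY k L z)) = 0"
proof -
  let ?B = "\<Sum>i\<in>UNIV. \<Sum>j\<in>UNIV. gi i j z * (\<Sum>k\<in>UNIV. DY j (Gam l i k) z * DY k L z)"
  have "DX l tau0 z = 1/2 * (\<Sum>i\<in>UNIV. \<Sum>j\<in>UNIV. gi i j z * DX l (g i j) z)" by (rule DX_tau0[OF z])
  also have "(\<Sum>i\<in>UNIV. \<Sum>j\<in>UNIV. gi i j z * DX l (g i j) z) = 1/2 * ?B
     + (\<Sum>i\<in>UNIV. \<Sum>j\<in>UNIV. gi i j z * (\<Sum>k\<in>UNIV. Gam l i k z * g k j z))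
     + (\<Sum>i\<in>UNIV. \<Sum>j\<in>UNIV. gi i j z * (\<Sum>k\<in>UNIV. Gam l j k z * g k i z))
     + (\<Sum>i\<in>UNIV. \<Sum>j\<in>UNIV. \<Sum>k\<in>UNIV. N l k z * (gi i j z * DY k (g i j) z))"
    unfolding DX_g[OF z] by (simp add: distrib_left sum.distrib sum_distrib_left mult_ac)
  also have "(\<Sum>i\<in>UNIV. \<Sum>j\<in>UNIV. \<Sum>k\<in>UNIV. N l k z * (gi i j z * DY k (g i j) z)) = 2 * (\<Sum>k\<in>UNIV. N l k z * DY k tau0 z)"
  proof -
    have "(\<Sum>i\<in>UNIV. \<Sum>j\<in>UNIV. \<Sum>k\<in>UNIV. N l k z * (gi i j z * DY k (g i j) z)) = (\<Sum>i\<in>UNIV. \<Sum>k\<in>UNIV. \<Sum>j\<in>UNIV. N l k z * (gi i j z * DY k (g i j) z))"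
      by (intro sum.cong refl sum.swap)
    also have "\<dots> = (\<Sum>k\<in>UNIV. \<Sum>i\<in>UNIV. \<Sum>j\<in>UNIV. N l k z * (gi i j z * DY k (g i j) z))" by (rule sum.swap)
    finally show ?thesis unfolding DY_tau0[OF z] by (simp add: sum_distrib_left)
  qed
  finally have "DX l tau0 z = 1/4 * ?B + (\<Sum>k\<in>UNIV. Gam l k k z) + (\<Sum>k\<in>UNIV. N l k z * DY k tau0 z)"
    unfolding gi_N_g[OF z] by simp
  moreover have "DX l tau0 z = (\<Sum>k\<in>UNIV. Gam l k k z) + (\<Sum>k\<in>UNIV. N l k z * DY k tau0 z)"
    using DX_tau[OF z, of l] DX_tau_N[OF z, of l] DY_tau[OF z] trace_Gam[OF z, of l] by simp
  ultimately show ?thesis by simp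
qed

lemma hom_Gam: "hom 0 (Gam l i k)"
  unfolding Gam_def using hom_DY[OF sm_N hom_N] by simp

lemma DY_Gam_sym: assumes z: "z \<in> Om"
  shows "DY j (Gam l i k) z = DY j (Gam i l k) z" "DY j (Gam l i k) z = DY i (Gam l j k) z"
  by (rule DY_cong[OF Gam_sym z]) (auto simp: Gam_def DYY[OF sm_N z, of j i])

text \<open>The tensor \<open>B\<close> is symmetric in its lower indices and kills the flagpole, so
  in dimension 2 it is a vector \<open>bk\<close> times the cube of the annihilating covector
  \<open>t\<close>. \<open>berwald_trace\<close> makes \<open>t\<close> kill \<open>bk\<close>, and
  \<open>landsberg_trace\<close> makes the fibre differential of \<open>L\<close> kill it. These
  covectors are independent, as the latter takes the value \<open>2 * L z\<close> on the
  flagpole.\<close>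

lemma berwald:
  assumes n: "CARD('b) = 2" and z: "z \<in> Om"
  shows "DY j (Gam l i k) z = 0"
proof -
  define B where "B k l i j = DY j (Gam l i k) z" for k l i j
  have sy: "B k l i j = B k i l j" "B k l i j = B k l j i" for k l i j
    unfolding B_def using DY_Gam_sym[OF z] by blast+
  obtain t r where r: "r \<noteq> 0" and t: "\<exists>i. t i \<noteq> 0" and "(\<Sum>i\<in>UNIV. t i * snd z $ i) = 0"
    and ann: "\<And>w i. (\<Sum>i\<in>UNIV. w i * snd z $ i) = 0 \<Longrightarrow> w i = r * t i * (\<Sum>j\<in>UNIV. t j * w j)"
    and zero: "\<And>b l i. (\<Sum>i\<in>UNIV. b i * t i) = 0 \<Longrightarrow> (\<Sum>i\<in>UNIV. b i * l i) = 0 \<Longrightarrow> (\<Sum>i\<in>UNIV. l i * snd z $ i) \<noteq> 0 \<Longrightarrow> b i = 0"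
  proof (rule two_dim_annihilator[OF n])
    show "snd z \<noteq> 0" using z by auto
  qed (rule that)
  obtain i0 where i0: "t i0 \<noteq> 0" using t by blast
  have eul: "(\<Sum>j\<in>UNIV. B k l i j * snd z $ j) = 0" for k l i
    using euler[OF sm_Gam hom_Gam z, of l i k] by (simp add: B_def mult_ac)
  define bk where "bk k = r * r * r * (\<Sum>a\<in>UNIV. \<Sum>b\<in>UNIV. \<Sum>d\<in>UNIV. t d * t b * t a * B k d b a)" for k
  have Bt: "B k l i j = bk k * t l * t i * t j" for k l i j
  proof -
    \<comment> \<open>Euler's identity contracts the last lower index only; in the next two steps
      the symmetries move each remaining index into that place.\<close>
    have 1: "B k l i j = r * t j * (\<Sum>a\<in>UNIV. t a * B k l i a)" for k l i j by (rule ann[OF eul])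
    have 2: "B k l i a = r * t i * (\<Sum>b\<in>UNIV. t b * B k l b a)" for l i a
    proof -
      have "B k l i a = r * t i * (\<Sum>b\<in>UNIV. t b * B k l a b)" using 1[of k l a i] sy(2)[of k l i a] by simp
      then show ?thesis by (simp only: sy(2)[of k l _ a])
    qed
    have 3: "B k l b a = r * t l * (\<Sum>d\<in>UNIV. t d * B k d b a)" for l b a
    proof -
      have cyc: "B k d b a = B k b a d" for d using sy(1)[of k d b a] sy(2)[of k b d a] by simp
      have "B k l b a = r * t l * (\<Sum>d\<in>UNIV. t d * B k b a d)" using 1[of k b a l] cyc[of l] by simp
      then show ?thesis by (simp only: cyc)
    qed
    have "B k l i j = r * t j * (\<Sum>a\<in>UNIV. t a * B k l i a)" by (rule 1)
    also have "\<dots> = r * t j * (\<Sum>a\<in>UNIV. t a * (r * t i * (\<Sum>b\<in>UNIV. t b * B k l b a)))"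
      by (intro sum.cong refl arg_cong2[where f="(*)"] 2)
    also have "\<dots> = r * t j * (\<Sum>a\<in>UNIV. t a * (r * t i * (\<Sum>b\<in>UNIV. t b * (r * t l * (\<Sum>d\<in>UNIV. t d * B k d b a)))))"
      by (intro sum.cong refl arg_cong2[where f="(*)"] 3)
    finally have "B k l i j = r * t j * (\<Sum>a\<in>UNIV. t a * (r * t i * (\<Sum>b\<in>UNIV. t b * (r * t l * (\<Sum>d\<in>UNIV. t d * B k d b a)))))" .
    then show ?thesis unfolding bk_def by (simp add: sum_distrib_left sum_distrib_right mult_ac)
  qed
  have "bk k = 0" for k
  proof (rule zero[of bk "\<lambda>i. DY i L z"])
    have "(\<Sum>k\<in>UNIV. B k i0 k i0) = 0" using berwald_trace[OF z, of i0 i0] by (simp add: B_def)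
    moreover have "(\<Sum>k\<in>UNIV. B k i0 k i0) = (\<Sum>k\<in>UNIV. bk k * t k) * (t i0 * t i0)"
      unfolding Bt sum_distrib_right by (simp add: mult_ac)
    ultimately have "(\<Sum>k\<in>UNIV. bk k * t k) * (t i0 * t i0) = 0" by (simp only:)
    then show "(\<Sum>k\<in>UNIV. bk k * t k) = 0" using i0 by simp
    have "0 = (\<Sum>i\<in>UNIV. \<Sum>j\<in>UNIV. gi i j z * (\<Sum>k\<in>UNIV. B k i0 i j * DY k L z))"
      using landsberg_trace[OF z, of i0] by (simp add: B_def)
    also have "\<dots> = t i0 * ip t t z * (\<Sum>k\<in>UNIV. bk k * DY k L z)"
      unfolding Bt ip_def by (simp add: sum_distrib_left sum_distrib_right mult_ac)
    finally have "t i0 * ip t t z * (\<Sum>k\<in>UNIV. bk k * DY k L z) = 0" by simp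
    moreover have "ip t t z \<noteq> 0" using ip_eq_0[OF z] i0 by blast
    ultimately show "(\<Sum>k\<in>UNIV. bk k * DY k L z) = 0" using i0 by simp
    have "(\<Sum>i\<in>UNIV. DY i L z * snd z $ i) = 2 * L z" using euler[OF sm_L hom_L z] by (simp add: mult_ac)
    then show "(\<Sum>i\<in>UNIV. DY i L z * snd z $ i) \<noteq> 0" using L_pos[OF z] by simp
  qed
  then show ?thesis using Bt[of k l i j] unfolding B_def by simp
qed

lemma Gam_fibre:
  assumes n: "CARD('b) = 2" and x: "x \<in> U" and y: "y \<noteq> 0" "y' \<noteq> 0"
  shows "Gam l i k (x, y) = Gam l i k (x, y')"
  by (rule fibre_constant[OF sm_Gam x _ _ y]) (use n berwald[OF n] x in auto)

text \<open>Euler's identity for \<open>N\<close>, with \<open>Gam\<close> read off at an arbitrary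
  other vector of the fibre. In \<open>flat_coordinates\<close> that vector is the value of the
  parallel field \<open>e\<close>, while \<open>y\<close> varies.\<close>

lemma N_Gam:
  assumes n: "CARD('b) = 2" and x: "x \<in> U" and y: "y \<noteq> 0" "y' \<noteq> 0"
  shows "N l k (x, y) = (\<Sum>i\<in>UNIV. y $ i * Gam l i k (x, y'))"
  using euler[OF sm_N hom_N, of "(x, y)" l k] x y Gam_fibre[OF n x y] by (simp add: Gam_def)

end

section \<open>Flat coordinates\<close>

lemma smooth_inverse_function:
  fixes f :: "'a::euclidean_space \<Rightarrow> 'a"
  assumes S: "open S" and f: "smooth_map_on S f" and x0: "x0 \<in> S"
    and D: "\<And>x. x \<in> S \<Longrightarrow> (f has_derivative D x) (at x)" and inj: "\<And>v. D x0 v = 0 \<Longrightarrow> v = 0"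
  obtains S' V g where "open S'" "S' \<subseteq> S" "x0 \<in> S'" "open V" "f x0 \<in> V" "homeomorphism S' V f g"
    "\<And>y. y \<in> V \<Longrightarrow> g differentiable (at y)" "\<And>x v. x \<in> S' \<Longrightarrow> D x v = 0 \<Longrightarrow> v = 0"
proof -
  define f' where "f' x = Blinfun (D x)" for x
  have ap: "blinfun_apply (f' x) = D x" if "x \<in> S" for x
    unfolding f'_def using bounded_linear_Blinfun_apply[OF has_derivative_bounded_linear[OF D[OF that]]] .
  have Dx: "D x v = (\<Sum>b\<in>Basis. pd v (\<lambda>x. f x \<bullet> b) x *\<^sub>R b)" if "x \<in> S" for x v
    using has_derivative_unique[OF D[OF that] smooth_map_on_has_derivative[OF f S that]] by metis
  have cont: "continuous_on S f'"
  proof (rule continuous_on_blinfun_componentwise)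
    fix i :: 'a assume i: "i \<in> Basis"
    have "continuous_on S (\<lambda>x. \<Sum>b\<in>Basis. pd i (\<lambda>x. f x \<bullet> b) x *\<^sub>R b)"
    proof (intro continuous_on_sum continuous_on_scaleR continuous_on_const)
      fix b :: 'a assume "b \<in> Basis"
      then show "continuous_on S (pd i (\<lambda>x. f x \<bullet> b))"
        using f i by (intro smooth_on_imp_continuous[OF smooth_on_pd S]) (auto simp: smooth_map_on_def)
    qed
    then show "continuous_on S (\<lambda>x. blinfun_apply (f' x) i)"
      by (rule continuous_on_eq) (simp add: ap Dx)
  qed
  have lin: "linear (D x0)" by (rule has_derivative_linear[OF D[OF x0]])
  have "inj (D x0)" using linear_injective_0[OF lin] inj by blast
  then obtain g0 where g0: "linear g0" "g0 \<circ> D x0 = id" using linear_injective_left_inverse[OF lin] by blast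
  have "Blinfun g0 o\<^sub>L f' x0 = id_blinfun"
  proof (rule blinfun_eqI)
    fix i
    have "blinfun_apply (Blinfun g0) = g0"
      using g0(1) by (simp add: bounded_linear_Blinfun_apply linear_conv_bounded_linear)
    then show "blinfun_apply (Blinfun g0 o\<^sub>L f' x0) i = blinfun_apply id_blinfun i"
      using fun_cong[OF g0(2), of i] by (simp add: ap[OF x0])
  qed
  then obtain S' V g g' where r: "open S'" "S' \<subseteq> S" "x0 \<in> S'" "open V" "f x0 \<in> V" "homeomorphism S' V f g"
    "\<And>y. y \<in> V \<Longrightarrow> (g has_derivative (g' y)) (at y)" "\<And>y. y \<in> V \<Longrightarrow> bij (blinfun_apply (f' (g y)))"
    using inverse_function_theorem[OF S _ cont x0, of f "Blinfun g0"] D ap by metis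
  show ?thesis
  proof (rule that[OF r(1-6)])
    show "g differentiable (at y)" if "y \<in> V" for y using r(7)[OF that] unfolding differentiable_def by blast
    fix x v assume x: "x \<in> S'" and v: "D x v = 0"
    have "f x \<in> V" "g (f x) = x" using r(6) x unfolding homeomorphism_def by auto
    then have "inj (D x)" using r(8)[of "f x"] ap[of x] x r(2) by (auto simp: bij_def)
    then show "v = 0" using linear_injective_0[OF has_derivative_linear[OF D]] x r(2) v by blast
  qed
qed

lemma smooth_map_on_vecI:
  assumes "\<And>k. smooth_on S (\<lambda>x. (f x :: real^'n) $ k)" shows "smooth_map_on S f"
  unfolding smooth_map_on_def
proof
  fix b :: "real^'n" assume "b \<in> Basis"
  then obtain k where "b = axis k 1" by (auto simp: Basis_vec_def)
  then show "smooth_on S (\<lambda>x. f x \<bullet> b)" using assms[of k] by (simp add: inner_axis)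
qed

text \<open>The primitive is the integral of the form along the segments issuing from the centre; it
  is differentiated under the integral sign.\<close>

lemma poincare_lemma:
  fixes \<theta> :: "'n::finite \<Rightarrow> real^'n \<Rightarrow> real"
  assumes sm: "\<And>i. smooth_on (ball x0 r) (\<theta> i)"
    and closed: "\<And>i j x. x \<in> ball x0 r \<Longrightarrow> pd (axis j 1) (\<theta> i) x = pd (axis i 1) (\<theta> j) x"
  obtains f where "\<And>x. x \<in> ball x0 r \<Longrightarrow> (f has_derivative (\<lambda>v. \<Sum>i\<in>UNIV. \<theta> i x * v $ i)) (at x)"
proof -
  let ?B = "ball x0 r"
  define P where "P x t = x0 + t *\<^sub>R (x - x0)" for x and t :: real
  have PB: "P x t \<in> ?B" if "x \<in> ?B" "t \<in> {0..1}" for x t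
  proof -
    have "dist x0 (P x t) = t * dist x0 x" using that by (simp add: P_def dist_norm norm_minus_commute)
    also have "\<dots> \<le> dist x0 x" using that by (simp add: mult_left_le_one_le)
    finally show ?thesis using that by simp
  qed
  note d = smooth_on_imp_differentiable[OF sm open_ball]
  have axB: "axis k (1::real) \<in> (Basis :: (real^'n) set)" for k by (simp add: axis_in_Basis_iff)
  \<comment> \<open>The \<open>k\<close>-th partial of the integrand. Closedness turns it into the
    \<open>t\<close>-derivative of \<open>t * \<theta> k (P x t)\<close>, so it integrates to
    \<open>\<theta> k x\<close>.\<close>
  define w where "w k x t = (\<Sum>i\<in>UNIV. t * pd (axis k 1) (\<theta> i) (P x t) * (x - x0) $ i) + \<theta> k (P x t)" for k x t
  define fx where "fx x t = (\<Sum>k\<in>UNIV. w k x t *\<^sub>R Blinfun (\<lambda>v::real^'n. v $ k))" for x t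
  have fx_apply: "blinfun_apply (fx x t) v = (\<Sum>k\<in>UNIV. w k x t * v $ k)" for x t v
    unfolding fx_def blinfun.sum_left
    by (simp add: blinfun.scaleR_left bounded_linear_Blinfun_apply bounded_linear_vec_nth)
  define f where "f x = integral (cbox 0 1) (\<lambda>t. \<Sum>i\<in>UNIV. \<theta> i (P x t) * (x - x0) $ i)" for x
  have contP: "continuous_on (?B \<times> cbox 0 1) (\<lambda>z. h (P (fst z) (snd z)))" if "continuous_on ?B h" for h :: "real^'n \<Rightarrow> real"
    by (rule continuous_on_compose2[OF that]) (use PB in \<open>auto simp: P_def intro!: continuous_intros\<close>)
  have fder: "(f has_derivative integral (cbox 0 1) (fx x)) (at x within ?B)" if x: "x \<in> ?B" for x
    unfolding f_def
  proof (rule leibniz_rule[OF _ _ _ x])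
    fix x t assume x: "x \<in> ?B" and t: "t \<in> cbox 0 (1::real)"
    have p: "P x t \<in> ?B" using PB x t by simp
    have DP: "((\<lambda>x. P x t) has_derivative (\<lambda>v. t *\<^sub>R v)) (at x)"
      unfolding P_def by (auto intro!: derivative_eq_intros)
    have "((\<lambda>x. \<theta> i (P x t)) has_derivative (\<lambda>v. \<Sum>k\<in>UNIV. t * v $ k * pd (axis k 1) (\<theta> i) (P x t))) (at x)" for i
    proof (rule has_derivative_eq_rhs[OF has_derivative_compose[OF DP pd_has_derivative[OF d[OF p]]]])
      show "(\<lambda>v. pd (t *\<^sub>R v) (\<theta> i) (P x t)) = (\<lambda>v. \<Sum>k\<in>UNIV. t * v $ k * pd (axis k 1) (\<theta> i) (P x t))"
        by (rule ext, subst pd_vec[OF d[OF p]]) simp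
    qed
    moreover have "((\<lambda>x. (x - x0) $ i) has_derivative (\<lambda>v. v $ i)) (at x)" for i
      by (rule has_derivative_eq_rhs[OF bounded_linear.has_derivative[OF bounded_linear_vec_nth]]) (auto intro!: derivative_eq_intros)
    ultimately have "((\<lambda>x. \<Sum>i\<in>UNIV. \<theta> i (P x t) * (x - x0) $ i) has_derivative
      (\<lambda>v. \<Sum>i\<in>UNIV. \<theta> i (P x t) * v $ i + (\<Sum>k\<in>UNIV. t * v $ k * pd (axis k 1) (\<theta> i) (P x t)) * (x - x0) $ i)) (at x)"
      by (intro has_derivative_sum has_derivative_mult)
    moreover have "(\<Sum>i\<in>UNIV. \<theta> i (P x t) * v $ i + (\<Sum>k\<in>UNIV. t * v $ k * pd (axis k 1) (\<theta> i) (P x t)) * (x - x0) $ i) = blinfun_apply (fx x t) v" for v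
    proof -
      have "(\<Sum>i\<in>UNIV. (\<Sum>k\<in>UNIV. t * v $ k * pd (axis k 1) (\<theta> i) (P x t)) * (x - x0) $ i)
        = (\<Sum>k\<in>UNIV. (\<Sum>i\<in>UNIV. t * pd (axis k 1) (\<theta> i) (P x t) * (x - x0) $ i) * v $ k)"
        unfolding sum_distrib_right by (subst sum.swap) (simp add: mult_ac)
      then show ?thesis unfolding fx_apply w_def sum.distrib distrib_right by simp
    qed
    ultimately show "((\<lambda>x. \<Sum>i\<in>UNIV. \<theta> i (P x t) * (x - x0) $ i) has_derivative blinfun_apply (fx x t)) (at x within ?B)"
      by (simp add: has_derivative_at_withinI)
  next
    fix x assume x: "x \<in> ?B"
    have "continuous_on (cbox 0 1) (\<lambda>t. \<theta> i (P x t))" for i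
      by (rule continuous_on_compose2[OF smooth_on_imp_continuous[OF sm open_ball]])
         (use PB[OF x] in \<open>auto simp: P_def intro!: continuous_intros\<close>)
    then show "(\<lambda>t. \<Sum>i\<in>UNIV. \<theta> i (P x t) * (x - x0) $ i) integrable_on cbox 0 1"
      by (intro integrable_continuous continuous_on_sum continuous_on_mult continuous_on_const)
  next
    have c1: "continuous_on (?B \<times> cbox 0 1) (\<lambda>z. pd (axis k 1) (\<theta> i) (P (fst z) (snd z)))" for i k
      by (rule contP, rule smooth_on_imp_continuous[OF smooth_on_pd[OF sm axB] open_ball])
    have c2: "continuous_on (?B \<times> cbox 0 1) (\<lambda>z. \<theta> i (P (fst z) (snd z)))" for i
      by (rule contP, rule smooth_on_imp_continuous[OF sm open_ball])
    have c3: "continuous_on (?B \<times> cbox 0 (1::real)) (\<lambda>z. (fst z - x0) $ i)" for i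
      by (intro continuous_intros)
    show "continuous_on (?B \<times> cbox 0 1) (\<lambda>(x, t). fx x t)"
      unfolding fx_def w_def case_prod_unfold
      by (intro continuous_on_sum continuous_on_scaleR continuous_on_const continuous_on_add continuous_on_mult c1 c2 c3 continuous_on_snd continuous_on_id)
  qed simp
  have wint: "(w k x has_integral \<theta> k x) (cbox 0 1)" if x: "x \<in> ?B" for k x
  proof -
    have "((\<lambda>t. w k x t) has_integral (1 * \<theta> k (P x 1) - 0 * \<theta> k (P x 0))) {0..1}"
    proof (rule fundamental_theorem_of_calculus)
      fix t :: real assume t: "t \<in> {0..1}"
      have p: "P x t \<in> ?B" using PB[OF x t] .
      have DP: "((\<lambda>t. P x t) has_derivative (\<lambda>s. s *\<^sub>R (x - x0))) (at t)"
        unfolding P_def by (auto intro!: derivative_eq_intros)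
      have "((\<lambda>t. \<theta> k (P x t)) has_derivative (\<lambda>s. pd (s *\<^sub>R (x - x0)) (\<theta> k) (P x t))) (at t)"
        by (rule has_derivative_compose[OF DP pd_has_derivative[OF d[OF p]]])
      from has_derivative_mult[OF has_derivative_ident this]
      have "((\<lambda>t. t * \<theta> k (P x t)) has_derivative (\<lambda>s. t * pd (s *\<^sub>R (x - x0)) (\<theta> k) (P x t) + s * \<theta> k (P x t))) (at t)" .
      moreover have "t * pd (s *\<^sub>R (x - x0)) (\<theta> k) (P x t) + s * \<theta> k (P x t) = s *\<^sub>R w k x t" for s
      proof -
        have "pd (s *\<^sub>R (x - x0)) (\<theta> k) (P x t) = (\<Sum>i\<in>UNIV. s * (x - x0) $ i * pd (axis k 1) (\<theta> i) (P x t))"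
          by (subst pd_vec[OF d[OF p]]) (simp add: closed[OF p, of _ k])
        then show ?thesis unfolding w_def by (simp add: sum_distrib_left distrib_left mult_ac)
      qed
      ultimately show "((\<lambda>t. t * \<theta> k (P x t)) has_vector_derivative w k x t) (at t within {0..1})"
        unfolding has_vector_derivative_def by (simp add: has_derivative_at_withinI)
    qed simp
    then show ?thesis by (simp add: P_def)
  qed
  have "(f has_derivative (\<lambda>v. \<Sum>i\<in>UNIV. \<theta> i x * v $ i)) (at x)" if x: "x \<in> ?B" for x
  proof -
    have "(fx x has_integral (\<Sum>k\<in>UNIV. \<theta> k x *\<^sub>R Blinfun (\<lambda>v::real^'n. v $ k))) (cbox 0 1)"
      unfolding fx_def[abs_def] by (intro has_integral_sum has_integral_scaleR_left wint x) simp
    then have "integral (cbox 0 1) (fx x) = (\<Sum>k\<in>UNIV. \<theta> k x *\<^sub>R Blinfun (\<lambda>v::real^'n. v $ k))" by (rule integral_unique)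
    then have "blinfun_apply (integral (cbox 0 1) (fx x)) = (\<lambda>v. \<Sum>i\<in>UNIV. \<theta> i x * v $ i)"
      by (simp add: fun_eq_iff blinfun.sum_left blinfun.scaleR_left bounded_linear_Blinfun_apply bounded_linear_vec_nth)
    then show ?thesis using fder[OF x] at_within_open[OF x open_ball] by simp
  qed
  then show ?thesis using that by blast
qed

section \<open>Horizontal sections and the flat coordinates built from them\<close>

context finsler_core
begin

text \<open>The graph of the field is tangent at \<open>x\<close> to the horizontal distribution of
  \<open>N\<close>; along it, functions therefore change by their horizontal derivatives.\<close>

definition parallel_at :: "(real^'b \<Rightarrow> real^'b) \<Rightarrow> real^'b \<Rightarrow> bool" where
  "parallel_at \<xi> x \<longleftrightarrow> (\<xi> has_derivative (\<lambda>v. \<chi> k. - (\<Sum>i\<in>UNIV. v $ i * N i k (x, \<xi> x)))) (at x)"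

lemma along_parallel:
  assumes par: "parallel_at \<xi> x" and z: "(x, \<xi> x) \<in> Om" and h: "sm h"
  shows "((\<lambda>x. h (x, \<xi> x)) has_derivative
    (\<lambda>v. \<Sum>j\<in>UNIV. v $ j * (DX j h (x, \<xi> x) - (\<Sum>k\<in>UNIV. N j k (x, \<xi> x) * DY k h (x, \<xi> x))))) (at x)"
proof -
  have "((\<lambda>x. (x, \<xi> x)) has_derivative (\<lambda>v. (v, \<chi> k. - (\<Sum>i\<in>UNIV. v $ i * N i k (x, \<xi> x))))) (at x)"
    using par unfolding parallel_at_def by (intro has_derivative_Pair has_derivative_ident)
  from has_derivative_compose[OF this pd_has_derivative[OF sm_diff[OF h z]]]
  have "((\<lambda>x. h (x, \<xi> x)) has_derivative (\<lambda>v. pd (v, \<chi> k. - (\<Sum>i\<in>UNIV. v $ i * N i k (x, \<xi> x))) h (x, \<xi> x))) (at x)" .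
  moreover have "pd (v, \<chi> k. - (\<Sum>i\<in>UNIV. v $ i * N i k (x, \<xi> x))) h (x, \<xi> x)
    = (\<Sum>j\<in>UNIV. v $ j * (DX j h (x, \<xi> x) - (\<Sum>k\<in>UNIV. N j k (x, \<xi> x) * DY k h (x, \<xi> x))))" for v
  proof -
    have "(\<Sum>k\<in>UNIV. (\<Sum>i\<in>UNIV. v $ i * N i k (x, \<xi> x)) * DY k h (x, \<xi> x)) = (\<Sum>j\<in>UNIV. v $ j * (\<Sum>k\<in>UNIV. N j k (x, \<xi> x) * DY k h (x, \<xi> x)))"
      unfolding sum_distrib_left sum_distrib_right by (subst sum.swap) (simp add: mult_ac)
    then show ?thesis
      unfolding pd_pair[OF sm_diff[OF h z]] by (simp add: right_diff_distrib sum_subtractf sum_negf)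
  qed
  ultimately show ?thesis by simp
qed

text \<open>Over each fibre \<open>L\<close> and \<open>tau\<close> are local coordinates near
  \<open>y0\<close>: their differentials are independent because \<open>I\<close> is nonzero and
  kills the flagpole, whereas the differential of \<open>L\<close> does not. The section on which
  both keep their initial values is parallel, since horizontal motion preserves them too and they
  determine the vertical part.\<close>

lemma parallel_field:
  assumes n: "CARD('b) = 2" and x0: "x0 \<in> U" and y0: "y0 \<noteq> 0" and I0: "I k0 (x0, y0) \<noteq> 0"
  obtains X e where "open X" "x0 \<in> X" "X \<subseteq> U" "\<And>x. x \<in> X \<Longrightarrow> e x \<noteq> 0" "\<And>x. x \<in> X \<Longrightarrow> parallel_at e x"
    "\<And>x m. x \<in> X \<Longrightarrow> (\<Sum>j\<in>UNIV. m $ j * DY j L (x, e x)) = 0 \<Longrightarrow> (\<Sum>j\<in>UNIV. m $ j * I j (x, e x)) = 0 \<Longrightarrow> m = 0"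
proof -
  obtain p q :: 'b where pq: "UNIV = {p, q}" "p \<noteq> q" using n by (auto simp: card_2_iff)
  \<comment> \<open>With just two indices \<open>p\<close> and \<open>q\<close> this packs the pair
    \<open>L\<close>, \<open>tau\<close> into the model space, so that \<open>Th\<close> maps a
    space to itself and the inverse function theorem applies.\<close>
  define Q where "Q z = (\<chi> i. if i = p then L z else tau z)" for z
  define Th where "Th z = (fst z, Q z)" for z
  define D where "D z v = (fst v, \<chi> i. if i = p then pd v L z else pd v tau z)" for z v
  have Qsm: "sm (\<lambda>z. Q z $ i)" for i unfolding Q_def using sm_L sm_tau by (cases "i = p") auto
  have smTh: "smooth_map_on Om Th"
    unfolding smooth_map_on_def
  proof
    fix b :: "(real^'b) \<times> (real^'b)" assume "b \<in> Basis"
    have eq: "(\<lambda>z. Th z \<bullet> b) = (\<lambda>z. fst z \<bullet> fst b + (\<Sum>i\<in>UNIV. Q z $ i * snd b $ i))"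
      by (simp add: Th_def inner_prod_def inner_vec_def fun_eq_iff)
    show "sm (\<lambda>z. Th z \<bullet> b)" unfolding eq
      by (intro smooth_on_add smooth_on_sum smooth_on_mult smooth_on_const open_Om Qsm
          smooth_on_bounded_linear bounded_linear_compose[OF bounded_linear_inner_left bounded_linear_fst])
  qed
  have DTh: "(Th has_derivative D z) (at z)" if z: "z \<in> Om" for z
  proof -
    have "(Q has_derivative (\<lambda>v. \<chi> i. if i = p then pd v L z else pd v tau z)) (at z)"
    proof (rule has_derivative_vecI)
      fix k
      show "((\<lambda>x. Q x $ k) has_derivative (\<lambda>h. (\<chi> i. if i = p then pd h L z else pd h tau z) $ k)) (at z)"
        unfolding Q_def using pd_has_derivative[OF sm_diff[OF sm_L z]] pd_has_derivative[OF sm_diff[OF sm_tau z]]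
        by (cases "k = p") auto
    qed
    then show ?thesis unfolding Th_def[abs_def] D_def[abs_def]
      by (intro has_derivative_Pair) (auto intro!: derivative_eq_intros)
  qed
  have z0: "(x0, y0) \<in> Om" using x0 y0 by auto
  have D0: "fst v = 0" "(\<Sum>j\<in>UNIV. snd v $ j * DY j L z) = 0" "(\<Sum>j\<in>UNIV. snd v $ j * I j z) = 0" if "D z v = 0" "z \<in> Om" for z v
  proof -
    show v1: "fst v = 0" using that unfolding D_def by (simp add: prod_eq_iff)
    have vv: "\<And>i. (if i = p then pd v L z else pd v tau z) = 0" using that unfolding D_def by (simp add: prod_eq_iff vec_eq_iff)
    have "pd v L z = 0" "pd v tau z = 0" using vv[of p] vv[of q] pq(2) by auto
    moreover have "v = (fst v, snd v)" by simp
    ultimately have "pd (fst v, snd v) L z = 0" "pd (fst v, snd v) tau z = 0" by metis+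
    then show "(\<Sum>j\<in>UNIV. snd v $ j * DY j L z) = 0" "(\<Sum>j\<in>UNIV. snd v $ j * I j z) = 0"
      using pd_pair[OF sm_diff[OF sm_L that(2)], of "fst v" "snd v"] pd_pair[OF sm_diff[OF sm_tau that(2)], of "fst v" "snd v"] v1 by auto
  qed
  have Dm: "D z (0, m) = 0" if "(\<Sum>j\<in>UNIV. m $ j * DY j L z) = 0" "(\<Sum>j\<in>UNIV. m $ j * I j z) = 0" "z \<in> Om" for z m
    using that pd_pair[OF sm_diff[OF sm_L that(3)], of 0 m] pd_pair[OF sm_diff[OF sm_tau that(3)], of 0 m]
    unfolding D_def by (simp add: prod_eq_iff vec_eq_iff)
  have inj0: "v = 0" if Dv: "D (x0, y0) v = 0" for v
  proof -
    obtain t r where "r \<noteq> 0" "\<exists>i. t i \<noteq> 0" "(\<Sum>i\<in>UNIV. t i * y0 $ i) = 0"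
      and ann: "\<And>w i. (\<Sum>i\<in>UNIV. w i * y0 $ i) = 0 \<Longrightarrow> w i = r * t i * (\<Sum>j\<in>UNIV. t j * w j)"
      and zero: "\<And>b l i. (\<Sum>i\<in>UNIV. b i * t i) = 0 \<Longrightarrow> (\<Sum>i\<in>UNIV. b i * l i) = 0 \<Longrightarrow> (\<Sum>i\<in>UNIV. l i * y0 $ i) \<noteq> 0 \<Longrightarrow> b i = 0"
    proof (rule two_dim_annihilator[OF n y0])
    qed (rule that)
    define s where "s = r * (\<Sum>j\<in>UNIV. t j * I j (x0, y0))"
    have It: "I i (x0, y0) = s * t i" for i
      using ann[of "\<lambda>i. I i (x0, y0)" i] I_y[OF z0] by (simp add: s_def mult_ac)
    then have s0: "s \<noteq> 0" using I0 by auto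
    have "s * (\<Sum>j\<in>UNIV. snd v $ j * t j) = 0"
      using D0(3)[OF Dv z0] unfolding It sum_distrib_left by (simp add: mult_ac)
    then have 1: "(\<Sum>j\<in>UNIV. snd v $ j * t j) = 0" using s0 by simp
    have "(\<Sum>i\<in>UNIV. DY i L (x0, y0) * y0 $ i) = 2 * L (x0, y0)" using euler[OF sm_L hom_L z0] by (simp add: mult_ac)
    then have 3: "(\<Sum>i\<in>UNIV. DY i L (x0, y0) * y0 $ i) \<noteq> 0" using L_pos[OF z0] by simp
    have "snd v $ i = 0" for i by (rule zero[OF 1 D0(2)[OF Dv z0] 3])
    then show "v = 0" using D0(1)[OF Dv z0] by (simp add: prod_eq_iff vec_eq_iff)
  qed
  obtain S' V g where r: "open S'" "S' \<subseteq> Om" "(x0, y0) \<in> S'" "open V" "Th (x0, y0) \<in> V" "homeomorphism S' V Th g"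
    and gd: "\<And>y. y \<in> V \<Longrightarrow> g differentiable (at y)" and Dinj: "\<And>x v. x \<in> S' \<Longrightarrow> D x v = 0 \<Longrightarrow> v = 0"
    using smooth_inverse_function[OF open_Om smTh z0 DTh inj0] by blast
  define w0 where "w0 = Q (x0, y0)"
  define X where "X = (\<lambda>x. (x, w0)) -` V"
  define e where "e x = snd (g (x, w0))" for x
  have oX: "open X" unfolding X_def by (intro continuous_open_vimage r(4)) (auto intro!: continuous_intros)
  have gx: "g (x, w0) = (x, e x)" "(x, e x) \<in> S'" "Q (x, e x) = w0" if "x \<in> X" for x
  proof -
    have "(x, w0) \<in> V" using that by (simp add: X_def)
    then have a: "g (x, w0) \<in> S'" "Th (g (x, w0)) = (x, w0)" using r(6) unfolding homeomorphism_def by auto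
    then show "g (x, w0) = (x, e x)" by (simp add: Th_def e_def prod_eq_iff)
    then show "(x, e x) \<in> S'" "Q (x, e x) = w0" using a by (auto simp: Th_def)
  qed
  have zX: "(x, e x) \<in> Om" if "x \<in> X" for x using gx(2)[OF that] r(2) by blast
  have eDiff: "e differentiable (at x)" if "x \<in> X" for x
  proof -
    have "(x, w0) \<in> V" using that by (simp add: X_def)
    then obtain g' where g': "(g has_derivative g') (at (x, w0))" using gd unfolding differentiable_def by blast
    have "((\<lambda>x. (x, w0)) has_derivative (\<lambda>v. (v, 0))) (at x)" by (auto intro!: derivative_eq_intros)
    from has_derivative_snd[OF has_derivative_compose[OF this g']]
    show ?thesis unfolding e_def[abs_def] differentiable_def by blast
  qed
  have par: "parallel_at e x" if x: "x \<in> X" for x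
  proof -
    obtain e' where e': "(e has_derivative e') (at x)" using eDiff[OF x] unfolding differentiable_def by blast
    have P: "((\<lambda>x. (x, e x)) has_derivative (\<lambda>v. (v, e' v))) (at x)" by (intro has_derivative_Pair has_derivative_ident e')
    have const0: "pd (v, e' v) h (x, e x) = 0" if h: "sm h" "\<And>x. x \<in> X \<Longrightarrow> h (x, e x) = k" for h k v
    proof -
      have "pd v (\<lambda>x. h (x, e x)) x = pd v (\<lambda>_. k) x" by (rule pd_cong_open[OF oX x h(2)])
      then show ?thesis using pd_chain[OF P sm_diff[OF h(1) zX[OF x]], of v] by simp
    qed
    have Lk: "L (x, e x) = w0 $ p" "tau (x, e x) = w0 $ q" if "x \<in> X" for x
      using gx(3)[OF that] pq(2) unfolding Q_def by (auto simp: vec_eq_iff split: if_splits)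
    have "e' v = (\<chi> k. - (\<Sum>i\<in>UNIV. v $ i * N i k (x, e x)))" for v
    proof -
      \<comment> \<open>The deviation from the horizontal lift. Both fibre differentials kill it,
        because \<open>L\<close> and \<open>tau\<close> are constant along the section as well as
        horizontally.\<close>
      define m where "m = e' v - (\<chi> k. - (\<Sum>i\<in>UNIV. v $ i * N i k (x, e x)))"
      have hz: "(\<Sum>j\<in>UNIV. m $ j * DY j h (x, e x)) = 0"
        if h: "sm h" "\<And>x. x \<in> X \<Longrightarrow> h (x, e x) = k" "\<And>l. DX l h (x, e x) = (\<Sum>j\<in>UNIV. N l j (x, e x) * DY j h (x, e x))" for h k
      proof -
        have "(\<Sum>l\<in>UNIV. v $ l * DX l h (x, e x)) + (\<Sum>j\<in>UNIV. e' v $ j * DY j h (x, e x)) = 0"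
          using const0[OF h(1,2), of v] pd_pair[OF sm_diff[OF h(1) zX[OF x]], of v "e' v"] by simp
        moreover have "(\<Sum>l\<in>UNIV. v $ l * DX l h (x, e x)) = (\<Sum>j\<in>UNIV. (\<Sum>l\<in>UNIV. v $ l * N l j (x, e x)) * DY j h (x, e x))"
          unfolding h(3) sum_distrib_left sum_distrib_right by (subst sum.swap) (simp add: mult_ac)
        ultimately show ?thesis unfolding m_def by (simp add: distrib_right sum.distrib)
      qed
      have "D (x, e x) (0, m) = 0"
        by (rule Dm[OF hz[OF sm_L Lk(1) DX_L[OF zX[OF x]]] hz[OF sm_tau Lk(2) DX_tau_N[OF zX[OF x]]] zX[OF x]])
      then have "(0::real^'b, m) = 0" by (rule Dinj[OF gx(2)[OF x]])
      then show ?thesis unfolding m_def by (simp add: prod_eq_iff)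
    qed
    then have "e' = (\<lambda>v. \<chi> k. - (\<Sum>i\<in>UNIV. v $ i * N i k (x, e x)))" by (rule ext)
    then show ?thesis using e' unfolding parallel_at_def by simp
  qed
  show ?thesis
  proof (rule that[of X e])
    show "x0 \<in> X" using r(5) by (simp add: X_def w0_def Th_def)
    show "X \<subseteq> U" using zX by auto
    show "e x \<noteq> 0" if "x \<in> X" for x using zX[OF that] by auto
    fix x m assume x: "x \<in> X" and "(\<Sum>j\<in>UNIV. m $ j * DY j L (x, e x)) = 0" "(\<Sum>j\<in>UNIV. m $ j * I j (x, e x)) = 0"
    then have "D (x, e x) (0, m) = 0" using Dm zX by blast
    then have "(0::real^'b, m) = 0" by (rule Dinj[OF gx(2)[OF x]])
    then show "m = 0" by (simp add: prod_eq_iff)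
  qed (use oX par in auto)
qed

end

lemma sum_axis: "(\<Sum>l\<in>UNIV. axis j 1 $ l * a l) = (a (j::'n::finite) :: real)"
proof -
  have "(\<Sum>l\<in>UNIV. axis j 1 $ l * a l) = (\<Sum>l\<in>UNIV. (if l = j then 1 else 0) * a l)"
    by (intro sum.cong refl) (simp add: axis_def)
  then show ?thesis by simp
qed

text \<open>The coordinates \<open>f\<close> have the fibre differentials of \<open>L\<close> and
  \<open>tau\<close> along the parallel field \<open>e\<close> as their differentials. A vector
  field with constant components in \<open>f\<close> is parallel, so \<open>F\<close> is constant
  along it; thus \<open>F\<close> depends on the components alone.\<close>

lemma (in finsler_core) flat_coordinates:
  assumes n: "CARD('b) = 2" and x0: "x0 \<in> U" and y0: "y0 \<noteq> 0" and I0: "I k0 (x0, y0) \<noteq> 0"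
  obtains W V and f fi :: "real^'b \<Rightarrow> real^'b" and N0 where "open W" "x0 \<in> W" "W \<subseteq> U" "open V" "homeomorphism W V f fi"
    "smooth_map_on W f" "smooth_map_on V fi"
    "\<And>x v. x \<in> W \<Longrightarrow> Floc F c (x, v) = N0 (frechet_derivative f (at x) v)"
proof -
  obtain X e where X: "open X" "x0 \<in> X" "X \<subseteq> U" and e0: "\<And>x. x \<in> X \<Longrightarrow> e x \<noteq> 0" and par: "\<And>x. x \<in> X \<Longrightarrow> parallel_at e x"
    and ind: "\<And>x m. x \<in> X \<Longrightarrow> (\<Sum>j\<in>UNIV. m $ j * DY j L (x, e x)) = 0 \<Longrightarrow> (\<Sum>j\<in>UNIV. m $ j * I j (x, e x)) = 0 \<Longrightarrow> m = 0"
    using parallel_field[OF n x0 y0 I0] by blast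
  have zX: "(x, e x) \<in> Om" if "x \<in> X" for x using X(3) e0[OF that] that by auto
  obtain r where r: "r > 0" "ball x0 r \<subseteq> X" using X(1,2) openE by blast
  have axB: "axis k (1::real) \<in> (Basis :: (real^'b) set)" for k by (simp add: axis_in_Basis_iff)
  have pd_along: "pd (axis j 1) (\<lambda>x. h (x, e x)) x = DX j h (x, e x) - (\<Sum>k\<in>UNIV. N j k (x, e x) * DY k h (x, e x))"
    if "sm h" "x \<in> X" for h x j
    using pd_eqI[OF along_parallel[OF par[OF that(2)] zX[OF that(2)] that(1)], of "axis j 1"] by (simp only: sum_axis)
  \<comment> \<open>The field \<open>e\<close> is only known to be differentiable. As it is
    parallel, however, each partial of a smooth function pulled back along it is again such a
    pullback, and \<open>smooth_coinduct\<close> applies.\<close>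
  have smooth_along: "smooth_on X (\<lambda>x. h (x, e x))" if h: "sm h" for h
  proof (rule smooth_coinduct[OF X(1), where P="\<lambda>f. \<exists>h. sm h \<and> f = (\<lambda>x. h (x, e x))"])
    show "\<exists>h'. sm h' \<and> (\<lambda>x. h (x, e x)) = (\<lambda>x. h' (x, e x))" using h by blast
    show "f differentiable (at x)" if "\<exists>h. sm h \<and> f = (\<lambda>x. h (x, e x))" "x \<in> X" for f x
      using that along_parallel[OF par zX] unfolding differentiable_def by blast
    show "\<exists>g. (\<exists>h. sm h \<and> g = (\<lambda>x. h (x, e x))) \<and> (\<forall>x\<in>X. pd b f x = g x)"
      if fb: "\<exists>h. sm h \<and> f = (\<lambda>x. h (x, e x))" "b \<in> Basis" for f b
    proof -
      obtain h where h: "sm h" "f = (\<lambda>x. h (x, e x))" using fb by blast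
      obtain j where j: "b = axis j 1" using fb(2) by (auto simp: Basis_vec_def)
      have "sm (\<lambda>z. DX j h z - (\<Sum>k\<in>UNIV. N j k z * DY k h z))"
        by (intro smooth_on_diff smooth_on_sum smooth_on_mult open_Om sm_N sm_DX sm_DY h)
      moreover have "\<forall>x\<in>X. pd b f x = (\<lambda>x. (\<lambda>z. DX j h z - (\<Sum>k\<in>UNIV. N j k z * DY k h z)) (x, e x)) x"
        using pd_along[OF h(1)] unfolding h(2) j by blast
      ultimately show ?thesis by blast
    qed
  qed
  obtain p q :: 'b where pq: "UNIV = {p, q}" "p \<noteq> q" using n by (auto simp: card_2_iff)
  define hh where "hh a = (if a = p then L else tau)" for a :: 'b
  have hh_sm: "sm (hh a)" for a unfolding hh_def using sm_L sm_tau by simp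
  have hh_hor: "DX l (hh a) z = (\<Sum>k\<in>UNIV. N l k z * DY k (hh a) z)" if "z \<in> Om" for l a z
    unfolding hh_def using DX_L[OF that] DX_tau_N[OF that] by simp
  define E where "E x = (\<chi> a i. DY i (hh a) (x, e x))" for x
  have E_sm: "smooth_on X (\<lambda>x. E x $ a $ i)" for a i
    unfolding E_def using smooth_along[OF sm_DY[OF hh_sm]] by simp
  \<comment> \<open>The rows of \<open>E\<close> are parallel covector fields; symmetry of
    \<open>Gam\<close> in its lower indices makes them closed 1-forms.\<close>
  have pdE: "pd (axis j 1) (\<lambda>x. E x $ a $ i) x = (\<Sum>k\<in>UNIV. Gam j i k (x, e x) * E x $ a $ k)" if x: "x \<in> X" for j a i x
    using pd_along[OF sm_DY[OF hh_sm] x, of j i a] horizontal_DY[OF hh_sm hh_hor zX[OF x], of j i a]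
    unfolding E_def by simp
  have E_inj: "m = 0" if "x \<in> X" "E x *v m = 0" for x m
  proof -
    have "(\<Sum>i\<in>UNIV. E x $ a $ i * m $ i) = 0" for a using that(2) by (simp add: vec_eq_iff matrix_vector_mult_def)
    from this[of p] this[of q] show ?thesis using pq(2) by (intro ind[OF that(1)]) (simp_all add: E_def hh_def mult_ac)
  qed
  have E_inv: "invertible (E x)" if "x \<in> X" for x
  proof -
    have "inj ((*v) (E x))"
      using E_inj[OF that] by (intro linear_injective_0[THEN iffD2]) auto
    then show ?thesis using matrix_left_invertible_injective invertible_left_inverse by blast
  qed
  have E_det: "det (E x) \<noteq> 0" if "x \<in> X" for x using E_inv[OF that] invertible_det_nz by blast
  have "\<exists>u. \<forall>x\<in>ball x0 r. (u has_derivative (\<lambda>v. \<Sum>i\<in>UNIV. E x $ a $ i * v $ i)) (at x)" for a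
  proof -
    obtain u where "\<And>x. x \<in> ball x0 r \<Longrightarrow> (u has_derivative (\<lambda>v. \<Sum>i\<in>UNIV. E x $ a $ i * v $ i)) (at x)"
    proof (rule poincare_lemma[of x0 r "\<lambda>i x. E x $ a $ i"])
      show "smooth_on (ball x0 r) (\<lambda>x. E x $ a $ i)" for i by (rule smooth_on_subset[OF E_sm r(2)])
      show "pd (axis j 1) (\<lambda>x. E x $ a $ i) x = pd (axis i 1) (\<lambda>x. E x $ a $ j) x" if "x \<in> ball x0 r" for i j x
      proof -
        have x: "x \<in> X" using that r(2) by blast
        show ?thesis unfolding pdE[OF x] using Gam_sym[OF zX[OF x], of j i] by simp
      qed
    qed (rule that)
    then show ?thesis by blast
  qed
  then obtain u where u: "\<And>a x. x \<in> ball x0 r \<Longrightarrow> (u a has_derivative (\<lambda>v. \<Sum>i\<in>UNIV. E x $ a $ i * v $ i)) (at x)" by metis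
  define f where "f x = (\<chi> a. u a x)" for x
  have fD: "(f has_derivative (\<lambda>v. E x *v v)) (at x)" if "x \<in> ball x0 r" for x
    by (rule has_derivative_vecI) (use u[OF that] in \<open>simp add: f_def matrix_vector_mult_def\<close>)
  have f_sm: "smooth_map_on (ball x0 r) f"
  proof (rule smooth_map_on_vecI, rule smooth_on_from_pd[OF open_ball])
    show "(\<lambda>x. f x $ a) differentiable (at x)" if "x \<in> ball x0 r" for a x
      using u[OF that, of a] unfolding f_def differentiable_def by auto
    fix a and b :: "real^'b" assume "b \<in> Basis"
    then obtain j where j: "b = axis j 1" by (auto simp: Basis_vec_def)
    have "pd b (\<lambda>x. f x $ a) x = E x $ a $ j" if "x \<in> ball x0 r" for x
      using pd_eqI[OF u[OF that, of a], of b] unfolding f_def j vec_lambda_beta mult.commute[of "E x $ a $ _"] sum_axis by simp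
    then show "smooth_on (ball x0 r) (pd b (\<lambda>x. f x $ a))"
      using smooth_on_cong[OF open_ball smooth_on_subset[OF E_sm r(2)], of a j "pd b (\<lambda>x. f x $ a)"] by simp
  qed
  obtain S' V g where S': "open S'" "S' \<subseteq> ball x0 r" "x0 \<in> S'" "open V" "f x0 \<in> V" "homeomorphism S' V f g"
    and gd: "\<And>y. y \<in> V \<Longrightarrow> g differentiable (at y)"
  proof (rule smooth_inverse_function[OF open_ball f_sm _ fD])
    show "x0 \<in> ball x0 r" using r(1) by simp
    show "v = 0" if "E x0 *v v = 0" for v by (rule E_inj[OF X(2) that])
  qed (assumption | rule that)+
  \<comment> \<open>A ball is chosen because constancy of \<open>L\<close> along parallel fields is
    deduced from a zero derivative on the convex set \<open>W\<close>.\<close>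
  obtain \<rho> where \<rho>: "\<rho> > 0" "ball x0 \<rho> \<subseteq> S'" using S'(1,3) openE by blast
  define W where "W = ball x0 \<rho>"
  define V' where "V' = f ` W"
  have W: "open W" "x0 \<in> W" "W \<subseteq> ball x0 r" "W \<subseteq> X" "W \<subseteq> S'" "convex W" using \<rho> S'(2) r(2) by (auto simp: W_def)
  have V': "V' \<subseteq> V" using W(5) S'(6) unfolding V'_def homeomorphism_def by blast
  have hom: "homeomorphism W V' f g" by (rule homeomorphism_of_subsets[OF S'(6) W(5) V']) (simp add: V'_def)
  have "openin (top_of_set S') W" using W(1,5) by (simp add: open_subset)
  then have "openin (top_of_set V) V'" unfolding V'_def by (rule homeomorphism_imp_open_map[OF S'(6)])
  then have oV': "open V'" using S'(4) openin_open_trans by blast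
  have gW: "g y \<in> W" "f (g y) = y" if "y \<in> V'" for y using hom that unfolding homeomorphism_def by auto
  have gD: "(g has_derivative (\<lambda>b. matrix_inv (E (g y)) *v b)) (at y)" if y: "y \<in> V'" for y
  proof -
    obtain g' where g': "(g has_derivative g') (at y)" using gd y V' unfolding differentiable_def by blast
    have gr: "g y \<in> ball x0 r" "g y \<in> X" using gW[OF y] W by auto
    have "((\<lambda>y. f (g y)) has_derivative (\<lambda>b. E (g y) *v g' b)) (at y)"
      by (rule has_derivative_compose[OF g' fD[OF gr(1)]])
    moreover have "((\<lambda>y. f (g y)) has_derivative (\<lambda>b. b)) (at y)"
      by (rule has_derivative_transform_within_open[OF has_derivative_ident oV' y]) (simp add: gW)
    ultimately have "(\<lambda>b. E (g y) *v g' b) = (\<lambda>b. b)" by (rule has_derivative_unique)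
    then have "E (g y) *v g' b = b" for b by metis
    then have "matrix_inv (E (g y)) *v (E (g y) *v g' b) = matrix_inv (E (g y)) *v b" for b by simp
    then have "g' b = matrix_inv (E (g y)) *v b" for b
      by (simp add: matrix_vector_mul_assoc matrix_inv_left[OF E_inv[OF gr(2)]])
    then have "g' = (\<lambda>b. matrix_inv (E (g y)) *v b)" by (rule ext)
    then show ?thesis using g' by simp
  qed
  have E_smW: "smooth_on W (\<lambda>x. E x $ a $ i)" for a i by (rule smooth_on_subset[OF E_sm W(4)])
  have inv_sm: "smooth_on W (\<lambda>x. matrix_inv (E x) $ i $ j)" for i j
    by (rule smooth_on_matrix_inv[OF W(1) E_smW]) (use E_det W(4) in blast)
  \<comment> \<open>The inverse \<open>g\<close> is also only known to be differentiable. Its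
    derivative is the inverse of \<open>E\<close> at \<open>g y\<close>, so partials of
    \<open>h (g y)\<close> stay in the class of smooth functions of \<open>g y\<close>.\<close>
  have comp_sm: "smooth_on V' (\<lambda>y. h (g y))" if h: "smooth_on W h" for h
  proof (rule smooth_coinduct[OF oV', where P="\<lambda>f. \<exists>h. smooth_on W h \<and> f = (\<lambda>y. h (g y))"])
    show "\<exists>h'. smooth_on W h' \<and> (\<lambda>y. h (g y)) = (\<lambda>y. h' (g y))" using h by blast
    show "k differentiable (at y)" if k: "\<exists>h. smooth_on W h \<and> k = (\<lambda>y. h (g y))" and y: "y \<in> V'" for k y
    proof -
      obtain h where h: "smooth_on W h" "k = (\<lambda>y. h (g y))" using k by blast
      show ?thesis unfolding h(2)
        using has_derivative_compose[OF gD[OF y] pd_has_derivative[OF smooth_on_imp_differentiable[OF h(1) W(1) gW(1)[OF y]]]]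
        unfolding differentiable_def by blast
    qed
    show "\<exists>l. (\<exists>h. smooth_on W h \<and> l = (\<lambda>y. h (g y))) \<and> (\<forall>y\<in>V'. pd b k y = l y)"
      if kb: "\<exists>h. smooth_on W h \<and> k = (\<lambda>y. h (g y))" "b \<in> Basis" for k and b :: "real^'b"
    proof -
      obtain h where h: "smooth_on W h" "k = (\<lambda>y. h (g y))" using kb(1) by blast
      define l where "l x = (\<Sum>i\<in>UNIV. (\<Sum>a\<in>UNIV. matrix_inv (E x) $ i $ a * b $ a) * pd (axis i 1) h x)" for x
      have "smooth_on W l" unfolding l_def[abs_def]
        by (intro smooth_on_sum smooth_on_mult smooth_on_const W(1) inv_sm smooth_on_pd[OF h(1) axB])
      moreover have "pd b k y = l (g y)" if y: "y \<in> V'" for y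
      proof -
        note d = smooth_on_imp_differentiable[OF h(1) W(1) gW(1)[OF y]]
        have "pd b k y = pd (matrix_inv (E (g y)) *v b) h (g y)" unfolding h(2) by (rule pd_chain[OF gD[OF y] d])
        also have "\<dots> = l (g y)" by (subst pd_vec[OF d]) (simp add: l_def matrix_vector_mult_def)
        finally show ?thesis .
      qed
      ultimately show ?thesis by blast
    qed
  qed
  have g_sm: "smooth_map_on V' g"
    by (rule smooth_map_on_vecI, rule comp_sm, rule smooth_on_bounded_linear[OF W(1) bounded_linear_vec_nth])
  \<comment> \<open>The vector field whose components in the coordinates \<open>f\<close> are the
    constants \<open>s\<close>.\<close>
  define \<xi> where "\<xi> s x = matrix_inv (E x) *v s" for s x
  have \<xi>n: "\<xi> s x \<noteq> 0" if "x \<in> W" "s \<noteq> 0" for s x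
  proof
    assume "\<xi> s x = 0"
    then have "E x *v (matrix_inv (E x) *v s) = 0" unfolding \<xi>_def by simp
    moreover have "x \<in> X" using that W by blast
    ultimately show False using that(2) by (simp add: matrix_vector_mul_assoc matrix_inv_right[OF E_inv])
  qed
  have \<xi>par: "parallel_at (\<xi> s) x" if x: "x \<in> W" and s: "s \<noteq> 0" for s x
    unfolding parallel_at_def
  proof (rule has_derivative_vecI)
    fix k
    have xX: "x \<in> X" and xU: "x \<in> U" using x W X by auto
    have comp: "(\<lambda>x. \<xi> s x $ k) = (\<lambda>x. \<Sum>a\<in>UNIV. matrix_inv (E x) $ k $ a * s $ a)" for k
      by (simp add: \<xi>_def matrix_vector_mult_def)
    have dinv: "(\<lambda>x. matrix_inv (E x) $ k $ a) differentiable (at x)" for k a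
      using smooth_on_imp_differentiable[OF inv_sm W(1) x] .
    have d: "(\<lambda>x. \<xi> s x $ k) differentiable (at x)" unfolding comp by (intro differentiable_sum finite ballI differentiable_mult dinv differentiable_const)
    have pinv: "pd v (\<lambda>x. matrix_inv (E x) $ k $ a) x = - (\<Sum>b\<in>UNIV. \<Sum>l\<in>UNIV. matrix_inv (E x) $ k $ b * pd v (\<lambda>x. E x $ b $ l) x * matrix_inv (E x) $ l $ a)" for v a
      by (rule pd_matrix_inv[OF W(1) E_smW _ x]) (use E_det W(4) in blast)
    have "pd (axis j 1) (\<lambda>x. \<xi> s x $ k) x = - N j k (x, \<xi> s x)" for j
    proof -
      have "pd (axis j 1) (\<lambda>x. \<xi> s x $ k) x = (\<Sum>a\<in>UNIV. pd (axis j 1) (\<lambda>x. matrix_inv (E x) $ k $ a * s $ a) x)"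
        unfolding comp by (rule pd_sum) (intro differentiable_mult dinv differentiable_const)
      also have "\<dots> = (\<Sum>a\<in>UNIV. pd (axis j 1) (\<lambda>x. matrix_inv (E x) $ k $ a) x * s $ a)"
        by (intro sum.cong refl, subst pd_mult[OF dinv differentiable_const]) simp
      also have "\<dots> = - (\<Sum>a\<in>UNIV. \<Sum>b\<in>UNIV. \<Sum>l\<in>UNIV. matrix_inv (E x) $ k $ b * (\<Sum>m\<in>UNIV. Gam j l m (x, e x) * E x $ b $ m) * matrix_inv (E x) $ l $ a * s $ a)"
        unfolding pinv pdE[OF xX]
        by (simp add: sum_negf sum_distrib_right)
      also have "(\<Sum>a\<in>UNIV. \<Sum>b\<in>UNIV. \<Sum>l\<in>UNIV. matrix_inv (E x) $ k $ b * (\<Sum>m\<in>UNIV. Gam j l m (x, e x) * E x $ b $ m) * matrix_inv (E x) $ l $ a * s $ a)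
        = (\<Sum>l\<in>UNIV. (\<Sum>b\<in>UNIV. matrix_inv (E x) $ k $ b * (\<Sum>m\<in>UNIV. Gam j l m (x, e x) * E x $ b $ m)) * (\<Sum>a\<in>UNIV. matrix_inv (E x) $ l $ a * s $ a))"
      proof -
        have "(\<Sum>l\<in>UNIV. (\<Sum>b\<in>UNIV. P b l) * (\<Sum>a\<in>UNIV. Q l a)) = (\<Sum>a\<in>UNIV. \<Sum>b\<in>UNIV. \<Sum>l\<in>UNIV. P b l * Q l a)" for P Q :: "'b \<Rightarrow> 'b \<Rightarrow> real"
        proof -
          have "(\<Sum>l\<in>UNIV. (\<Sum>b\<in>UNIV. P b l) * (\<Sum>a\<in>UNIV. Q l a)) = (\<Sum>l\<in>UNIV. \<Sum>a\<in>UNIV. \<Sum>b\<in>UNIV. P b l * Q l a)"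
            by (simp add: sum_distrib_left sum_distrib_right)
          also have "\<dots> = (\<Sum>a\<in>UNIV. \<Sum>l\<in>UNIV. \<Sum>b\<in>UNIV. P b l * Q l a)" by (rule sum.swap)
          also have "\<dots> = (\<Sum>a\<in>UNIV. \<Sum>b\<in>UNIV. \<Sum>l\<in>UNIV. P b l * Q l a)" by (intro sum.cong refl sum.swap)
          finally show ?thesis .
        qed
        from this[of "\<lambda>b l. matrix_inv (E x) $ k $ b * (\<Sum>m\<in>UNIV. Gam j l m (x, e x) * E x $ b $ m)" "\<lambda>l a. matrix_inv (E x) $ l $ a * s $ a"]
        show ?thesis by (simp only: mult.assoc)
      qed
      also have "\<dots> = (\<Sum>l\<in>UNIV. Gam j l k (x, e x) * \<xi> s x $ l)"
      proof (intro sum.cong refl arg_cong2[where f="(*)"])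
        fix l
        have "(\<Sum>b\<in>UNIV. matrix_inv (E x) $ k $ b * (\<Sum>m\<in>UNIV. Gam j l m (x, e x) * E x $ b $ m)) = (\<Sum>b\<in>UNIV. \<Sum>m\<in>UNIV. Gam j l m (x, e x) * (matrix_inv (E x) $ k $ b * E x $ b $ m))"
          by (simp add: sum_distrib_left mult_ac)
        also have "\<dots> = (\<Sum>m\<in>UNIV. Gam j l m (x, e x) * (\<Sum>b\<in>UNIV. matrix_inv (E x) $ k $ b * E x $ b $ m))"
          by (subst sum.swap) (simp add: sum_distrib_left)
        finally show "(\<Sum>b\<in>UNIV. matrix_inv (E x) $ k $ b * (\<Sum>m\<in>UNIV. Gam j l m (x, e x) * E x $ b $ m)) = Gam j l k (x, e x)"
          unfolding matrix_inv_left_entry[OF E_inv[OF xX]] by simp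
        show "(\<Sum>a\<in>UNIV. matrix_inv (E x) $ l $ a * s $ a) = \<xi> s x $ l" by (simp add: \<xi>_def matrix_vector_mult_def)
      qed
      \<comment> \<open>Here the Berwald property enters: \<open>Gam\<close> was obtained at
        \<open>e x\<close> but is needed at \<open>\<xi> s x\<close>.\<close>
      also have "\<dots> = N j k (x, \<xi> s x)"
        unfolding N_Gam[OF n xU \<xi>n[OF x s] e0[OF xX]] by (simp add: mult.commute)
      finally show ?thesis .
    qed
    then have "pd v (\<lambda>x. \<xi> s x $ k) x = (\<chi> k. - (\<Sum>i\<in>UNIV. v $ i * N i k (x, \<xi> s x))) $ k" for v
      by (subst pd_vec[OF d]) (simp add: sum_negf)
    then show "((\<lambda>x. \<xi> s x $ k) has_derivative (\<lambda>v. (\<chi> k. - (\<Sum>i\<in>UNIV. v $ i * N i k (x, \<xi> s x))) $ k)) (at x)"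
      using pd_has_derivative[OF d] by simp
  qed
  have L_const: "L (x, \<xi> s x) = L (x0, \<xi> s x0)" if x: "x \<in> W" and s: "s \<noteq> 0" for s x
  proof -
    have "\<exists>k. \<forall>x\<in>W. L (x, \<xi> s x) = k"
    proof (rule has_derivative_zero_constant[OF W(6)])
      fix x assume x: "x \<in> W"
      have z: "(x, \<xi> s x) \<in> Om" using \<xi>n[OF x s] x W X by auto
      from along_parallel[OF \<xi>par[OF x s] z sm_L]
      show "((\<lambda>x. L (x, \<xi> s x)) has_derivative (\<lambda>h. 0)) (at x within W)"
        unfolding DX_L[OF z] by (simp add: has_derivative_at_withinI)
    qed
    then show ?thesis using x W(2) by metis
  qed
  define N0 where "N0 s = Floc F c (x0, \<xi> s x0)" for s
  show ?thesis
  proof (rule that[of W V' f g N0])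
    show "W \<subseteq> U" using W X by auto
    show "smooth_map_on W f" using f_sm smooth_on_subset[OF _ W(3)] unfolding smooth_map_on_def by blast
    fix x v assume x: "x \<in> W"
    have xX: "x \<in> X" and xr: "x \<in> ball x0 r" and xU: "x \<in> U" using x W X by auto
    have fr: "frechet_derivative f (at x) v = E x *v v" using frechet_derivative_at[OF fD[OF xr]] by metis
    have \<xi>v: "\<xi> (E x *v v) x = v" unfolding \<xi>_def by (simp add: matrix_vector_mul_assoc matrix_inv_left[OF E_inv[OF xX]])
    show "Floc F c (x, v) = N0 (frechet_derivative f (at x) v)"
    proof (cases "v = 0")
      case True
      then show ?thesis unfolding fr N0_def using F_zero[OF xU] F_zero[OF x0] by (simp add: \<xi>_def)
    next
      case False
      then have "E x *v v \<noteq> 0" using E_inj[OF xX] by blast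
      from L_const[OF x this] have "(Floc F c (x, v))\<^sup>2 = (N0 (E x *v v))\<^sup>2"
        unfolding \<xi>v N0_def Lsq_def .
      then show ?thesis unfolding fr
        by (rule power2_eq_imp_eq) (use F_nonneg xU x0 in \<open>auto simp: N0_def\<close>)
    qed
  qed (use W oV' hom g_sm in auto)
qed

section \<open>The theorem\<close>

lemma smooth_compat_compose:
  fixes g h k :: "real^'n \<Rightarrow> real^'n"
  assumes S: "open S" and T: "open T" and g: "smooth_map_on S g" "\<And>x. x \<in> S \<Longrightarrow> g x \<in> T"
    and h: "smooth_map_on T h" and eq: "\<And>x. x \<in> S \<Longrightarrow> h (g x) = k x"
  shows "smooth_map_on S k"
  unfolding smooth_map_on_def
proof
  fix b :: "real^'n" assume "b \<in> Basis"
  then have "smooth_on T (\<lambda>x. h x \<bullet> b)" using h unfolding smooth_map_on_def by blast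
  from smooth_on_compose[OF S T g this]
  show "smooth_on S (\<lambda>x. k x \<bullet> b)" 
  proof (rule smooth_on_cong[OF S])
    fix x assume "x \<in> S"
    then show "h (g x) \<bullet> b = k x \<bullet> b" by (simp only: eq)
  qed
qed

lemma smooth_map_on_subset: "smooth_map_on S f \<Longrightarrow> T \<subseteq> S \<Longrightarrow> smooth_map_on T f"
  unfolding smooth_map_on_def using smooth_on_subset by blast

lemma smooth_map_on_frechet:
  assumes "smooth_map_on S f" "open S" "x \<in> S"
  shows "(f has_derivative frechet_derivative f (at x)) (at x)"
  using smooth_map_on_has_derivative[OF assms] unfolding frechet_derivative_works[symmetric] differentiable_def by blast

text \<open>The required chart is \<open>c\<close> followed by \<open>f\<close>. Its transition to
  any other chart factors through \<open>c\<close>, so \<open>F\<close> in the new components is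
  evaluated in \<open>c\<close> on a vector that \<open>f\<close> sends back to those components,
  which gives \<open>N0\<close>.\<close>

lemma flat_chart:
  fixes A :: "('m::topological_space, 'n::finite) chart set"
    and f g :: "real^'n \<Rightarrow> real^'n"
  assumes fin: "finsler A F" and c: "c \<in> A" and p: "p \<in> fst c"
    and W: "open W" "snd c p \<in> W" "W \<subseteq> snd c ` fst c" and V: "open V" and hom: "homeomorphism W V f g"
    and f: "smooth_map_on W f" and g: "smooth_map_on V g"
    and N0: "\<And>x v. x \<in> W \<Longrightarrow> Floc F c (x, v) = N0 (frechet_derivative f (at x) v)"
  shows "\<exists>e :: ('m, 'n) chart. p \<in> fst e \<and> is_chart e \<and>
      (\<forall>c\<in>A. smooth_compat e c \<and> smooth_compat c e) \<and>
      (\<forall>q1\<in>fst e. \<forall>q2\<in>fst e. \<forall>c1\<in>A. \<forall>c2\<in>A. \<forall>y. q1 \<in> fst c1 \<longrightarrow> q2 \<in> fst c2 \<longrightarrow>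
         F c1 q1 (dtrans e c1 q1 y) = F c2 q2 (dtrans e c2 q2 y))"
proof -
  have charts: "is_chart d" if "d \<in> A" for d using fin that unfolding finsler_def smooth_atlas_def by blast
  have compat: "smooth_compat d d'" if "d \<in> A" "d' \<in> A" for d d' using fin that unfolding finsler_def smooth_atlas_def by blast
  have cc: "is_chart c" by (rule charts[OF c])
  define M where "M = fst c \<inter> snd c -` W"
  define e where "e = (M, f \<circ> snd c)"
  have fe: "fst e = M" "snd e q = f (snd c q)" for q by (auto simp: e_def)
  have c_hom: "homeomorphism (fst c) (snd c ` fst c) (snd c) (cinv c)" and oc: "open (fst c)"
    using cc unfolding is_chart_def cinv_def by auto
  have oM: "open M" unfolding M_def
    by (rule continuous_open_preimage[OF _ oc W(1)]) (use c_hom in \<open>simp add: homeomorphism_def\<close>)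
  have cM: "snd c ` M = W"
  proof
    show "W \<subseteq> snd c ` M"
    proof
      fix x assume x: "x \<in> W"
      then have "x \<in> snd c ` fst c" using W(3) by blast
      then show "x \<in> snd c ` M" using chart_cinv[OF cc] x unfolding M_def by (intro image_eqI[of _ _ "cinv c x"]) auto
    qed
  qed (auto simp: M_def)
  have fW: "f ` W = V" "\<And>x. x \<in> W \<Longrightarrow> g (f x) = x" "\<And>y. y \<in> V \<Longrightarrow> f (g y) = y" "\<And>y. y \<in> V \<Longrightarrow> g y \<in> W"
    using hom unfolding homeomorphism_def by auto
  have "homeomorphism M W (snd c) (cinv c)"
    by (rule homeomorphism_of_subsets[OF c_hom]) (use cM W(3) in \<open>auto simp: M_def\<close>)
  from homeomorphism_compose[OF this hom]
  have e_hom: "homeomorphism M V (snd e) (cinv c \<circ> g)" by (simp add: e_def)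
  have eM: "snd e ` M = V" and einj: "inj_on (snd e) M"
    using e_hom unfolding homeomorphism_def by (auto intro: inj_on_inverseI)
  have einv: "cinv e y = cinv c (g y)" if "y \<in> V" for y
  proof -
    have "cinv c (g y) \<in> M" "snd e (cinv c (g y)) = y" using e_hom that unfolding homeomorphism_def by auto
    then show ?thesis unfolding cinv_def[of e] fe(1) using inv_into_f_eq[OF einj] by blast
  qed
  have ech: "is_chart e"
    unfolding is_chart_def fe(1) eM
  proof (intro conjI oM V)
    show "homeomorphism M V (snd e) (inv_into M (snd e))"
      by (rule homeomorphism_cong[OF e_hom]) (use einv in \<open>auto simp: cinv_def[of e] fe(1)\<close>)
  qed
  have compat_e: "smooth_compat e d" and compat_d: "smooth_compat d e" if d: "d \<in> A" for d
  proof -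
    have od: "open (fst d)" using charts[OF d] unfolding is_chart_def by blast
    have o1: "open (snd e ` (M \<inter> fst d))" using chart_open_image[OF ech] oM od fe(1) by auto
    have o2: "open (snd c ` (fst c \<inter> fst d))" using chart_open_image[OF cc] oc od by auto
    have o3: "open (snd d ` (fst d \<inter> M))" using chart_open_image[OF charts[OF d]] oM od by auto
    have inV: "y \<in> V" if "y \<in> snd e ` (M \<inter> fst d)" for y using that eM by blast
    show "smooth_compat e d"
      unfolding smooth_compat_def fe(1)
    proof (rule smooth_compat_compose[OF o1 o2 smooth_map_on_subset[OF g]])
      show "smooth_map_on (snd c ` (fst c \<inter> fst d)) (snd d \<circ> cinv c)" using compat[OF c d] unfolding smooth_compat_def .
      show "snd e ` (M \<inter> fst d) \<subseteq> V" using inV by blast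
      fix y assume y: "y \<in> snd e ` (M \<inter> fst d)"
      then obtain q where q: "q \<in> M" "q \<in> fst d" "y = f (snd c q)" by (auto simp: fe)
      then have "g y = snd c q" using fW(2) by (auto simp: M_def)
      then show "g y \<in> snd c ` (fst c \<inter> fst d)" using q by (auto simp: M_def)
      show "(snd d \<circ> cinv c) (g y) = (snd d \<circ> cinv e) y" using einv[OF inV[OF y]] by simp
    qed
    show "smooth_compat d e"
      unfolding smooth_compat_def fe(1)
    proof (rule smooth_compat_compose[OF o3 W(1) smooth_map_on_subset _ f])
      show "smooth_map_on (snd d ` (fst d \<inter> fst c)) (snd c \<circ> cinv d)" using compat[OF d c] unfolding smooth_compat_def .
      show "snd d ` (fst d \<inter> M) \<subseteq> snd d ` (fst d \<inter> fst c)" by (auto simp: M_def)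
      fix x assume "x \<in> snd d ` (fst d \<inter> M)"
      then show "(snd c \<circ> cinv d) x \<in> W" using cinv_chart[OF charts[OF d]] by (auto simp: M_def)
      show "f ((snd c \<circ> cinv d) x) = (snd e \<circ> cinv d) x" by (simp add: fe)
    qed
  qed
  have main: "F d q (dtrans e d q y) = N0 y" if q: "q \<in> M" "d \<in> A" "q \<in> fst d" for d q y
  proof -
    have qc: "q \<in> fst c" "snd c q \<in> W" using q by (auto simp: M_def)
    define x where "x = snd c q"
    have fx: "f x \<in> V" "g (f x) = x" "snd e q = f x" using qc fW unfolding x_def fe by auto
    have od: "open (fst d)" using charts[OF q(2)] unfolding is_chart_def by blast
    have o1: "open (snd e ` (M \<inter> fst d))" using chart_open_image[OF ech] oM od fe(1) by auto
    have o2: "open (snd c ` (fst c \<inter> fst d))" using chart_open_image[OF cc] oc od by auto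
    have Dg: "(g has_derivative frechet_derivative g (at (f x))) (at (f x))"
      by (rule smooth_map_on_frechet[OF g V fx(1)])
    have Df: "(f has_derivative frechet_derivative f (at x)) (at x)"
      by (rule smooth_map_on_frechet[OF f W(1)]) (use qc in \<open>simp add: x_def\<close>)
    have Dt: "(trans_map c d has_derivative dtrans c d q) (at x)"
    proof -
      have "x \<in> snd c ` (fst c \<inter> fst d)" using qc q by (auto simp: x_def)
      then have "(trans_map c d has_derivative frechet_derivative (trans_map c d) (at x)) (at x)"
        using smooth_map_on_frechet[OF _ o2] compat[OF c q(2)] unfolding smooth_compat_def trans_map_def by blast
      moreover have "dtrans c d q = frechet_derivative (trans_map c d) (at x)" by (auto simp: dtrans_def x_def)
      ultimately show ?thesis by simp
    qed
    have "((\<lambda>y. trans_map c d (g y)) has_derivative (\<lambda>v. dtrans c d q (frechet_derivative g (at (f x)) v))) (at (f x))"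
      by (rule has_derivative_compose[OF Dg]) (use Dt fx(2) in simp)
    then have "(trans_map e d has_derivative (\<lambda>v. dtrans c d q (frechet_derivative g (at (f x)) v))) (at (f x))"
      by (rule has_derivative_transform_within_open[OF _ V fx(1)]) (simp add: trans_map_def einv)
    from frechet_derivative_at[OF this]
    have 1: "dtrans e d q y = dtrans c d q (frechet_derivative g (at (f x)) y)" unfolding dtrans_def[of e] fx(3) by metis
    have "((\<lambda>y. f (g y)) has_derivative (\<lambda>v. frechet_derivative f (at x) (frechet_derivative g (at (f x)) v))) (at (f x))"
      by (rule has_derivative_compose[OF Dg]) (use Df fx(2) in simp)
    moreover have "((\<lambda>y. f (g y)) has_derivative (\<lambda>v. v)) (at (f x))"
      by (rule has_derivative_transform_within_open[OF has_derivative_ident V fx(1)]) (simp add: fW)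
    ultimately have "(\<lambda>v. frechet_derivative f (at x) (frechet_derivative g (at (f x)) v)) = (\<lambda>v. v)"
      by (rule has_derivative_unique)
    then have 2: "frechet_derivative f (at x) (frechet_derivative g (at (f x)) y) = y" by metis
    have "F d q (dtrans e d q y) = F c q (frechet_derivative g (at (f x)) y)"
      unfolding 1 using fin c q qc unfolding finsler_def by blast
    also have "\<dots> = Floc F c (x, frechet_derivative g (at (f x)) y)"
      unfolding Floc_def x_def using cinv_chart[OF cc qc(1)] by simp
    also have "\<dots> = N0 y" using N0[of x "frechet_derivative g (at (f x)) y"] qc 2 by (simp add: x_def)
    finally show ?thesis .
  qed
  show ?thesis
  proof (intro exI[of _ e] conjI ballI allI impI)
    show "p \<in> fst e" using p W(2) by (simp add: fe M_def)
    show "F c1 q1 (dtrans e c1 q1 y) = F c2 q2 (dtrans e c2 q2 y)"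
      if "q1 \<in> fst e" "q2 \<in> fst e" "c1 \<in> A" "c2 \<in> A" "q1 \<in> fst c1" "q2 \<in> fst c2" for q1 q2 c1 c2 y
      using main[of q1 c1 y] main[of q2 c2 y] that by (simp add: fe)
  qed (use ech compat_e compat_d in auto)
qed

text \<open>The mean torsion pulls back through the injective Jacobian of an isometry. Read
  contrapositively, a nonzero torsion over one point provides one over every point.\<close>

lemma torsion_free_transfer:
  assumes fin: "finsler A F" and hom: "homogeneous A F" and c: "c \<in> A" "d \<in> A"
    and x: "x \<in> snd c ` fst c" "x' \<in> snd d ` fst d"
    and 0: "\<And>y k. y \<noteq> 0 \<Longrightarrow> DY k (finsler_chart.tau0 F d) (x', y) = 0" and y: "y \<noteq> 0"
  shows "DY k (finsler_chart.tau0 F c) (x, y) = 0"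
proof -
  obtain \<Phi> W where iso: "finsler_isometry F c d \<Phi> W" "x \<in> W" "\<Phi> x = x'"
    using homogeneous_isometry[OF fin hom c x] .
  interpret T: finsler_isometry F c d \<Phi> W by (rule iso(1))
  have z: "(x, y) \<in> T.OmW" using iso(2) y by auto
  show ?thesis
    unfolding T.DY_tau0_T[OF z] using 0 T.jac_inj[OF iso(2) y] iso(3) by (simp add: T.T_def)
qed

theorem theorem1p1:
  fixes A :: "('m::{t2_space, second_countable_topology}, 'n::finite) chart set"
    and F :: "('m, 'n) tbfun"
  assumes "smooth_atlas A"
    and "connected (UNIV :: 'm set)"
    and "finsler A F"
    and "homogeneous A F"
    and "isotropic_S A F"
    and "CARD('n) \<ge> 2"
    and "CARD('n) = 2 \<Longrightarrow> flag_curv_le0 A F"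
    and "CARD('n) > 2 \<Longrightarrow> flag_curv_lt0 A F"
  shows "riemannian A F \<or> locally_minkowskian A F"
proof -
  note fin = assms(3) and hom = assms(4) and n2 = assms(6)
  have K: "flag_curv F c x y u \<le> 0" if "c \<in> A" "x \<in> snd c ` fst c" "y \<noteq> 0" "u \<notin> span {y}" for c x y u
  proof (cases "CARD('n) = 2")
    case True
    then show ?thesis using assms(7) that unfolding flag_curv_le0_def by blast
  next
    case False
    then have "flag_curv_lt0 A F" using assms(8) n2 by simp
    then have "flag_curv F c x y u < 0" using that unfolding flag_curv_lt0_def by blast
    then show ?thesis by simp
  qed
  have core: "finsler_core F c (\<lambda>x. ln (sigmaBH F c x))" if c: "c \<in> A" for c
  proof -
    interpret T: finsler_trans F c by (rule homogeneous_finsler_trans[OF fin hom c])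
    obtain cf where cf: "\<And>x y. x \<in> snd c ` fst c \<Longrightarrow> y \<noteq> 0 \<Longrightarrow>
        Scurv F c (x, y) = (real CARD('n) + 1) * cf (cinv c x) * Floc F c (x, y)"
      using assms(5) c unfolding isotropic_S_def by blast
    have "Scurv F c (x, y) = 0" if "x \<in> snd c ` fst c" "y \<noteq> 0" for x y
      by (rule T.S_zero[where k="\<lambda>x. (real CARD('n) + 1) * cf (cinv c x)", OF cf that])
    then interpret S: finsler_S0 F c "\<lambda>x. ln (sigmaBH F c x)" by (rule T.finsler_S0I)
    show ?thesis by unfold_locales (use K[OF c] in blast)
  qed
  \<comment> \<open>The split is on whether the mean torsion vanishes in all charts: if so, Deicke's
    theorem applies on each fibre; if not, \<open>I_zero\<close> excludes dimensions above 2 and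
    flat coordinates exist around every point.\<close>
  show ?thesis
  proof (cases "\<forall>c\<in>A. \<forall>x\<in>snd c ` fst c. \<forall>y k. y \<noteq> 0 \<longrightarrow> DY k (finsler_chart.tau0 F c) (x, y) = 0")
    case True
    have "riemannian A F"
      unfolding riemannian_def
    proof (intro ballI allI impI)
      fix c x and y y' :: "real^'n" and i j
      assume c: "c \<in> A" and x: "x \<in> snd c ` fst c" and y: "y \<noteq> 0" "y' \<noteq> 0"
      interpret C: finsler_chart F c by (rule finsler_finsler_chart[OF fin c])
      show "gten F c i j (x, y) = gten F c i j (x, y')"
        by (rule C.deicke[OF x _ n2 y]) (use True c x in blast)
    qed
    then show ?thesis ..
  next
    case False
    then obtain c0 x0 y0 k0 where ne: "c0 \<in> A" "x0 \<in> snd c0 ` fst c0" "y0 \<noteq> 0" "DY k0 (finsler_chart.tau0 F c0) (x0, y0) \<noteq> 0"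
      by blast
    have n: "CARD('n) = 2"
    proof (rule ccontr)
      assume "CARD('n) \<noteq> 2"
      then have lt: "flag_curv_lt0 A F" using assms(8) n2 by simp
      interpret finsler_core F c0 "\<lambda>x. ln (sigmaBH F c0 x)" by (rule core[OF ne(1)])
      have "DY k0 tau0 (x0, y0) = 0"
        by (rule I_zero) (use lt ne in \<open>auto simp: flag_curv_lt0_def\<close>)
      then show False using ne(4) by simp
    qed
    have "locally_minkowskian A F"
      unfolding locally_minkowskian_def
    proof
      fix p :: 'm
      obtain c where c: "c \<in> A" "p \<in> fst c" using assms(1) unfolding smooth_atlas_def by blast
      interpret C: finsler_core F c "\<lambda>x. ln (sigmaBH F c x)" by (rule core[OF c(1)])
      have x: "snd c p \<in> snd c ` fst c" using c(2) by blast
      have "\<exists>y k. y \<noteq> 0 \<and> DY k C.tau0 (snd c p, y) \<noteq> 0"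
        using torsion_free_transfer[OF fin hom ne(1) c(1) ne(2) x _ ne(3), of k0] ne(4) by blast
      then obtain y k where yk: "y \<noteq> 0" "DY k C.tau0 (snd c p, y) \<noteq> 0" by blast
      have "(snd c p, y) \<in> C.Om" using x yk(1) by blast
      then have Ik: "C.I k (snd c p, y) \<noteq> 0" using yk(2) C.DY_tau by simp
      show "\<exists>e :: ('m, 'n) chart. p \<in> fst e \<and> is_chart e \<and>
          (\<forall>c\<in>A. smooth_compat e c \<and> smooth_compat c e) \<and>
          (\<forall>q1\<in>fst e. \<forall>q2\<in>fst e. \<forall>c1\<in>A. \<forall>c2\<in>A. \<forall>y. q1 \<in> fst c1 \<longrightarrow> q2 \<in> fst c2 \<longrightarrow>
             F c1 q1 (dtrans e c1 q1 y) = F c2 q2 (dtrans e c2 q2 y))"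
      proof (rule C.flat_coordinates[OF n x yk(1) Ik])
        fix W V and f g :: "real^'n \<Rightarrow> real^'n" and N0
        assume a: "open W" "snd c p \<in> W" "W \<subseteq> snd c ` fst c" "open V" "homeomorphism W V f g"
          "smooth_map_on W f" "smooth_map_on V g"
          "\<And>x v. x \<in> W \<Longrightarrow> Floc F c (x, v) = N0 (frechet_derivative f (at x) v)"
        show ?thesis by (rule flat_chart[OF fin c a])
      qed
    qed
    then show ?thesis ..
  qed
qed

end
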